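(* Assume A1–A5 (stated in the context) and put $s=\frac{r}{2-4r}$, so that $r=\frac{2s}{1+4s}$. Then for every $P_0>0$ the ball $$\bar{\mathbb{B}}^s_{2\infty}(P_0)=\Bigl\{f=\sum_{j=1}^\infty\theta_j\phi_j:\ \theta_j\in\mathbb{R},\ \sup_{\lambda>0}\lambda^{2s}\sum_{j>\lambda}\theta_j^2\le P_0\Bigr\}$$ is a maxiset for the test statistics $T_n$.
   Context: Setting. Fix $0<r<1/2$ and $\sigma>0$. One observes $dY_n(t)=f(t)\,dt+\frac{\sigma}{\sqrt n}\,dw(t)$, $t\in[0,1]$, with unknown signal $f\in L_2(0,1)$ and Gaussian white noise $dw$. Let $(\phi_j)_{j\ge1}$ be an orthonormal basis of $L_2(0,1)$; then $y_j=\int_0^1\phi_j\,dY_n=\theta_j+\frac{\sigma}{\sqrt n}\xi_j$ with $\theta_j=\int_0^1f\phi_j\,dt$ and $\xi_j$ i.i.d. standard Gaussian. The hypothesis is $f=0$. The test statistics are $$T_n=\sum_{j=1}^\infty\kappa_{nj}^2y_j^2-\sigma^2n^{-1}\rho_n,\qquad \rho_n=\sum_{j=1}^\infty\kappa_{nj}^2 .$$ Assumptions on the coefficients. $[\cdot]$ is the integer part; $a_n\asymp b_n$ means that $a_n/b_n$ is bounded between two positive constants. A1: for each $n$ the sequence $\kappa_{nj}^2$, $j\ge1$, is decreasing. A2: there are positive constants $C_1,C_2$ such that $C_1<A_n=\sigma^{-4}n^2\sum_{j=1}^\infty\kappa_{nj}^4<C_2$ for each $n$. A3: there are positive constants $c_1,c_2$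 such that $c_1n^{-2r}\le\rho_n\le c_2n^{-2r}$. Put $k_n=\sup\{k:\sum_{j<k}\kappa_{nj}^2\le\frac12\rho_n\}$ and $\kappa_n^2=\kappa_{nk_n}^2$. A4: there are $C_1$ and $\lambda>1$ such that $\kappa^2_{n,[(1+\delta)k_n]}<C_1(1+\delta)^{-\lambda}\kappa_n^2$ for any $\delta>0$ and each $n$. A5: $\kappa_{n1}^2\asymp\kappa_n^2$ as $n\to\infty$, and for any $c>1$ there is $C>0$ such that $\kappa_{n,[ck_n]}^2\ge C\kappa_n^2$ for all $n$. Tests. A test $K_n$ generated by $T_n$ rejects the hypothesis when $T_n$ exceeds a threshold; $\alpha(K_n)$ and $\beta(K_n,f)$ are its type I error probability and its type II error probability at $f$. A sequence $f_n$ is consistent if for any $\alpha\in(0,1)$, for tests $K_n$ generated by $T_n$ with $\alpha(K_n)=\alpha(1+o(1))$, one has $\limsup_{n}\beta(K_n,f_n)<1-\alpha$. It is inconsistent if for each sequence of tests $K_n$ generated by $T_n$ one has $\liminf_{n}(\alpha(K_n)+\beta(K_n,f_n))\ge1$. For alternatives $f_{n_i}$ given only along $n_i\to\infty$ ("subsequences") the same definitions are used with the limits taken along $n_i$. Maxisets. A set $W\subset L_2(0,1)$ is ortho-symmetric if $\sum_j\theta_j\phi_j\in W$ implies $\sum_j\tilde\theta_j\phi_j\in W$ for all choices $\tilde\theta_j\in\{\theta_j,-\theta_j\}$. For a closed, bounded, convex, ortho-symmetric set $U$ let $\Xi=\bigcup_{\gamma>0}\gamma U$ be the space with unit ball $U$.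 A bounded ortho-symmetric closed set $U$ is called a maxiset if: (i) any subsequence of alternatives $f_{n_i}\in\gamma U$ ($\gamma>0$) with $cn_i^{-r}<\|f_{n_i}\|<Cn_i^{-r}$ (for constants $0<c<C$), $n_i\to\infty$, is consistent; (ii) if $f\in L_2(0,1)$, $f\notin\Xi$, then in any convex ortho-symmetric set $V$ containing $f$ there is an inconsistent subsequence of alternatives $f_{n_i}\in V$ with $cn_i^{-r}<\|f_{n_i}\|<Cn_i^{-r}$ for some constants $0<c<C$, where $n_i\to\infty$. *)

theory Defs
  imports "HOL-Probability.Probability" "HOL-Library.Landau_Symbols"
begin

section \<open>The Hilbert space of square integrable functions on the unit interval\<close>

abbreviation unit_interval_measure :: "real measure" where
  "unit_interval_measure \<equiv> lebesgue_on {0<..<1}"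

definition square_integrable :: "(real \<Rightarrow> real) \<Rightarrow> bool" where
  "square_integrable f \<longleftrightarrow> f \<in> borel_measurable unit_interval_measure \<and>
     integrable unit_interval_measure (\<lambda>t. (f t)\<^sup>2)"

lemma square_integrable_zero: "square_integrable (\<lambda>t. 0)"
  by (simp add: square_integrable_def)

lemma square_integrable_mult:
  assumes "square_integrable f" "square_integrable g"
  shows "integrable unit_interval_measure (\<lambda>t. f t * g t)"
proof (rule Bochner_Integration.integrable_bound)
  show "integrable unit_interval_measure (\<lambda>t. (f t)\<^sup>2 + (g t)\<^sup>2)"
    using assms by (simp add: square_integrable_def)
  show "(\<lambda>t. f t * g t) \<in> borel_measurable unit_interval_measure"
    using assms unfolding square_integrable_def by (blast intro: borel_measurable_times)
  have "\<bar>x * y\<bar> \<le> \<bar>x\<^sup>2 + y\<^sup>2\<bar>" for x y :: real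
  proof -
    have "0 \<le> (\<bar>x\<bar> - \<bar>y\<bar>)\<^sup>2" by simp
    then have "2 * (\<bar>x\<bar> * \<bar>y\<bar>) \<le> x\<^sup>2 + y\<^sup>2"
      by (simp add: power2_diff)
    moreover have "0 \<le> \<bar>x\<bar> * \<bar>y\<bar>" by simp
    ultimately show ?thesis unfolding abs_mult by linarith
  qed
  then show "AE t in unit_interval_measure. norm (f t * g t) \<le> norm ((f t)\<^sup>2 + (g t)\<^sup>2)"
    by simp
qed

lemma square_integrable_add:
  assumes "square_integrable f" "square_integrable g"
  shows "square_integrable (\<lambda>t. f t + g t)"
  using assms square_integrable_mult[OF assms]
  by (auto simp: square_integrable_def power2_sum mult.assoc)

lemma square_integrable_scale:
  assumes "square_integrable f"
  shows "square_integrable (\<lambda>t. c * f t)"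
  using assms by (auto simp: square_integrable_def power_mult_distrib)

text \<open>\<open>L2\<close> is the space $L_2(0,1)$ itself: its elements are classes of functions
  that agree almost everywhere.\<close>

quotient_type L2 = "real \<Rightarrow> real" / partial:
  "\<lambda>f g. square_integrable f \<and> square_integrable g \<and> (AE t in unit_interval_measure. f t = g t)"
proof (rule part_equivpI)
  show "\<exists>f. square_integrable f \<and> square_integrable f \<and> (AE t in unit_interval_measure. f t = f t)"
    using square_integrable_zero by auto
  show "symp (\<lambda>f g. square_integrable f \<and> square_integrable g \<and>
      (AE t in unit_interval_measure. f t = g t))"
    by (auto simp: symp_def elim: eventually_mono)
  show "transp (\<lambda>f g. square_integrable f \<and> square_integrable g \<and>
      (AE t in unit_interval_measure. f t = g t))"
    unfolding transp_def by (auto elim: eventually_elim2)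
qed

instantiation L2 :: real_vector
begin

lift_definition zero_L2 :: L2 is "\<lambda>t. 0"
  by (simp add: square_integrable_zero)

lift_definition plus_L2 :: "L2 \<Rightarrow> L2 \<Rightarrow> L2" is "\<lambda>f g t. f t + g t"
  by (auto intro: square_integrable_add elim: eventually_elim2)

lift_definition scaleR_L2 :: "real \<Rightarrow> L2 \<Rightarrow> L2" is "\<lambda>c f t. c * f t"
  by (auto intro: square_integrable_scale elim: eventually_mono)

definition uminus_L2 :: "L2 \<Rightarrow> L2" where "uminus_L2 f = (-1) *\<^sub>R f"

definition minus_L2 :: "L2 \<Rightarrow> L2 \<Rightarrow> L2" where "minus_L2 f g = f + - g"

instance
proof
  fix a b c :: L2 and x y :: real
  show "a + b + c = a + (b + c)"
    by transfer (auto simp: add.assoc intro!: square_integrable_add)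
  show "a + b = b + a"
    by transfer (auto simp: add.commute intro!: square_integrable_add)
  show "0 + a = a"
    by transfer auto
  show "- a + a = 0"
    unfolding uminus_L2_def
    by transfer (use square_integrable_scale[of _ "-1"] in
        \<open>auto simp: square_integrable_zero intro!: square_integrable_add\<close>)
  show "a - b = a + - b"
    by (fact minus_L2_def)
  show "x *\<^sub>R (a + b) = x *\<^sub>R a + x *\<^sub>R b"
    by transfer (auto simp: distrib_left intro!: square_integrable_add square_integrable_scale)
  show "(x + y) *\<^sub>R a = x *\<^sub>R a + y *\<^sub>R a"
    by transfer (auto simp: distrib_right intro!: square_integrable_add square_integrable_scale)
  show "x *\<^sub>R y *\<^sub>R a = (x * y) *\<^sub>R a"
    by transfer (auto simp: mult.assoc intro!: square_integrable_scale)
  show "1 *\<^sub>R a = a"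
    by transfer auto
qed

end

instantiation L2 :: real_inner
begin

lift_definition inner_L2 :: "L2 \<Rightarrow> L2 \<Rightarrow> real" is
  "\<lambda>f g. LINT t|unit_interval_measure. f t * g t"
  by (rule integral_cong_AE)
    (auto simp: square_integrable_def elim: eventually_elim2)

definition norm_L2 :: "L2 \<Rightarrow> real" where "norm_L2 f = sqrt (f \<bullet> f)"

definition sgn_L2 :: "L2 \<Rightarrow> L2" where "sgn_L2 f = f /\<^sub>R norm f"

definition dist_L2 :: "L2 \<Rightarrow> L2 \<Rightarrow> real" where "dist_L2 f g = norm (f - g)"

definition uniformity_L2 :: "(L2 \<times> L2) filter" where
  "uniformity_L2 = (INF e\<in>{0<..}. principal {(f, g). dist f g < e})"

definition open_L2 :: "L2 set \<Rightarrow> bool" where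
  "open_L2 U \<longleftrightarrow> (\<forall>f\<in>U. \<forall>\<^sub>F (f', g) in uniformity. f' = f \<longrightarrow> g \<in> U)"

instance
proof
  fix f g h :: L2 and c :: real and U :: "L2 set"
  show "dist f g = norm (f - g)" by (fact dist_L2_def)
  show "sgn f = f /\<^sub>R norm f" by (fact sgn_L2_def)
  show "uniformity = (INF e\<in>{0<..}. principal {(f::L2, g). dist f g < e})"
    by (fact uniformity_L2_def)
  show "open U = (\<forall>f\<in>U. \<forall>\<^sub>F (f', g) in uniformity. f' = f \<longrightarrow> g \<in> U)"
    by (fact open_L2_def)
  show "f \<bullet> g = g \<bullet> f"
    by transfer (simp add: mult.commute)
  show "(f + g) \<bullet> h = f \<bullet> h + g \<bullet> h"
    by transfer (simp add: distrib_right square_integrable_mult)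
  show "(c *\<^sub>R f) \<bullet> g = c * (f \<bullet> g)"
    by transfer (simp add: mult.assoc)
  show "0 \<le> f \<bullet> f"
    by transfer simp
  show "f \<bullet> f = 0 \<longleftrightarrow> f = 0"
  proof transfer
    fix f :: "real \<Rightarrow> real"
    assume *: "square_integrable f \<and> square_integrable f \<and> (AE t in unit_interval_measure. f t = f t)"
    then have "integrable unit_interval_measure (\<lambda>t. f t * f t)"
      by (simp add: square_integrable_mult)
    then have "(LINT t|unit_interval_measure. f t * f t) = 0 \<longleftrightarrow>
        (AE t in unit_interval_measure. f t * f t = 0)"
      by (rule integral_nonneg_eq_0_iff_AE) simp
    with * show "((LINT t|unit_interval_measure. f t * f t) = 0) \<longleftrightarrow>
        (square_integrable f \<and> square_integrable (\<lambda>t. 0) \<and> (AE t in unit_interval_measure. f t = 0))"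
      by (simp add: square_integrable_zero)
  qed
  show "norm f = sqrt (f \<bullet> f)" by (fact norm_L2_def)
qed

end

section \<open>Orthonormal bases and sets of signals\<close>

text \<open>Throughout, sequences written with $j \ge 1$ are functions on \<^typ>\<open>nat\<close> whose value at
  \<open>0\<close> is irrelevant.\<close>

definition orthonormal_basis :: "(nat \<Rightarrow> L2) \<Rightarrow> bool" where
  "orthonormal_basis \<phi> \<longleftrightarrow>
     (\<forall>i\<ge>1. \<forall>j\<ge>1. \<phi> i \<bullet> \<phi> j = (if i = j then 1 else 0)) \<and>
     closure (span (\<phi> ` {1..})) = UNIV"

definition ortho_symmetric :: "(nat \<Rightarrow> L2) \<Rightarrow> L2 set \<Rightarrow> bool" where
  "ortho_symmetric \<phi> W \<longleftrightarrow>
     (\<forall>\<theta> \<theta>' f g. ((\<lambda>j. \<theta> j *\<^sub>R \<phi> j) has_sum f) {1..} \<longrightarrow>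
        ((\<lambda>j. \<theta>' j *\<^sub>R \<phi> j) has_sum g) {1..} \<longrightarrow>
        (\<forall>j\<ge>1. \<theta>' j \<in> {\<theta> j, - \<theta> j}) \<longrightarrow> f \<in> W \<longrightarrow> g \<in> W)"

text \<open>The space whose unit ball is \<open>U\<close>.\<close>

definition generated_space :: "L2 set \<Rightarrow> L2 set" where
  "generated_space U = (\<Union>\<gamma>\<in>{0<..}. (\<lambda>f. \<gamma> *\<^sub>R f) ` U)"

definition besov_ball :: "(nat \<Rightarrow> L2) \<Rightarrow> real \<Rightarrow> real \<Rightarrow> L2 set" where
  "besov_ball \<phi> s P\<^sub>0 =
     {f. \<exists>\<theta>. ((\<lambda>j. \<theta> j *\<^sub>R \<phi> j) has_sum f) {1..} \<and>
        (SUP l\<in>{0<..}. ereal (l powr (2 * s) * (\<Sum>\<^sub>\<infinity>j\<in>{j. l < real j}. (\<theta> j)\<^sup>2))) \<le> ereal P\<^sub>0}"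

section \<open>Gaussian observations and quadratic test statistics\<close>

text \<open>\<open>\<xi> j\<close> is the $j$-th coordinate $\int_0^1 \phi_j\,dw$ of the white noise.\<close>

definition standard_gaussian_sequence :: "'w measure \<Rightarrow> (nat \<Rightarrow> 'w \<Rightarrow> real) \<Rightarrow> bool" where
  "standard_gaussian_sequence M \<xi> \<longleftrightarrow> prob_space M \<and>
     prob_space.indep_vars M (\<lambda>_. borel) \<xi> {1..} \<and>
     (\<forall>j\<ge>1. distributed M lborel (\<xi> j) std_normal_density)"

definition observation ::
  "real \<Rightarrow> (nat \<Rightarrow> L2) \<Rightarrow> (nat \<Rightarrow> 'w \<Rightarrow> real) \<Rightarrow> nat \<Rightarrow> L2 \<Rightarrow> nat \<Rightarrow> 'w \<Rightarrow> real" where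
  "observation \<sigma> \<phi> \<xi> n f j \<omega> = f \<bullet> \<phi> j + \<sigma> / sqrt (real n) * \<xi> j \<omega>"

definition coeff_sum :: "(nat \<Rightarrow> nat \<Rightarrow> real) \<Rightarrow> nat \<Rightarrow> real" where
  "coeff_sum \<kappa> n = (\<Sum>\<^sub>\<infinity>j\<in>{1..}. (\<kappa> n j)\<^sup>2)"

text \<open>For summable \<open>(\<kappa> n j)\<^sup>2\<close> the series below converges almost surely; \<^const>\<open>infsum\<close> is \<open>0\<close> on
  the exceptional null set.\<close>

definition test_statistic ::
  "real \<Rightarrow> (nat \<Rightarrow> L2) \<Rightarrow> (nat \<Rightarrow> 'w \<Rightarrow> real) \<Rightarrow> (nat \<Rightarrow> nat \<Rightarrow> real) \<Rightarrow>
   nat \<Rightarrow> L2 \<Rightarrow> 'w \<Rightarrow> real" where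
  "test_statistic \<sigma> \<phi> \<xi> \<kappa> n f \<omega> =
     (\<Sum>\<^sub>\<infinity>j\<in>{1..}. (\<kappa> n j)\<^sup>2 * (observation \<sigma> \<phi> \<xi> n f j \<omega>)\<^sup>2)
       - \<sigma>\<^sup>2 / real n * coeff_sum \<kappa> n"

section \<open>Assumptions on the coefficients\<close>

definition same_order :: "(nat \<Rightarrow> real) \<Rightarrow> (nat \<Rightarrow> real) \<Rightarrow> bool" where
  "same_order a b \<longleftrightarrow>
     (\<exists>c>0. \<exists>C>0. \<forall>\<^sub>F n in sequentially. c \<le> a n / b n \<and> a n / b n \<le> C)"

definition cutoff :: "(nat \<Rightarrow> nat \<Rightarrow> real) \<Rightarrow> nat \<Rightarrow> nat" where
  "cutoff \<kappa> n = Sup {k. 1 \<le> k \<and> (\<Sum>j\<in>{1..<k}. (\<kappa> n j)\<^sup>2) \<le> coeff_sum \<kappa> n / 2}"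

definition assumption_A1 :: "(nat \<Rightarrow> nat \<Rightarrow> real) \<Rightarrow> bool" where
  "assumption_A1 \<kappa> \<longleftrightarrow> (\<forall>n\<ge>1. antimono_on {1..} (\<lambda>j. (\<kappa> n j)\<^sup>2))"

text \<open>A divergent series has \<^const>\<open>infsum\<close> equal to \<open>0\<close>, so the strict lower bounds in the next
  two assumptions also force $\sum_j \kappa_{nj}^4$ and $\sum_j \kappa_{nj}^2$ to converge.\<close>

definition assumption_A2 :: "real \<Rightarrow> (nat \<Rightarrow> nat \<Rightarrow> real) \<Rightarrow> bool" where
  "assumption_A2 \<sigma> \<kappa> \<longleftrightarrow>
     (\<exists>C\<^sub>1>0. \<exists>C\<^sub>2>0. \<forall>n\<ge>1.
        let A = (real n)\<^sup>2 / \<sigma> ^ 4 * (\<Sum>\<^sub>\<infinity>j\<in>{1..}. (\<kappa> n j) ^ 4) in C\<^sub>1 < A \<and> A < C\<^sub>2)"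

definition assumption_A3 :: "real \<Rightarrow> (nat \<Rightarrow> nat \<Rightarrow> real) \<Rightarrow> bool" where
  "assumption_A3 r \<kappa> \<longleftrightarrow>
     (\<exists>c\<^sub>1>0. \<exists>c\<^sub>2>0. \<forall>n\<ge>1. c\<^sub>1 * real n powr (- 2 * r) \<le> coeff_sum \<kappa> n \<and>
        coeff_sum \<kappa> n \<le> c\<^sub>2 * real n powr (- 2 * r))"

definition assumption_A4 :: "(nat \<Rightarrow> nat \<Rightarrow> real) \<Rightarrow> bool" where
  "assumption_A4 \<kappa> \<longleftrightarrow>
     (\<exists>C\<^sub>1. \<exists>l>1. \<forall>\<delta>>0. \<forall>n\<ge>1.
        (\<kappa> n (nat \<lfloor>(1 + \<delta>) * real (cutoff \<kappa> n)\<rfloor>))\<^sup>2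
          < C\<^sub>1 * (1 + \<delta>) powr (- l) * (\<kappa> n (cutoff \<kappa> n))\<^sup>2)"

definition assumption_A5 :: "(nat \<Rightarrow> nat \<Rightarrow> real) \<Rightarrow> bool" where
  "assumption_A5 \<kappa> \<longleftrightarrow>
     same_order (\<lambda>n. (\<kappa> n 1)\<^sup>2) (\<lambda>n. (\<kappa> n (cutoff \<kappa> n))\<^sup>2) \<and>
     (\<forall>c>1. \<exists>C>0. \<forall>n\<ge>1.
        (\<kappa> n (nat \<lfloor>c * real (cutoff \<kappa> n)\<rfloor>))\<^sup>2 \<ge> C * (\<kappa> n (cutoff \<kappa> n))\<^sup>2)"

section \<open>Tests, consistency and maxisets\<close>

text \<open>\<open>T n f\<close> is the test statistic at noise level \<open>n\<close> when the signal is \<open>f\<close>. A test generated by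
  \<open>T n\<close> is determined by its threshold \<open>x\<close>.\<close>

definition type_I_error :: "'w measure \<Rightarrow> (nat \<Rightarrow> L2 \<Rightarrow> 'w \<Rightarrow> real) \<Rightarrow> nat \<Rightarrow> real \<Rightarrow> real" where
  "type_I_error M T n x = measure M {\<omega> \<in> space M. T n 0 \<omega> > x}"

definition type_II_error ::
  "'w measure \<Rightarrow> (nat \<Rightarrow> L2 \<Rightarrow> 'w \<Rightarrow> real) \<Rightarrow> nat \<Rightarrow> real \<Rightarrow> L2 \<Rightarrow> real" where
  "type_II_error M T n x f = measure M {\<omega> \<in> space M. \<not> T n f \<omega> > x}"

text \<open>The alternatives \<open>f i\<close> are attached to the noise levels \<open>m i\<close>.\<close>

definition consistent ::
  "'w measure \<Rightarrow> (nat \<Rightarrow> L2 \<Rightarrow> 'w \<Rightarrow> real) \<Rightarrow> (nat \<Rightarrow> nat) \<Rightarrow> (nat \<Rightarrow> L2) \<Rightarrow> bool" where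
  "consistent M T m f \<longleftrightarrow>
     (\<forall>\<alpha>\<in>{0<..<1}. \<forall>x.
        (\<lambda>i. type_I_error M T (m i) (x i)) \<sim>[sequentially] (\<lambda>_. \<alpha>) \<longrightarrow>
        limsup (\<lambda>i. ereal (type_II_error M T (m i) (x i) (f i))) < ereal (1 - \<alpha>))"

definition inconsistent ::
  "'w measure \<Rightarrow> (nat \<Rightarrow> L2 \<Rightarrow> 'w \<Rightarrow> real) \<Rightarrow> (nat \<Rightarrow> nat) \<Rightarrow> (nat \<Rightarrow> L2) \<Rightarrow> bool" where
  "inconsistent M T m f \<longleftrightarrow>
     (\<forall>x. liminf (\<lambda>i. ereal (type_I_error M T (m i) (x i) +
        type_II_error M T (m i) (x i) (f i))) \<ge> 1)"

definition alternatives_of_rate ::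
  "real \<Rightarrow> real \<Rightarrow> real \<Rightarrow> (nat \<Rightarrow> nat) \<Rightarrow> (nat \<Rightarrow> L2) \<Rightarrow> bool" where
  "alternatives_of_rate r c C m f \<longleftrightarrow> strict_mono m \<and> (\<forall>i. 1 \<le> m i) \<and>
     (\<forall>i. c * real (m i) powr (- r) < norm (f i) \<and> norm (f i) < C * real (m i) powr (- r))"

text \<open>Convexity of \<open>U\<close> is part of the standing conventions under which the space generated by \<open>U\<close>
  is considered.\<close>

definition maxiset ::
  "'w measure \<Rightarrow> (nat \<Rightarrow> L2) \<Rightarrow> real \<Rightarrow> (nat \<Rightarrow> L2 \<Rightarrow> 'w \<Rightarrow> real) \<Rightarrow> L2 set \<Rightarrow> bool" where
  "maxiset M \<phi> r T U \<longleftrightarrow>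
     bounded U \<and> closed U \<and> convex U \<and> ortho_symmetric \<phi> U \<and>
     (\<forall>\<gamma>>0. \<forall>c>0. \<forall>C>c. \<forall>m f.
        alternatives_of_rate r c C m f \<longrightarrow> (\<forall>i. f i \<in> (\<lambda>g. \<gamma> *\<^sub>R g) ` U) \<longrightarrow>
        consistent M T m f) \<and>
     (\<forall>f. f \<notin> generated_space U \<longrightarrow>
        (\<forall>V. convex V \<longrightarrow> ortho_symmetric \<phi> V \<longrightarrow> f \<in> V \<longrightarrow>
          (\<exists>c>0. \<exists>C>c. \<exists>m g. alternatives_of_rate r c C m g \<and> (\<forall>i. g i \<in> V) \<and>
             inconsistent M T m g)))"

end

theory Submission
  imports Defs "HOL-Real_Asymp.Real_Asymp"
begin

text \<open>
  The statistic \<open>n\<^sup>2 T\<close> is, up to negligible errors, a sum of two parts: a centred quadratic form of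
  the noise, whose variance is bounded away from \<open>0\<close> and \<open>\<infinity>\<close> by A2, and the deterministic
  signal energy \<open>B = n\<^sup>2 \<Sum> \<kappa>\<^sub>j\<^sup>2 \<theta>\<^sub>j\<^sup>2\<close>. The quadratic form is a weighted sum of the
  independent variables \<open>\<xi>\<^sub>j\<^sup>2 - 1\<close> with uniformly small weights, hence asymptotically normal
  (\<open>weighted_central_limit_theorem\<close>), uniformly over thresholds because the limiting distribution
  function is continuous (\<open>weak_conv_m_imp_uniform\<close>). Both facts are combined in
  \<open>normal_approximation\<close>. Consequently alternatives of norm \<open>n powr (-r)\<close> are consistent when their
  energy stays away from \<open>0\<close>, and inconsistent when it tends to \<open>0\<close>
  (\<open>consistent_of_signal_energy_bounded_below\<close>, \<open>inconsistent_of_signal_energy_vanishing\<close>).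

  It remains to compute energies. The assumptions force the coefficients \<open>\<kappa>\<^sup>2\<close> up to the cutoff to be of order
  \<open>n powr (2r - 2)\<close> and the cutoff to be of order \<open>n powr (2 - 4r)\<close> (\<open>coefficient_scales\<close>). A signal
  of norm of order \<open>n powr (-r)\<close> therefore has energy of order \<open>1\<close> exactly when a fixed
  proportion of its squared norm sits at frequencies comparable with the cutoff or below. The exponent
  \<open>s\<close> is chosen so that the Besov tail bound at the frequency \<open>n powr (2 - 4r)\<close> is
  of order \<open>n powr (-2r)\<close>. Inside a multiple of the ball the part of the signal far beyond the
  cutoff is hence too short to matter (\<open>besov_alternatives_signal_energy\<close>). For a signal outside the
  space generated by the ball, the tails themselves are used as alternatives: they belong to every
  convex ortho-symmetric set containing the signal (\<open>tail_mem_convex_ortho_symmetric\<close>), and infinitely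
  many of them are too long for the Besov bound. Choosing the sample size that matches the norm of such a
  tail places it far beyond the cutoff, where A4 makes its energy vanish
  (\<open>tail_alternatives_signal_energy\<close>).
\<close>

section \<open>Basis expansions and Besov balls\<close>

lemma expansion_coefficient:
  assumes "orthonormal_basis \<phi>" "((\<lambda>j. \<theta> j *\<^sub>R \<phi> j) has_sum f) {1..}" "j \<ge> 1"
  shows "f \<bullet> \<phi> j = \<theta> j"
proof -
  have "((\<lambda>i. (\<theta> i *\<^sub>R \<phi> i) \<bullet> \<phi> j) has_sum (f \<bullet> \<phi> j)) {1..}"
    using has_sum_bounded_linear[OF bounded_linear_inner_left assms(2)] by (simp add: o_def)
  moreover have "((\<lambda>i. (\<theta> i *\<^sub>R \<phi> i) \<bullet> \<phi> j) has_sum \<theta> j) {1..}"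
    using assms(1,3) by (intro has_sum_finite_neutralI[of "{j}"]) (auto simp: orthonormal_basis_def)
  ultimately show ?thesis by (rule has_sum_unique)
qed

text \<open>The part of \<open>f\<close> carried by the basis vectors with index above \<open>k\<close>. Working with this
  vector instead of the series of squared coefficients turns the Besov condition into a bound on
  the norm of a continuous linear image of \<open>f\<close>.\<close>
definition tail :: "(nat \<Rightarrow> L2) \<Rightarrow> nat \<Rightarrow> L2 \<Rightarrow> L2" where
  "tail \<phi> k f = f - (\<Sum>j\<in>{1..k}. (f \<bullet> \<phi> j) *\<^sub>R \<phi> j)"

lemma residual_inner:
  assumes "orthonormal_basis \<phi>" "finite Y" "Y \<subseteq> {1..}" "j \<ge> 1"
  shows "(f - (\<Sum>i\<in>Y. (f \<bullet> \<phi> i) *\<^sub>R \<phi> i)) \<bullet> \<phi> j = (if j \<in> Y then 0 else f \<bullet> \<phi> j)"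
proof -
  have "(\<Sum>i\<in>Y. (f \<bullet> \<phi> i) * (\<phi> i \<bullet> \<phi> j)) = (\<Sum>i\<in>Y. if i = j then f \<bullet> \<phi> j else 0)"
    using assms by (intro sum.cong) (auto simp: orthonormal_basis_def)
  then show ?thesis using assms(2) by (simp add: inner_diff_left inner_sum_left)
qed

text \<open>The span of the basis is dense, and among all combinations of a given finite set of basis
  vectors the Fourier partial sum is the closest to \<open>f\<close>.
  Once it is close, enlarging the index set can only bring it closer, which is convergence along
  the net of finite index sets.\<close>
lemma basis_expansion:
  assumes "orthonormal_basis \<phi>"
  shows "((\<lambda>j. (f \<bullet> \<phi> j) *\<^sub>R \<phi> j) has_sum f) {1..}"
  unfolding has_sum_def tendsto_iff eventually_finite_subsets_at_top
proof (intro allI impI)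
  fix e :: real assume "e > 0"
  have "f \<in> closure (span (\<phi> ` {1..}))"
    using assms by (simp add: orthonormal_basis_def)
  then obtain g where g: "g \<in> span (\<phi> ` {1..})" "dist g f < e"
    using \<open>e > 0\<close> unfolding closure_approachable by blast
  from g(1) obtain t u where t: "finite t" "t \<subseteq> \<phi> ` {1..}" "g = (\<Sum>v\<in>t. u v *\<^sub>R v)"
    unfolding span_explicit by blast
  then obtain X where X: "X \<subseteq> {1..}" "finite X" "t = \<phi> ` X"
    using finite_subset_image[OF t(1,2)] by blast
  have "dist (\<Sum>j\<in>Y. (f \<bullet> \<phi> j) *\<^sub>R \<phi> j) f < e" if Y: "finite Y" "X \<subseteq> Y" "Y \<subseteq> {1..}" for Y
  proof -
    define p where "p = (\<Sum>j\<in>Y. (f \<bullet> \<phi> j) *\<^sub>R \<phi> j)"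
    have "p - g \<in> span (\<phi> ` Y)"
      unfolding p_def t(3) using X(3) Y(2)
      by (intro span_diff span_sum span_scale span_base) auto
    moreover have "orthogonal (f - p) x" if "x \<in> \<phi> ` Y" for x
      using that Y residual_inner[OF assms Y(1,3), of _ f] by (auto simp: orthogonal_def p_def)
    ultimately have "orthogonal (f - p) (p - g)"
      by (rule orthogonal_to_span)
    then have "(norm (f - g))\<^sup>2 = (norm (f - p))\<^sup>2 + (norm (p - g))\<^sup>2"
      using norm_add_Pythagorean[of "f - p" "p - g"] by simp
    then have "(norm (f - p))\<^sup>2 \<le> (norm (f - g))\<^sup>2"
      by simp
    then have "norm (f - p) \<le> norm (f - g)"
      by (rule power2_le_imp_le) simp
    with g(2) show ?thesis
      unfolding p_def by (simp add: dist_norm norm_minus_commute)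
  qed
  with X show "\<exists>X. finite X \<and> X \<subseteq> {1..} \<and>
      (\<forall>Y. finite Y \<and> X \<subseteq> Y \<and> Y \<subseteq> {1..} \<longrightarrow> dist (\<Sum>j\<in>Y. (f \<bullet> \<phi> j) *\<^sub>R \<phi> j) f < e)"
    by blast
qed

lemma parseval:
  assumes "orthonormal_basis \<phi>"
  shows "((\<lambda>j. (f \<bullet> \<phi> j)\<^sup>2) has_sum (norm f)\<^sup>2) {1..}"
  using has_sum_bounded_linear[OF bounded_linear_inner_right basis_expansion[OF assms], of f f]
  by (simp add: dot_square_norm power2_eq_square[of "_ \<bullet> _"])

lemma tail_inner:
  assumes "orthonormal_basis \<phi>" "j \<ge> 1"
  shows "tail \<phi> k f \<bullet> \<phi> j = (if j \<le> k then 0 else f \<bullet> \<phi> j)"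
  unfolding tail_def using residual_inner[OF assms(1) _ _ assms(2), of "{1..k}" f] assms(2) by auto

lemma has_sum_tail:
  assumes "orthonormal_basis \<phi>"
  shows "((\<lambda>j. (f \<bullet> \<phi> j)\<^sup>2) has_sum (norm (tail \<phi> k f))\<^sup>2) {k<..}"
  using parseval[OF assms, of "tail \<phi> k f"]
  by (rule has_sum_cong_neutral[THEN iffD1, rotated -1]) (auto simp: tail_inner[OF assms])

lemma linear_tail: "linear (tail \<phi> k)"
  unfolding tail_def
  by (intro linearI)
    (simp_all add: inner_add_left scaleR_add_left sum.distrib scaleR_diff_right scaleR_sum_right)

lemma continuous_tail: "continuous_on UNIV (tail \<phi> k)"
  unfolding tail_def by (intro continuous_intros)

lemma besov_ball_iff:
  assumes "orthonormal_basis \<phi>"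
  shows "f \<in> besov_ball \<phi> s P \<longleftrightarrow> (\<forall>l>0. l powr (2 * s) * (norm (tail \<phi> (nat \<lfloor>l\<rfloor>) f))\<^sup>2 \<le> P)"
proof -
  have idx: "{j. l < real j} = {nat \<lfloor>l\<rfloor><..}" if "l > 0" for l
    using that by (auto simp: nat_less_iff floor_less_iff)
  have tails: "(\<Sum>\<^sub>\<infinity>j\<in>{j. l < real j}. (\<theta> j)\<^sup>2) = (norm (tail \<phi> (nat \<lfloor>l\<rfloor>) f))\<^sup>2"
    if "((\<lambda>j. \<theta> j *\<^sub>R \<phi> j) has_sum f) {1..}" "l > 0" for \<theta> l
  proof -
    have "(\<Sum>\<^sub>\<infinity>j\<in>{j. l < real j}. (\<theta> j)\<^sup>2) = (\<Sum>\<^sub>\<infinity>j\<in>{j. l < real j}. (f \<bullet> \<phi> j)\<^sup>2)"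
      using expansion_coefficient[OF assms that(1)] that(2) by (intro infsum_cong) auto
    then show ?thesis
      unfolding idx[OF that(2)] using infsumI[OF has_sum_tail[OF assms]] by metis
  qed
  have "f \<in> besov_ball \<phi> s P \<longleftrightarrow>
     (\<exists>\<theta>. ((\<lambda>j. \<theta> j *\<^sub>R \<phi> j) has_sum f) {1..} \<and>
        (\<forall>l>0. l powr (2 * s) * (\<Sum>\<^sub>\<infinity>j\<in>{j. l < real j}. (\<theta> j)\<^sup>2) \<le> P))"
    unfolding besov_ball_def by (simp add: SUP_le_iff Ball_def)
  also have "\<dots> \<longleftrightarrow> (\<exists>\<theta>. ((\<lambda>j. \<theta> j *\<^sub>R \<phi> j) has_sum f) {1..} \<and>
        (\<forall>l>0. l powr (2 * s) * (norm (tail \<phi> (nat \<lfloor>l\<rfloor>) f))\<^sup>2 \<le> P))"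
    by (intro ex_cong1 conj_cong refl) (simp add: tails)
  also have "\<dots> \<longleftrightarrow> (\<forall>l>0. l powr (2 * s) * (norm (tail \<phi> (nat \<lfloor>l\<rfloor>) f))\<^sup>2 \<le> P)"
    using basis_expansion[OF assms, of f] by (intro iffI, blast, intro exI conjI)
  finally show ?thesis .
qed

text \<open>An intersection of preimages of balls under continuous linear maps is closed and convex;
  the level \<open>l = 1/2\<close>, where nothing is cut off, gives boundedness.\<close>
lemma besov_ball_eq_Inter:
  assumes "orthonormal_basis \<phi>"
  shows "besov_ball \<phi> s P = (\<Inter>l\<in>{0<..}. tail \<phi> (nat \<lfloor>l\<rfloor>) -` cball 0 (sqrt (P / l powr (2 * s))))"
proof -
  have "w * x\<^sup>2 \<le> P \<longleftrightarrow> x \<le> sqrt (P / w)" if "w > 0" "x \<ge> 0" for w x :: real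
  proof -
    have "w * x\<^sup>2 \<le> P \<longleftrightarrow> x\<^sup>2 \<le> P / w" using that by (simp add: pos_le_divide_eq mult.commute)
    also have "\<dots> \<longleftrightarrow> sqrt (x\<^sup>2) \<le> sqrt (P / w)" by (simp only: real_sqrt_le_iff)
    finally show ?thesis using that by simp
  qed
  then show ?thesis
    by (intro set_eqI) (auto simp: besov_ball_iff[OF assms])
qed

lemma closed_besov_ball:
  assumes "orthonormal_basis \<phi>" shows "closed (besov_ball \<phi> s P)"
  unfolding besov_ball_eq_Inter[OF assms]
  by (intro closed_INT ballI closed_vimage closed_cball continuous_tail)

lemma convex_besov_ball:
  assumes "orthonormal_basis \<phi>" shows "convex (besov_ball \<phi> s P)"
  unfolding besov_ball_eq_Inter[OF assms]
  by (intro convex_INT convex_linear_vimage linear_tail convex_cball)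

lemma bounded_besov_ball:
  assumes "orthonormal_basis \<phi>" shows "bounded (besov_ball \<phi> s P)"
proof (rule bounded_subset[OF bounded_cball])
  show "besov_ball \<phi> s P \<subseteq> cball 0 (sqrt (P / (1/2) powr (2 * s)))"
  proof
    fix f assume "f \<in> besov_ball \<phi> s P"
    then have "f \<in> tail \<phi> (nat \<lfloor>1/2 :: real\<rfloor>) -` cball 0 (sqrt (P / (1/2) powr (2 * s)))"
      unfolding besov_ball_eq_Inter[OF assms] by (rule INT_D) simp
    then show "f \<in> cball 0 (sqrt (P / (1/2) powr (2 * s)))"
      by (simp add: tail_def)
  qed
qed

lemma ortho_symmetric_besov_ball:
  assumes "orthonormal_basis \<phi>"
  shows "ortho_symmetric \<phi> (besov_ball \<phi> s P)"
  unfolding ortho_symmetric_def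
proof (intro allI impI)
  fix \<theta> \<theta>' f g
  assume f: "((\<lambda>j. \<theta> j *\<^sub>R \<phi> j) has_sum f) {1..}" and g: "((\<lambda>j. \<theta>' j *\<^sub>R \<phi> j) has_sum g) {1..}"
    and signs: "\<forall>j\<ge>1. \<theta>' j \<in> {\<theta> j, - \<theta> j}" and "f \<in> besov_ball \<phi> s P"
  have "(norm (tail \<phi> k g))\<^sup>2 = (norm (tail \<phi> k f))\<^sup>2" for k
  proof (rule has_sum_unique[OF _ has_sum_tail[OF assms]])
    have eq: "(f \<bullet> \<phi> j)\<^sup>2 = (g \<bullet> \<phi> j)\<^sup>2" if "j \<in> {k<..}" for j
      using that signs[rule_format, of j] expansion_coefficient[OF assms f, of j] expansion_coefficient[OF assms g, of j]
      by (auto simp: Ball_def)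
    show "((\<lambda>j. (f \<bullet> \<phi> j)\<^sup>2) has_sum (norm (tail \<phi> k g))\<^sup>2) {k<..}"
      by (subst has_sum_cong[OF eq]) (simp_all add: has_sum_tail[OF assms])
  qed
  with \<open>f \<in> besov_ball \<phi> s P\<close> show "g \<in> besov_ball \<phi> s P"
    by (simp add: besov_ball_iff[OF assms])
qed

text \<open>If the weighted tails of \<open>f\<close> stayed below \<open>K\<close>, the rescaled signal \<open>sqrt (P / K) f\<close> would
  lie in the ball.\<close>
lemma not_in_generated_space_besov:
  assumes "orthonormal_basis \<phi>" "P > 0" "f \<notin> generated_space (besov_ball \<phi> s P)"
  shows "\<exists>l>0. l powr (2 * s) * (norm (tail \<phi> (nat \<lfloor>l\<rfloor>) f))\<^sup>2 > K"
proof (rule ccontr)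
  assume *: "\<not> ?thesis"
  define K' where "K' = max K 1"
  define \<gamma> where "\<gamma> = sqrt (K' / P)"
  have "\<gamma> > 0" and \<gamma>2: "\<gamma>\<^sup>2 = K' / P" using assms(2) by (auto simp: \<gamma>_def K'_def)
  have "(1/\<gamma>) *\<^sub>R f \<in> besov_ball \<phi> s P"
    unfolding besov_ball_iff[OF assms(1)]
  proof (intro allI impI)
    fix l :: real assume "l > 0"
    with * have "l powr (2 * s) * (norm (tail \<phi> (nat \<lfloor>l\<rfloor>) f))\<^sup>2 \<le> K'"
      unfolding K'_def by (meson linorder_not_le max.coboundedI1)
    moreover have "K' > 0" by (simp add: K'_def)
    ultimately show "l powr (2 * s) * (norm (tail \<phi> (nat \<lfloor>l\<rfloor>) ((1/\<gamma>) *\<^sub>R f)))\<^sup>2 \<le> P"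
      using assms(2)
      by (simp add: linear_cmul[OF linear_tail] power_divide \<gamma>2 divide_simps mult.commute mult.left_commute)
  qed
  moreover have "f = \<gamma> *\<^sub>R ((1/\<gamma>) *\<^sub>R f)" using \<open>\<gamma> > 0\<close> by simp
  ultimately have "f \<in> generated_space (besov_ball \<phi> s P)"
    unfolding generated_space_def using \<open>\<gamma> > 0\<close> by blast
  with assms(3) show False by simp
qed

section \<open>Orders of magnitude of the coefficients\<close>

text \<open>Positivity of an unconditional sum already certifies its convergence, since divergent sums
  have value \<open>0\<close>. This is how the lower bounds in A2 and A3 yield summable coefficients.\<close>
lemma infsum_nonzero_imp_summable: "infsum f A \<noteq> 0 \<Longrightarrow> f summable_on A"
  by (metis infsum_not_exists)

lemma cutoff_half_mass:
  assumes pos: "coeff_sum \<kappa> n > 0"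
  defines "k \<equiv> cutoff \<kappa> n"
  shows "coeff_sum \<kappa> n / 2 < (\<Sum>j\<in>{1..k}. (\<kappa> n j)\<^sup>2)"
proof -
  define S where "S = {k. 1 \<le> k \<and> (\<Sum>j\<in>{1..<k}. (\<kappa> n j)\<^sup>2) \<le> coeff_sum \<kappa> n / 2}"
  have "(\<lambda>j. (\<kappa> n j)\<^sup>2) summable_on {1..}"
    using pos unfolding coeff_sum_def by (intro infsum_nonzero_imp_summable) simp
  then have "((\<lambda>j. (\<kappa> n j)\<^sup>2) has_sum coeff_sum \<kappa> n) {1..}"
    unfolding coeff_sum_def by (rule has_sum_infsum)
  then have "\<forall>\<^sub>F F in finite_subsets_at_top {1..}. coeff_sum \<kappa> n / 2 < (\<Sum>j\<in>F. (\<kappa> n j)\<^sup>2)"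
    unfolding has_sum_def by (rule order_tendstoD) (use pos in simp)
  then obtain F where F: "finite F" "F \<subseteq> {1..}" "coeff_sum \<kappa> n / 2 < (\<Sum>j\<in>F. (\<kappa> n j)\<^sup>2)"
    unfolding eventually_finite_subsets_at_top by blast
  have "m \<le> Max (insert 0 F)" if "m \<in> S" for m
  proof (rule ccontr)
    assume "\<not> m \<le> Max (insert 0 F)"
    moreover have "x \<le> Max (insert 0 F)" if "x \<in> F" for x
      using that F(1) by (intro Max_ge) auto
    ultimately have "x < m" if "x \<in> F" for x
      using that by (meson le_less_trans not_le_imp_less)
    then have "F \<subseteq> {1..<m}" using F(2) by auto
    then have "(\<Sum>j\<in>F. (\<kappa> n j)\<^sup>2) \<le> (\<Sum>j\<in>{1..<m}. (\<kappa> n j)\<^sup>2)"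
      by (intro sum_mono2) auto
    with F(3) that show False by (simp add: S_def)
  qed
  then have bdd: "bdd_above S" by (rule bdd_aboveI)
  have "1 \<in> S" using pos by (simp add: S_def)
  have kS: "k = Sup S" by (simp add: k_def cutoff_def S_def)
  moreover have "Sup S = Max S" using \<open>1 \<in> S\<close> by (auto simp: Sup_nat_def)
  moreover have "finite S" using bdd by (simp add: bdd_above_nat)
  moreover from this have "Max S \<in> S" using \<open>1 \<in> S\<close> by (intro Max_in) auto
  ultimately have k: "k = Sup S" "k \<in> S" by simp_all
  have "k \<ge> 1" using k(2) by (simp add: S_def)
  have "Suc k \<notin> S"
    using cSup_upper[OF _ bdd, of "Suc k"] k(1) by auto
  then show "coeff_sum \<kappa> n / 2 < (\<Sum>j\<in>{1..k}. (\<kappa> n j)\<^sup>2)"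
    using \<open>k \<ge> 1\<close> by (simp add: S_def atLeastLessThanSuc_atLeastAtMost)
qed

text \<open>With \<open>k\<close> the cutoff, \<open>a\<close> the coefficient at \<open>k\<close>, \<open>b\<close> the first coefficient,
  \<open>\<rho>\<close> the sum and \<open>Q\<close> the sum of squares, monotonicity compares the first \<open>k\<close> summands with their
  smallest and largest member: \<open>k a \<le> \<rho>\<close>, \<open>\<rho> \<le> 2 k b\<close>, \<open>k a\<^sup>2 \<le> Q\<close> and \<open>Q \<le> b \<rho>\<close>.\<close>
lemma cutoff_bounds:
  assumes A1: "antimono_on {1..} (\<lambda>j. (\<kappa> n j)\<^sup>2)" and pos: "coeff_sum \<kappa> n > 0"
    and Q: "(\<Sum>\<^sub>\<infinity>j\<in>{1..}. (\<kappa> n j) ^ 4) > 0"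
  defines "k \<equiv> cutoff \<kappa> n"
  shows "real k * (\<kappa> n k)\<^sup>2 \<le> coeff_sum \<kappa> n"
    and "coeff_sum \<kappa> n \<le> 2 * real k * (\<kappa> n 1)\<^sup>2"
    and "real k * ((\<kappa> n k)\<^sup>2)\<^sup>2 \<le> (\<Sum>\<^sub>\<infinity>j\<in>{1..}. (\<kappa> n j) ^ 4)"
    and "(\<Sum>\<^sub>\<infinity>j\<in>{1..}. (\<kappa> n j) ^ 4) \<le> (\<kappa> n 1)\<^sup>2 * coeff_sum \<kappa> n"
proof -
  note half_mass = cutoff_half_mass[where \<kappa> = \<kappa>, OF pos, folded k_def]
  have anti: "(\<kappa> n j)\<^sup>2 \<le> (\<kappa> n i)\<^sup>2" if "1 \<le> i" "i \<le> j" for i j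
    using A1 that by (auto simp: monotone_on_def)
  have sm2: "(\<lambda>j. (\<kappa> n j)\<^sup>2) summable_on {1..}"
    using pos unfolding coeff_sum_def by (intro infsum_nonzero_imp_summable) simp
  have sm4: "(\<lambda>j. (\<kappa> n j) ^ 4) summable_on {1..}"
    using Q by (intro infsum_nonzero_imp_summable) simp
  have sq: "(\<kappa> n j) ^ 4 = ((\<kappa> n j)\<^sup>2)\<^sup>2" for j by simp
  have "real k * (\<kappa> n k)\<^sup>2 = (\<Sum>j\<in>{1..k}. (\<kappa> n k)\<^sup>2)" by simp
  also have "\<dots> \<le> (\<Sum>j\<in>{1..k}. (\<kappa> n j)\<^sup>2)" by (intro sum_mono anti) auto
  also have "\<dots> \<le> coeff_sum \<kappa> n"
    unfolding coeff_sum_def by (intro finite_sum_le_infsum sm2) auto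
  finally show "real k * (\<kappa> n k)\<^sup>2 \<le> coeff_sum \<kappa> n" .
  have "(\<Sum>j\<in>{1..k}. (\<kappa> n j)\<^sup>2) \<le> (\<Sum>j\<in>{1..k}. (\<kappa> n 1)\<^sup>2)" by (intro sum_mono anti) auto
  with half_mass show "coeff_sum \<kappa> n \<le> 2 * real k * (\<kappa> n 1)\<^sup>2" by simp
  have "real k * ((\<kappa> n k)\<^sup>2)\<^sup>2 = (\<Sum>j\<in>{1..k}. ((\<kappa> n k)\<^sup>2)\<^sup>2)" by simp
  also have "\<dots> \<le> (\<Sum>j\<in>{1..k}. (\<kappa> n j) ^ 4)"
    unfolding sq by (intro sum_mono power_mono anti) auto
  also have "\<dots> \<le> (\<Sum>\<^sub>\<infinity>j\<in>{1..}. (\<kappa> n j) ^ 4)"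
    by (intro finite_sum_le_infsum sm4) auto
  finally show "real k * ((\<kappa> n k)\<^sup>2)\<^sup>2 \<le> (\<Sum>\<^sub>\<infinity>j\<in>{1..}. (\<kappa> n j) ^ 4)" .
  have "(\<Sum>\<^sub>\<infinity>j\<in>{1..}. (\<kappa> n j) ^ 4) \<le> (\<Sum>\<^sub>\<infinity>j\<in>{1..}. (\<kappa> n 1)\<^sup>2 * (\<kappa> n j)\<^sup>2)"
  proof (intro infsum_mono sm4 summable_on_cmult_right sm2)
    fix j :: nat assume "j \<in> {1..}"
    then show "(\<kappa> n j) ^ 4 \<le> (\<kappa> n 1)\<^sup>2 * (\<kappa> n j)\<^sup>2"
      using mult_right_mono[OF anti[of 1 j], of "(\<kappa> n j)\<^sup>2"]
      by (simp add: power_add[symmetric])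
  qed
  also have "\<dots> = (\<kappa> n 1)\<^sup>2 * coeff_sum \<kappa> n"
    unfolding coeff_sum_def by (intro infsum_cmult_right) (use sm2 in simp)
  finally show "(\<Sum>\<^sub>\<infinity>j\<in>{1..}. (\<kappa> n j) ^ 4) \<le> (\<kappa> n 1)\<^sup>2 * coeff_sum \<kappa> n" .
qed

text \<open>When \<open>a\<close> and \<open>b\<close> agree up to a factor, these four inequalities say \<open>k a \<approx> \<rho>\<close> and
  \<open>k a\<^sup>2 \<approx> Q\<close>, so that \<open>a \<approx> Q / \<rho>\<close> and \<open>k \<approx> \<rho>\<^sup>2 / Q\<close>. Here \<open>y\<close> is the order of \<open>\<rho>\<close> and
  \<open>x y\<close> the order of \<open>Q\<close>, which makes \<open>x\<close> the order of \<open>a\<close> and \<open>y / x\<close> the order of \<open>k\<close>.\<close>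
lemma coefficient_scale_arith:
  fixes x y \<rho> Q a b k c\<^sub>1 c\<^sub>2 D\<^sub>1 D\<^sub>2 B :: real
  assumes pos: "x > 0" "y > 0" "c\<^sub>1 > 0" "c\<^sub>2 > 0" "D\<^sub>1 > 0" "D\<^sub>2 > 0" "B > 0"
    and nonneg: "a \<ge> 0" "b \<ge> 0" "k \<ge> 0"
    and \<rho>: "c\<^sub>1 * y \<le> \<rho>" "\<rho> \<le> c\<^sub>2 * y" and Q: "D\<^sub>1 * (x * y) \<le> Q" "Q \<le> D\<^sub>2 * (x * y)"
    and b: "b \<le> B * a" and k: "k * a \<le> \<rho>" "\<rho> \<le> 2 * k * b" "k * a\<^sup>2 \<le> Q" "Q \<le> b * \<rho>"
  shows "D\<^sub>1 / (c\<^sub>2 * B) * x \<le> a" "b \<le> 2 * B\<^sup>2 * D\<^sub>2 / c\<^sub>1 * x"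
    "c\<^sub>1\<^sup>2 / (4 * B\<^sup>2 * D\<^sub>2) * (y / x) \<le> k" "k \<le> c\<^sub>2\<^sup>2 * B / D\<^sub>1 * (y / x)"
proof -
  have "\<rho> \<ge> 0" using \<rho>(1) pos mult_pos_pos[of c\<^sub>1 y] by linarith
  have "D\<^sub>1 * x * y \<le> b * \<rho>" using Q(1) k(4) by (simp add: mult.assoc)
  also have "\<dots> \<le> (B * a) * (c\<^sub>2 * y)" using b \<rho> pos nonneg \<open>\<rho> \<ge> 0\<close> by (intro mult_mono) simp_all
  finally have "D\<^sub>1 * x * y \<le> (B * a * c\<^sub>2) * y" by (simp add: mult_ac)
  then have "D\<^sub>1 * x \<le> B * a * c\<^sub>2" using pos(2) by (rule mult_right_le_imp_le)
  then show lower: "D\<^sub>1 / (c\<^sub>2 * B) * x \<le> a"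
    using pos by (simp add: pos_divide_le_eq mult_ac)
  have "c\<^sub>1 * y \<le> 2 * k * b" using \<rho> k by linarith
  also have "\<dots> \<le> 2 * k * (B * a)" using nonneg b by (intro mult_left_mono) auto
  finally have "c\<^sub>1 * y * a \<le> 2 * k * (B * a) * a" using nonneg by (intro mult_right_mono) auto
  also have "\<dots> = 2 * B * (k * a\<^sup>2)" by (simp add: power2_eq_square)
  also have "\<dots> \<le> 2 * B * (D\<^sub>2 * (x * y))" using k(3) Q(2) pos by (intro mult_left_mono) auto
  finally have "(c\<^sub>1 * a) * y \<le> (2 * B * D\<^sub>2 * x) * y" by (simp add: mult_ac)
  then have "c\<^sub>1 * a \<le> 2 * B * D\<^sub>2 * x" using pos(2) by (rule mult_right_le_imp_le)
  then have "B * (c\<^sub>1 * a) \<le> B * (2 * B * D\<^sub>2 * x)" using pos by (intro mult_left_mono) auto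
  moreover have "c\<^sub>1 * b \<le> c\<^sub>1 * (B * a)" using b pos by (intro mult_left_mono) auto
  ultimately have "c\<^sub>1 * b \<le> 2 * B\<^sup>2 * D\<^sub>2 * x" by (simp add: power2_eq_square mult_ac)
  then show upper: "b \<le> 2 * B\<^sup>2 * D\<^sub>2 / c\<^sub>1 * x"
    using pos by (simp add: pos_le_divide_eq mult_ac)
  have "c\<^sub>1 * (c\<^sub>1 * y) \<le> c\<^sub>1 * (2 * k * b)" using \<rho> k pos by (intro mult_left_mono) linarith+
  also have "\<dots> \<le> c\<^sub>1 * (2 * k * (2 * B\<^sup>2 * D\<^sub>2 / c\<^sub>1 * x))"
    using nonneg upper pos by (intro mult_left_mono) simp_all
  also have "\<dots> = 4 * B\<^sup>2 * D\<^sub>2 * x * k" using pos by simp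
  finally show "c\<^sub>1\<^sup>2 / (4 * B\<^sup>2 * D\<^sub>2) * (y / x) \<le> k"
    using pos by (simp add: pos_divide_le_eq power2_eq_square mult_ac)
  have "k * (D\<^sub>1 / (c\<^sub>2 * B) * x) \<le> k * a" using lower nonneg by (intro mult_left_mono) auto
  also have "\<dots> \<le> c\<^sub>2 * y" using k \<rho> by linarith
  finally show "k \<le> c\<^sub>2\<^sup>2 * B / D\<^sub>1 * (y / x)"
    using pos by (simp add: pos_divide_le_eq pos_le_divide_eq power2_eq_square mult_ac)
qed

text \<open>The sum of the \<open>\<kappa>\<^sup>2\<close> has order \<open>n powr (-2r)\<close> by A3, the sum of the \<open>\<kappa>\<^sup>4\<close> has order
  \<open>n powr (-2)\<close> by A2, and A5 makes the largest coefficient comparable with the one at the cutoff.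
  Every later rate rests on these two scales.\<close>
lemma coefficient_scales:
  assumes "\<sigma> > 0" "assumption_A1 \<kappa>" "assumption_A2 \<sigma> \<kappa>" "assumption_A3 r \<kappa>" "assumption_A5 \<kappa>"
  obtains c C where "c > 0" "C > 0"
    "\<forall>\<^sub>F n in sequentially. c * real n powr (2 * r - 2) \<le> (\<kappa> n (cutoff \<kappa> n))\<^sup>2 \<and>
       (\<kappa> n 1)\<^sup>2 \<le> C * real n powr (2 * r - 2) \<and>
       c * real n powr (2 - 4 * r) \<le> real (cutoff \<kappa> n) \<and>
       real (cutoff \<kappa> n) \<le> C * real n powr (2 - 4 * r)"
proof -
  obtain c\<^sub>1 c\<^sub>2 where c: "c\<^sub>1 > 0" "c\<^sub>2 > 0"
    and \<rho>: "\<And>n. n \<ge> 1 \<Longrightarrow> c\<^sub>1 * real n powr (- 2 * r) \<le> coeff_sum \<kappa> n \<and>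
        coeff_sum \<kappa> n \<le> c\<^sub>2 * real n powr (- 2 * r)"
    using assms(4) unfolding assumption_A3_def by blast
  obtain C\<^sub>1 C\<^sub>2 where C: "C\<^sub>1 > 0" "C\<^sub>2 > 0"
    and A: "\<And>n. n \<ge> 1 \<Longrightarrow> C\<^sub>1 < (real n)\<^sup>2 / \<sigma> ^ 4 * (\<Sum>\<^sub>\<infinity>j\<in>{1..}. (\<kappa> n j) ^ 4) \<and>
       (real n)\<^sup>2 / \<sigma> ^ 4 * (\<Sum>\<^sub>\<infinity>j\<in>{1..}. (\<kappa> n j) ^ 4) < C\<^sub>2"
    using assms(3) unfolding assumption_A2_def Let_def by blast
  obtain b B where B: "b > 0" "B > 0" "\<forall>\<^sub>F n in sequentially.
      b \<le> (\<kappa> n 1)\<^sup>2 / (\<kappa> n (cutoff \<kappa> n))\<^sup>2 \<and> (\<kappa> n 1)\<^sup>2 / (\<kappa> n (cutoff \<kappa> n))\<^sup>2 \<le> B"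
    using assms(5) unfolding assumption_A5_def same_order_def by blast
  define D\<^sub>1 D\<^sub>2 where D_def: "D\<^sub>1 = C\<^sub>1 * \<sigma> ^ 4" "D\<^sub>2 = C\<^sub>2 * \<sigma> ^ 4"
  have D: "D\<^sub>1 > 0" "D\<^sub>2 > 0" using C assms(1) by (auto simp: D_def)
  define c where "c = min (D\<^sub>1 / (c\<^sub>2 * B)) (c\<^sub>1\<^sup>2 / (4 * B\<^sup>2 * D\<^sub>2))"
  define C' where "C' = max (2 * B\<^sup>2 * D\<^sub>2 / c\<^sub>1) (c\<^sub>2\<^sup>2 * B / D\<^sub>1)"
  show ?thesis
  proof (rule that[of c C'])
    show "c > 0" using c B D by (simp add: c_def)
    show "C' > 0" using c B D by (simp add: C'_def less_max_iff_disj)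
    show "\<forall>\<^sub>F n in sequentially. c * real n powr (2 * r - 2) \<le> (\<kappa> n (cutoff \<kappa> n))\<^sup>2 \<and>
       (\<kappa> n 1)\<^sup>2 \<le> C' * real n powr (2 * r - 2) \<and>
       c * real n powr (2 - 4 * r) \<le> real (cutoff \<kappa> n) \<and>
       real (cutoff \<kappa> n) \<le> C' * real n powr (2 - 4 * r)"
      using B(3) eventually_ge_at_top[of 1]
    proof eventually_elim
      case (elim n)
      define x y where xy: "x = real n powr (2 * r - 2)" "y = real n powr (- 2 * r)"
      define k Q where "k = cutoff \<kappa> n" "Q = (\<Sum>\<^sub>\<infinity>j\<in>{1..}. (\<kappa> n j) ^ 4)"
      have n: "real n > 0" using elim by simp
      have xy_pos: "x > 0" "y > 0" using n by (auto simp: xy)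
      have xy2: "x * y = 1 / (real n)\<^sup>2"
      proof -
        have "x * y = real n powr (- 2)" by (simp add: xy powr_add[symmetric])
        then show ?thesis using n by (simp add: powr_minus powr_numeral divide_inverse)
      qed
      have yx: "real n powr (2 - 4 * r) = y / x"
        by (simp add: xy powr_diff[symmetric])
      have Q: "D\<^sub>1 * (x * y) \<le> Q" "Q \<le> D\<^sub>2 * (x * y)"
        using A[OF elim(2)] n assms(1) unfolding xy2 D_def k_Q_def
        by (simp_all add: pos_divide_le_eq pos_le_divide_eq pos_divide_less_eq pos_less_divide_eq mult_ac)
      have "Q > 0" using Q(1) D xy_pos by (meson mult_pos_pos order_less_le_trans)
      have "coeff_sum \<kappa> n > 0"
        using \<rho>[OF elim(2)] c xy_pos unfolding xy by (meson mult_pos_pos order_less_le_trans)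
      have A1: "antimono_on {1..} (\<lambda>j. (\<kappa> n j)\<^sup>2)"
        using assms(2) elim(2) unfolding assumption_A1_def by blast
      note bounds = cutoff_bounds[OF A1 \<open>coeff_sum \<kappa> n > 0\<close>
          \<open>Q > 0\<close>[unfolded k_Q_def], folded k_Q_def]
      have "(\<kappa> n k)\<^sup>2 > 0"
        using elim(1) B(1) by (cases "\<kappa> n k = 0") (auto simp: k_Q_def)
      then have b: "(\<kappa> n 1)\<^sup>2 \<le> B * (\<kappa> n k)\<^sup>2"
        using elim(1) unfolding k_Q_def by (simp add: divide_le_eq)
      note main = coefficient_scale_arith[OF xy_pos c D B(2) zero_le_power2 zero_le_power2 of_nat_0_le_iff \<rho>[OF elim(2), folded xy, THEN conjunct1]
         \<rho>[OF elim(2), folded xy, THEN conjunct2] Q b bounds]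
      have "c * x \<le> D\<^sub>1 / (c\<^sub>2 * B) * x" "2 * B\<^sup>2 * D\<^sub>2 / c\<^sub>1 * x \<le> C' * x"
        "c * (y / x) \<le> c\<^sub>1\<^sup>2 / (4 * B\<^sup>2 * D\<^sub>2) * (y / x)" "c\<^sub>2\<^sup>2 * B / D\<^sub>1 * (y / x) \<le> C' * (y / x)"
        using xy_pos by (intro mult_right_mono; simp add: c_def C'_def)+
      with main show ?case
        unfolding yx unfolding xy[symmetric] k_Q_def(1)[symmetric] by linarith
    qed
  qed
qed

section \<open>Asymptotic normality of weighted sums\<close>

lemma char_distr_scale:
  assumes "real_distribution \<mu>"
  shows "char (distr \<mu> borel (\<lambda>x. c * x)) t = char \<mu> (t * c)"
proof -
  interpret real_distribution \<mu> by fact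
  show ?thesis unfolding char_def by (subst integral_distr) (auto simp: mult_ac)
qed

text \<open>Both characteristic functions have the same second order Taylor polynomial, so each is
  compared with that. Using the Gaussian characteristic function itself, rather than
  \<open>1 - u\<^sup>2 v / 2\<close>, as the comparison object keeps every factor of the later product in the unit
  disc, also when \<open>u\<close> is large.\<close>
lemma char_minus_gaussian_le:
  fixes \<mu> :: "real measure" and u v :: real
  assumes "real_distribution \<mu>"
    and \<mu>: "integrable \<mu> (\<lambda>x. x)" "(LINT x|\<mu>. x) = 0" "integrable \<mu> (\<lambda>x. x\<^sup>2)" "(LINT x|\<mu>. x\<^sup>2) = v"
    and "v \<ge> 0"
  shows "cmod (char \<mu> u - char std_normal_distribution (u * sqrt v)) \<le>
    u\<^sup>2 / 6 * ((LINT x|\<mu>. min (6 * x\<^sup>2) (\<bar>u\<bar> * \<bar>x\<bar> ^ 3)) +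
       v * (LINT x|std_normal_distribution. min (6 * x\<^sup>2) (\<bar>u * sqrt v\<bar> * \<bar>x\<bar> ^ 3)))"
proof -
  interpret real_distribution \<mu> by fact
  interpret N: real_distribution std_normal_distribution by (rule real_dist_normal_dist)
  let ?z = "1 - u\<^sup>2 * v / 2 :: complex"
  have "cmod (char \<mu> u - ?z) \<le> u\<^sup>2 / 6 * (LINT x|\<mu>. min (6 * x\<^sup>2) (\<bar>u\<bar> * \<bar>x\<bar> ^ 3))"
    using \<mu> by (intro char_approx3) auto
  moreover have "cmod (char std_normal_distribution (u * sqrt v) - ?z) \<le>
    (u * sqrt v)\<^sup>2 / 6 * (LINT x|std_normal_distribution. min (6 * x\<^sup>2) (\<bar>u * sqrt v\<bar> * \<bar>x\<bar> ^ 3))"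
  proof -
    have N1: "integrable std_normal_distribution (\<lambda>x. x)" "(LINT x|std_normal_distribution. x) = 0"
      using integrable_std_normal_distribution_moment[of 1] integral_std_normal_distribution_moment_odd[of 1]
      by simp_all
    have N2: "integrable std_normal_distribution (\<lambda>x. x\<^sup>2)" "N.variance (\<lambda>x. x) = 1"
      using std_normal_distribution_even_moments[of 1] N1 by (simp_all add: fact_numeral)
    have "(complex_of_real u * complex_of_real (sqrt v))\<^sup>2 = u\<^sup>2 * v"
      using assms(6) by (simp add: power_mult_distrib of_real_power[symmetric] del: of_real_power)
    then show ?thesis using N.char_approx3[OF N1 N2, of "u * sqrt v"] by simp
  qed
  moreover have "(u * sqrt v)\<^sup>2 = u\<^sup>2 * v" using assms(6) by (simp add: power_mult_distrib)
  ultimately have "cmod (char \<mu> u - ?z) + cmod (?z - char std_normal_distribution (u * sqrt v)) \<le>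
    u\<^sup>2 / 6 * ((LINT x|\<mu>. min (6 * x\<^sup>2) (\<bar>u\<bar> * \<bar>x\<bar> ^ 3)) +
       v * (LINT x|std_normal_distribution. min (6 * x\<^sup>2) (\<bar>u * sqrt v\<bar> * \<bar>x\<bar> ^ 3)))"
    by (simp add: norm_minus_commute distrib_left)
  then show ?thesis
    using norm_triangle_ineq[of "char \<mu> u - ?z" "?z - char std_normal_distribution (u * sqrt v)"]
    by simp
qed

lemma truncated_third_moment_tendsto_0:
  fixes \<mu> :: "real measure" and e :: "nat \<Rightarrow> real"
  assumes "real_distribution \<mu>" "integrable \<mu> (\<lambda>x. x\<^sup>2)" "e \<longlonglongrightarrow> 0" "\<And>n. e n \<ge> 0"
  shows "(\<lambda>n. LINT x|\<mu>. min (6 * x\<^sup>2) (e n * \<bar>x\<bar> ^ 3)) \<longlonglongrightarrow> 0"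
proof -
  interpret real_distribution \<mu> by fact
  have "(\<lambda>n. LINT x|\<mu>. min (6 * x\<^sup>2) (e n * \<bar>x\<bar> ^ 3)) \<longlonglongrightarrow> (LINT x|\<mu>. 0)"
  proof (intro integral_dominated_convergence[where w = "\<lambda>x. 6 * x\<^sup>2"])
    have "(\<lambda>n. min (6 * x\<^sup>2) (e n * \<bar>x\<bar> ^ 3)) \<longlonglongrightarrow> min (6 * x\<^sup>2) (0 * \<bar>x\<bar> ^ 3)" for x
      by (intro tendsto_intros assms)
    then show "AE x in \<mu>. (\<lambda>n. min (6 * x\<^sup>2) (e n * \<bar>x\<bar> ^ 3)) \<longlonglongrightarrow> 0"
      by (simp add: min_absorb2)
  qed (use assms in auto)
  then show ?thesis by simp
qed

text \<open>A central limit theorem for triangular arrays obtained from independent, identically distributed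
  variables by weights whose maximum tends to \<open>0\<close>. Since the squared weights sum to \<open>1 / v\<close>, the Gaussian
  characteristic function factors with the same weights, and the two products of numbers in the
  unit disc differ by at most the sum of the differences of their factors. The weights are small,
  so the truncated third moments in that bound tend to \<open>0\<close>.\<close>
lemma (in prob_space) weighted_central_limit_theorem:
  fixes X :: "'i \<Rightarrow> 'a \<Rightarrow> real" and b :: "nat \<Rightarrow> 'i \<Rightarrow> real" and v :: real
  assumes indep: "indep_vars (\<lambda>_. borel) X J"
    and dist: "\<And>j. j \<in> J \<Longrightarrow> distr M borel (X j) = \<mu>"
    and \<mu>: "integrable \<mu> (\<lambda>x. x)" "(LINT x|\<mu>. x) = 0" "integrable \<mu> (\<lambda>x. x\<^sup>2)" "(LINT x|\<mu>. x\<^sup>2) = v"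
    and "v > 0"
    and I: "\<And>n. finite (I n)" "\<And>n. I n \<subseteq> J"
    and norm: "\<And>n. v * (\<Sum>j\<in>I n. (b n j)\<^sup>2) = 1"
    and small: "\<And>n j. j \<in> I n \<Longrightarrow> \<bar>b n j\<bar> \<le> e n" "e \<longlonglongrightarrow> 0" "\<And>n. e n \<ge> 0"
  shows "weak_conv_m (\<lambda>n. distr M borel (\<lambda>\<omega>. \<Sum>j\<in>I n. b n j * X j \<omega>)) std_normal_distribution"
proof (rule levy_continuity)
  interpret N: real_distribution std_normal_distribution by (rule real_dist_normal_dist)
  have rv: "random_variable borel (X j)" if "j \<in> J" for j
    using indep that by (simp add: indep_vars_def2)
  have rv': "random_variable borel (X j)" if "j \<in> I n" for j n
    using rv that I by blast
  show "real_distribution (distr M borel (\<lambda>\<omega>. \<Sum>j\<in>I n. b n j * X j \<omega>))" for n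
    using rv' by (intro real_distribution_distr borel_measurable_sum borel_measurable_times) auto
  obtain j where "j \<in> J"
    using norm[of 0] I[of 0] by (cases "I 0 = {}") auto
  then have \<mu>_dist: "real_distribution \<mu>"
    using dist[of j] rv[of j] by (metis real_distribution_distr)
  interpret \<mu>: real_distribution \<mu> by fact
  fix t :: real
  define g where "g n = (LINT x|\<mu>. min (6 * x\<^sup>2) (\<bar>t\<bar> * e n * \<bar>x\<bar> ^ 3))" for n
  define h where "h n = (LINT x|std_normal_distribution. min (6 * x\<^sup>2) (\<bar>t\<bar> * e n * sqrt v * \<bar>x\<bar> ^ 3))" for n
  have N2: "integrable std_normal_distribution (\<lambda>x. x\<^sup>2)"
    by (rule integrable_std_normal_distribution_moment)
  have "(\<lambda>n. \<bar>t\<bar> * e n) \<longlonglongrightarrow> \<bar>t\<bar> * 0" "(\<lambda>n. \<bar>t\<bar> * e n * sqrt v) \<longlonglongrightarrow> \<bar>t\<bar> * 0 * sqrt v"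
    by (intro tendsto_intros small)+
  then have gh: "g \<longlonglongrightarrow> 0" "h \<longlonglongrightarrow> 0"
    unfolding g_def[abs_def] h_def[abs_def] using small(3) \<open>v > 0\<close>
    by (auto intro!: truncated_third_moment_tendsto_0 \<mu>_dist real_dist_normal_dist \<mu> N2)
  have char_S: "char (distr M borel (\<lambda>\<omega>. \<Sum>j\<in>I n. b n j * X j \<omega>)) t = (\<Prod>j\<in>I n. char \<mu> (t * b n j))" for n
  proof -
    have "indep_vars (\<lambda>_. borel) (\<lambda>j \<omega>. b n j * X j \<omega>) (I n)"
      by (rule indep_vars_compose2[OF indep_vars_subset[OF indep I(2)]]) auto
    then have "char (distr M borel (\<lambda>\<omega>. \<Sum>j\<in>I n. b n j * X j \<omega>)) t =
        (\<Prod>j\<in>I n. char (distr M borel (\<lambda>\<omega>. b n j * X j \<omega>)) t)"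
      by (rule char_distr_sum)
    also have "\<dots> = (\<Prod>j\<in>I n. char \<mu> (t * b n j))"
    proof (intro prod.cong refl)
      fix j assume "j \<in> I n"
      then have "distr M borel (\<lambda>\<omega>. b n j * X j \<omega>) = distr \<mu> borel (\<lambda>x. b n j * x)"
        using dist[of j] I(2)[of n] rv'[of j n]
        by (subst dist[symmetric]) (auto simp: distr_distr o_def)
      then show "char (distr M borel (\<lambda>\<omega>. b n j * X j \<omega>)) t = char \<mu> (t * b n j)"
        by (simp add: char_distr_scale[OF \<mu>_dist])
    qed
    finally show ?thesis .
  qed
  have char_N: "char std_normal_distribution t = (\<Prod>j\<in>I n. char std_normal_distribution (t * b n j * sqrt v))" for n
  proof -
    have "- t\<^sup>2 / 2 = (- t\<^sup>2 / 2) * (v * (\<Sum>j\<in>I n. (b n j)\<^sup>2))" by (simp add: norm)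
    also have "\<dots> = (\<Sum>j\<in>I n. - (t * b n j * sqrt v)\<^sup>2 / 2)"
      using \<open>v > 0\<close> by (simp add: sum_distrib_left power_mult_distrib mult_ac sum_negf sum_divide_distrib)
    finally show ?thesis
      by (simp add: char_std_normal_distribution exp_sum[OF I(1)] of_real_prod[symmetric] del: of_real_prod)
  qed
  have bound: "cmod (char (distr M borel (\<lambda>\<omega>. \<Sum>j\<in>I n. b n j * X j \<omega>)) t - char std_normal_distribution t)
      \<le> t\<^sup>2 / (6 * v) * (g n + v * h n)" for n
  proof -
    have step: "cmod (char \<mu> (t * b n j) - char std_normal_distribution (t * b n j * sqrt v)) \<le>
       (b n j)\<^sup>2 * (t\<^sup>2 / 6 * (g n + v * h n))" if j: "j \<in> I n" for j
    proof -
      let ?u = "t * b n j"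
      have u: "\<bar>?u\<bar> \<le> \<bar>t\<bar> * e n" using small(1)[OF j] by (simp add: abs_mult mult_left_mono)
      then have u': "\<bar>?u * sqrt v\<bar> \<le> \<bar>t\<bar> * e n * sqrt v"
        using mult_right_mono[OF u, of "sqrt v"] \<open>v > 0\<close> by (simp add: abs_mult)
      have "(LINT x|\<mu>. min (6 * x\<^sup>2) (\<bar>?u\<bar> * \<bar>x\<bar> ^ 3)) \<le> g n"
        unfolding g_def using u small(3) \<mu>(3)
        by (intro integral_mono Bochner_Integration.integrable_bound[OF integrable_mult_right[OF \<mu>(3), of 6]] min.mono mult_right_mono)
          auto
      moreover have "(LINT x|std_normal_distribution. min (6 * x\<^sup>2) (\<bar>?u * sqrt v\<bar> * \<bar>x\<bar> ^ 3)) \<le> h n"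
        unfolding h_def using u' small(3) \<open>v > 0\<close>
        by (intro integral_mono Bochner_Integration.integrable_bound[OF integrable_mult_right[OF N2, of 6]] min.mono mult_right_mono)
          auto
      ultimately have "?u\<^sup>2 / 6 * ((LINT x|\<mu>. min (6 * x\<^sup>2) (\<bar>?u\<bar> * \<bar>x\<bar> ^ 3)) +
          v * (LINT x|std_normal_distribution. min (6 * x\<^sup>2) (\<bar>?u * sqrt v\<bar> * \<bar>x\<bar> ^ 3))) \<le> ?u\<^sup>2 / 6 * (g n + v * h n)"
        using \<open>v > 0\<close> by (intro mult_left_mono add_mono) auto
      with char_minus_gaussian_le[OF \<mu>_dist \<mu>, of ?u] \<open>v > 0\<close> show ?thesis
        by (simp add: power_mult_distrib mult_ac)
    qed
    have "cmod (char (distr M borel (\<lambda>\<omega>. \<Sum>j\<in>I n. b n j * X j \<omega>)) t - char std_normal_distribution t)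
      \<le> (\<Sum>j\<in>I n. cmod (char \<mu> (t * b n j) - char std_normal_distribution (t * b n j * sqrt v)))"
      unfolding char_S char_N[of n] by (intro norm_prod_diff \<mu>.cmod_char_le_1 N.cmod_char_le_1)
    also have "\<dots> \<le> (\<Sum>j\<in>I n. (b n j)\<^sup>2 * (t\<^sup>2 / 6 * (g n + v * h n)))"
      by (intro sum_mono step)
    also have "\<dots> = (\<Sum>j\<in>I n. (b n j)\<^sup>2) * (t\<^sup>2 / 6 * (g n + v * h n))"
      by (simp add: sum_distrib_right)
    also have "(\<Sum>j\<in>I n. (b n j)\<^sup>2) = 1 / v"
      using norm[of n] \<open>v > 0\<close> by (simp add: eq_divide_eq mult.commute)
    finally show ?thesis using \<open>v > 0\<close> by (simp add: mult_ac)
  qed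
  have "(\<lambda>n. t\<^sup>2 / (6 * v) * (g n + v * h n)) \<longlonglongrightarrow> t\<^sup>2 / (6 * v) * (0 + v * 0)"
    by (intro tendsto_intros gh)
  then have "(\<lambda>n. t\<^sup>2 / (6 * v) * (g n + v * h n)) \<longlonglongrightarrow> 0" by simp
  then have "(\<lambda>n. char (distr M borel (\<lambda>\<omega>. \<Sum>j\<in>I n. b n j * X j \<omega>)) t
      - char std_normal_distribution t) \<longlonglongrightarrow> 0"
    by (rule Lim_null_comparison[OF always_eventually, rotated]) (rule allI, rule bound)
  then show "(\<lambda>n. char (distr M borel (\<lambda>\<omega>. \<Sum>j\<in>I n. b n j * X j \<omega>)) t)
      \<longlonglongrightarrow> char std_normal_distribution t"
    by (rule LIM_zero_cancel)
qed (rule real_dist_normal_dist)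

lemma continuous_cdf_attains:
  assumes "real_distribution \<nu>" "\<And>x. isCont (cdf \<nu>) x" "0 < p" "p < 1"
  obtains q where "cdf \<nu> q = p"
proof -
  interpret real_distribution \<nu> by fact
  obtain a where a: "cdf \<nu> a < p"
    using order_tendstoD(2)[OF cdf_lim_at_bot assms(3)] eventually_happens' trivial_limit_at_bot_linorder
    by blast
  obtain b where b: "cdf \<nu> b > p"
    using order_tendstoD(1)[OF cdf_lim_at_top_prob assms(4)] eventually_happens' trivial_limit_at_top_linorder
    by blast
  have "a \<le> b" using a b cdf_nondecreasing[of b a] by linarith
  then show ?thesis using IVT[of "cdf \<nu>" a p b] a b assms(2) that by auto
qed

text \<open>Polya's theorem. Monotonicity lets the finitely many quantiles of levels \<open>k / m\<close> control all
  arguments. Uniformity is essential below, because the thresholds of the tests are an arbitrary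
  sequence.\<close>
lemma weak_conv_m_imp_uniform:
  fixes \<mu> :: "nat \<Rightarrow> real measure" and \<nu> :: "real measure" and \<epsilon> :: real
  assumes "\<And>n. real_distribution (\<mu> n)" "real_distribution \<nu>" "weak_conv_m \<mu> \<nu>"
    and cont: "\<And>x. isCont (cdf \<nu>) x" and "\<epsilon> > 0"
  shows "\<forall>\<^sub>F n in sequentially. \<forall>x. \<bar>cdf (\<mu> n) x - cdf \<nu> x\<bar> \<le> \<epsilon>"
proof -
  interpret \<mu>: real_distribution "\<mu> n" for n by (rule assms)
  interpret \<nu>: real_distribution \<nu> by (rule assms)
  \<comment> \<open>Each bound below loses at most three steps of the grid: one by rounding \<open>cdf \<nu> x\<close>, one by passing
    to the neighbouring quantile, one by the convergence there.\<close>
  obtain m :: nat where m: "real m > 3 / \<epsilon>" using reals_Archimedean2 by blast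
  then have m0: "real m > 0" using \<open>\<epsilon> > 0\<close> by (meson divide_pos_pos less_trans zero_less_numeral)
  have "\<exists>q. cdf \<nu> q = p" if "0 < p" "p < 1" for p
    using continuous_cdf_attains[OF assms(2) cont that] by blast
  then obtain q where q: "\<And>p. 0 < p \<Longrightarrow> p < 1 \<Longrightarrow> cdf \<nu> (q p) = p" by metis
  define r where "r k = q (real k / real m)" for k
  have r: "cdf \<nu> (r k) = real k / real m" if "0 < k" "k < m" for k
    using that m0 by (simp add: r_def q)
  have lim: "(\<lambda>n. cdf (\<mu> n) x) \<longlonglongrightarrow> cdf \<nu> x" for x
    using assms(3) cont by (simp add: weak_conv_m_def weak_conv_def)
  have "\<forall>\<^sub>F n in sequentially. \<forall>k\<in>{..<m}. dist (cdf (\<mu> n) (r k)) (cdf \<nu> (r k)) < 1 / real m"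
    using m0 by (intro eventually_ball_finite finite_lessThan ballI tendstoD[OF lim]) simp
  then show ?thesis
  proof eventually_elim
    case (elim n)
    show ?case
    proof
      fix x
      define k where "k = nat \<lfloor>real m * cdf \<nu> x\<rfloor>"
      have nn: "real m * cdf \<nu> x \<ge> 0" using m0 \<nu>.cdf_nonneg[of x] by simp
      have k1: "real k \<le> real m * cdf \<nu> x" "real m * cdf \<nu> x < real k + 1"
        using nn by (auto simp: k_def)
      have k: "real k / real m \<le> cdf \<nu> x" "cdf \<nu> x < (real k + 1) / real m"
        using k1 m0 by (simp_all add: divide_le_eq less_divide_eq mult.commute)
      have upper: "cdf (\<mu> n) x \<le> (real k + 2) / real m"
      proof (cases "Suc k < m")
        case True
        then have rk: "cdf \<nu> (r (Suc k)) = (real k + 1) / real m" using r[of "Suc k"] by (simp add: add.commute)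
        then have "x \<le> r (Suc k)" using k(2) \<nu>.cdf_nondecreasing[of "r (Suc k)" x] by linarith
        then have "cdf (\<mu> n) x \<le> cdf (\<mu> n) (r (Suc k))" by (rule \<mu>.cdf_nondecreasing)
        also have "\<dots> \<le> (real k + 1) / real m + 1 / real m"
          using elim True rk by (force simp: dist_real_def dest: bspec[of _ _ "Suc k"])
        finally show ?thesis by (simp add: add_divide_distrib)
      next
        case False
        then have "1 \<le> (real k + 2) / real m" using m0 by (simp add: le_divide_eq)
        with \<mu>.cdf_bounded_prob[of n x] show ?thesis by linarith
      qed
      have lower: "cdf (\<mu> n) x \<ge> (real k - 2) / real m"
      proof (cases "k \<le> 1")
        case True
        then have "(real k - 2) / real m \<le> 0" using m0 by (simp add: divide_le_eq)
        with \<mu>.cdf_nonneg[of n x] show ?thesis by linarith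
      next
        case False
        have "real k \<le> real m * 1"
          using k1(1) mult_left_mono[OF \<nu>.cdf_bounded_prob[of x], of "real m"] m0 by linarith
        then have km: "0 < k - 1" "k - 1 < m" using False by auto
        then have rk: "cdf \<nu> (r (k - 1)) = (real k - 1) / real m" using r[of "k - 1"] False by (simp add: of_nat_diff)
        moreover have "(real k - 1) / real m < real k / real m" using m0 by (simp add: divide_strict_right_mono)
        ultimately have "r (k - 1) \<le> x" using k(1) \<nu>.cdf_nondecreasing[of x "r (k - 1)"] by linarith
        then have "cdf (\<mu> n) (r (k - 1)) \<le> cdf (\<mu> n) x" by (rule \<mu>.cdf_nondecreasing)
        moreover have "cdf (\<mu> n) (r (k - 1)) \<ge> (real k - 1) / real m - 1 / real m"
          using bspec[OF elim, of "k - 1"] km rk by (auto simp: dist_real_def)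
        ultimately show ?thesis by (simp add: diff_divide_distrib)
      qed
      have "3 / real m \<le> \<epsilon>" using m \<open>\<epsilon> > 0\<close> m0 by (simp add: divide_less_eq divide_le_eq mult.commute)
      with upper lower k show "\<bar>cdf (\<mu> n) x - cdf \<nu> x\<bar> \<le> \<epsilon>"
        by (simp add: add_divide_distrib diff_divide_distrib abs_le_iff)
    qed
  qed
qed

abbreviation \<Phi> :: "real \<Rightarrow> real" where "\<Phi> \<equiv> cdf std_normal_distribution"

lemma normal_cdf_lipschitz: "\<bar>\<Phi> x - \<Phi> y\<bar> \<le> \<bar>x - y\<bar>"
proof -
  interpret N: real_distribution std_normal_distribution by (rule real_dist_normal_dist)
  have dens: "std_normal_density z \<le> 1" for z
  proof -
    have "1 * 1 \<le> sqrt (2 * pi) " using pi_gt3 by simp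
    then have "exp (- z\<^sup>2 / 2) \<le> sqrt (2 * pi)" using order_trans[of "exp (- z\<^sup>2 / 2)" 1] by simp
    then show ?thesis by (simp add: std_normal_density_def field_simps)
  qed
  have *: "\<Phi> y - \<Phi> x \<le> y - x" if "x < y" for x y
  proof -
    have "emeasure std_normal_distribution {x<..y} = (\<integral>\<^sup>+ z. ennreal (std_normal_density z) * indicator {x<..y} z \<partial>lborel)"
      by (subst emeasure_density) auto
    also have "\<dots> \<le> (\<integral>\<^sup>+ z. indicator {x<..y} z \<partial>lborel)"
      using dens by (intro nn_integral_mono) (auto simp: indicator_def)
    also have "\<dots> = ennreal (y - x)" using that by simp
    finally show ?thesis
      using that N.cdf_diff_eq[OF that] by (simp add: N.emeasure_eq_measure)
  qed
  show ?thesis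
    using *[of x y] *[of y x] N.cdf_nondecreasing[of x y] N.cdf_nondecreasing[of y x]
    by (cases x y rule: linorder_cases) auto
qed

lemma normal_cdf_strict_mono:
  assumes "x < y" shows "\<Phi> x < \<Phi> y"
proof -
  interpret N: real_distribution std_normal_distribution by (rule real_dist_normal_dist)
  have "emeasure std_normal_distribution {x<..y} \<noteq> 0"
  proof
    assume "emeasure std_normal_distribution {x<..y} = 0"
    then have "{x<..y} \<in> null_sets (density lborel (\<lambda>x. ennreal (std_normal_density x)))"
      by (auto simp: null_sets_def)
    then have "AE z in lborel. z \<in> {x<..y} \<longrightarrow> ennreal (std_normal_density z) = 0"
      by (subst (asm) null_sets_density_iff) auto
    then have "AE z in lborel. z \<notin> {x<..y}"
      by eventually_elim (use normal_density_pos[of 1 0] in \<open>auto simp: ennreal_eq_0_iff simp flip: not_less\<close>)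
    then have "{x<..y} \<in> null_sets lborel"
      by (subst AE_iff_null_sets) auto
    with assms show False by (simp add: null_sets_def)
  qed
  then have "measure std_normal_distribution {x<..y} > 0"
    by (simp add: N.emeasure_eq_measure zero_less_measure_iff)
  then show ?thesis using N.cdf_diff_eq[OF assms] by simp
qed

lemma isCont_normal_cdf: "isCont \<Phi> x"
proof -
  have "1-lipschitz_on UNIV \<Phi>"
    by (rule lipschitz_onI) (auto simp: dist_real_def normal_cdf_lipschitz)
  then show ?thesis
    using lipschitz_on_continuous_on continuous_on_eq_continuous_at[OF open_UNIV] by blast
qed

section \<open>Decomposition of the test statistic\<close>

text \<open>For nonnegative terms the convention that a divergent sum is \<open>0\<close> agrees with the convention
  \<open>enn2real \<infinity> = 0\<close>, so divergent sums satisfy the identity as well. It makes the test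
  statistic measurable and gives access to monotone convergence.\<close>
lemma infsum_nonneg_eq_enn2real:
  fixes g :: "nat \<Rightarrow> real"
  assumes "\<And>j. g j \<ge> 0"
  shows "infsum g {N<..} = enn2real (\<Sum>j. ennreal (g (N + Suc j)))"
    and "g summable_on {N<..} \<longleftrightarrow> (\<Sum>j. ennreal (g (N + Suc j))) \<noteq> \<infinity>"
proof -
  have bij: "bij_betw (\<lambda>j. N + Suc j) UNIV {N<..}"
    by (rule bij_betwI[of _ _ _ "\<lambda>j. j - Suc N"]) auto
  have eq: "g summable_on {N<..} \<longleftrightarrow> summable (\<lambda>j. g (N + Suc j))"
    unfolding summable_on_reindex_bij_betw[OF bij, of g, symmetric]
    by (rule summable_on_UNIV_nonneg_real_iff) (rule assms)
  show iff: "g summable_on {N<..} \<longleftrightarrow> (\<Sum>j. ennreal (g (N + Suc j))) \<noteq> \<infinity>"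
  proof
    assume "g summable_on {N<..}"
    then have "summable (\<lambda>j. g (N + Suc j))" using eq by blast
    then have "(\<Sum>j. ennreal (g (N + Suc j))) = ennreal (\<Sum>j. g (N + Suc j))"
      by (intro suminf_ennreal2 assms)
    then show "(\<Sum>j. ennreal (g (N + Suc j))) \<noteq> \<infinity>" by (simp only:) simp
  next
    assume "(\<Sum>j. ennreal (g (N + Suc j))) \<noteq> \<infinity>"
    then have "summable (\<lambda>j. g (N + Suc j))"
      by (intro summable_suminf_not_top assms) (simp only: infinity_ennreal_def not_False_eq_True)
    then show "g summable_on {N<..}" using eq by blast
  qed
  show "infsum g {N<..} = enn2real (\<Sum>j. ennreal (g (N + Suc j)))"
  proof (cases "g summable_on {N<..}")
    case True
    then have s: "summable (\<lambda>j. g (N + Suc j))" using eq by blast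
    have "infsum g {N<..} = infsum (\<lambda>j. g (N + Suc j)) UNIV"
      by (rule infsum_reindex_bij_betw[OF bij, symmetric])
    also have "\<dots> = (\<Sum>j. g (N + Suc j))"
      by (intro infsumI sums_nonneg_imp_has_sum summable_sums s always_eventually allI assms)
    also have "\<dots> = enn2real (\<Sum>j. ennreal (g (N + Suc j)))"
      unfolding suminf_ennreal2[OF assms s] by (intro enn2real_ennreal[symmetric] suminf_nonneg s assms)
    finally show ?thesis .
  next
    case False
    then have "infsum g {N<..} = 0" by (rule infsum_not_exists)
    moreover have "(\<Sum>j. ennreal (g (N + Suc j))) = \<infinity>" using False iff by blast
    ultimately show ?thesis by (simp only: infinity_ennreal_def enn2real_top)
  qed
qed

lemma atLeast_Suc_0_eq: "{1::nat..} = {0<..}"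
  by auto

lemma infsum_split_at:
  fixes g :: "nat \<Rightarrow> real"
  assumes "g summable_on {N<..}"
  shows "g summable_on {1..}" "infsum g {1..} = (\<Sum>j\<in>{1..N}. g j) + infsum g {N<..}"
proof -
  have eq: "{1..} = {1..N} \<union> {N<..}" by auto
  show "g summable_on {1..}"
    unfolding eq using assms by (intro summable_on_Un_disjoint) auto
  show "infsum g {1..} = (\<Sum>j\<in>{1..N}. g j) + infsum g {N<..}"
    unfolding eq using assms by (subst infsum_Un_disjoint) auto
qed

lemma gaussian_sequence_distr:
  assumes "standard_gaussian_sequence M \<xi>" "j \<ge> 1"
  shows "\<xi> j \<in> borel_measurable M" "distr M borel (\<xi> j) = std_normal_distribution"
proof -
  have d: "distributed M lborel (\<xi> j) std_normal_density"
    using assms by (simp add: standard_gaussian_sequence_def)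
  then show "\<xi> j \<in> borel_measurable M" by (auto simp: distributed_def)
  have "distr M lborel (\<xi> j) = std_normal_distribution"
    using d by (simp add: distributed_distr_eq_density)
  moreover have "distr M borel (\<xi> j) = distr M lborel (\<xi> j)"
    by (rule distr_cong) auto
  ultimately show "distr M borel (\<xi> j) = std_normal_distribution" by simp
qed

lemma gaussian_sequence_moments:
  assumes "standard_gaussian_sequence M \<xi>" "j \<ge> 1"
  shows "integrable M (\<lambda>\<omega>. \<xi> j \<omega> ^ k)"
    and "(LINT \<omega>|M. \<xi> j \<omega> ^ k) = (LINT x|std_normal_distribution. x ^ k)"
proof -
  note d = gaussian_sequence_distr[OF assms]
  have "integrable (distr M borel (\<xi> j)) (\<lambda>x. x ^ k)"
    unfolding d(2) by (rule integrable_std_normal_distribution_moment)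
  then show "integrable M (\<lambda>\<omega>. \<xi> j \<omega> ^ k)"
    by (subst (asm) integrable_distr_eq) (use d in auto)
  show "(LINT \<omega>|M. \<xi> j \<omega> ^ k) = (LINT x|std_normal_distribution. x ^ k)"
    unfolding d(2)[symmetric] by (subst integral_distr) (use d in auto)
qed

lemma gaussian_sequence_mean_var:
  assumes "standard_gaussian_sequence M \<xi>" "j \<ge> 1"
  shows "integrable M (\<xi> j)" "(LINT \<omega>|M. \<xi> j \<omega>) = 0"
    "integrable M (\<lambda>\<omega>. (\<xi> j \<omega>)\<^sup>2)" "(LINT \<omega>|M. (\<xi> j \<omega>)\<^sup>2) = 1"
  using gaussian_sequence_moments[OF assms, of 1] gaussian_sequence_moments[OF assms, of 2]
    integral_std_normal_distribution_moment_odd[of 1] std_normal_distribution_even_moments(1)[of 1]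
  by (simp_all add: fact_numeral)

text \<open>Mean and second moment are proved together by induction: the mixed term of the new summand
  and the old sum factors by independence and vanishes because both means do.\<close>
lemma gaussian_linear_combination:
  fixes c :: "nat \<Rightarrow> real"
  assumes \<xi>: "standard_gaussian_sequence M \<xi>" and F: "finite F" "F \<subseteq> {1..}"
  defines "S \<equiv> (\<lambda>\<omega>. \<Sum>j\<in>F. c j * \<xi> j \<omega>)"
  shows "S \<in> borel_measurable M" "integrable M (\<lambda>\<omega>. (S \<omega>)\<^sup>2)" "(LINT \<omega>|M. S \<omega>) = 0"
    "(LINT \<omega>|M. (S \<omega>)\<^sup>2) = (\<Sum>j\<in>F. (c j)\<^sup>2)"
proof -
  interpret prob_space M using \<xi> by (simp add: standard_gaussian_sequence_def)
  have indep: "indep_vars (\<lambda>_. borel) \<xi> {1..}" using \<xi> by (simp add: standard_gaussian_sequence_def)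
  have *: "(\<lambda>\<omega>. \<Sum>j\<in>F. c j * \<xi> j \<omega>) \<in> borel_measurable M \<and>
      integrable M (\<lambda>\<omega>. \<Sum>j\<in>F. c j * \<xi> j \<omega>) \<and>
      integrable M (\<lambda>\<omega>. (\<Sum>j\<in>F. c j * \<xi> j \<omega>)\<^sup>2) \<and>
      (LINT \<omega>|M. (\<Sum>j\<in>F. c j * \<xi> j \<omega>)) = 0 \<and>
      (LINT \<omega>|M. (\<Sum>j\<in>F. c j * \<xi> j \<omega>)\<^sup>2) = (\<Sum>j\<in>F. (c j)\<^sup>2)"
    using F
  proof (induction F rule: finite_induct)
    case empty
    then show ?case by simp
  next
    case (insert i F)
    let ?S = "\<lambda>\<omega>. \<Sum>j\<in>F. c j * \<xi> j \<omega>"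
    have i: "i \<ge> 1" and IH: "?S \<in> borel_measurable M" "integrable M ?S" "integrable M (\<lambda>\<omega>. (?S \<omega>)\<^sup>2)"
      "(LINT \<omega>|M. ?S \<omega>) = 0" "(LINT \<omega>|M. (?S \<omega>)\<^sup>2) = (\<Sum>j\<in>F. (c j)\<^sup>2)"
      using insert by auto
    note m = gaussian_sequence_distr(1)[OF \<xi> i] gaussian_sequence_mean_var[OF \<xi> i]
    have "indep_vars (\<lambda>_. borel) (\<lambda>j \<omega>. c j * \<xi> j \<omega>) (insert i F)"
      by (rule indep_vars_compose2[OF indep_vars_subset[OF indep insert.prems]]) auto
    then have iv: "indep_var borel (\<lambda>\<omega>. c i * \<xi> i \<omega>) borel ?S"
      by (rule indep_vars_sum[OF insert.hyps])
    have ci: "integrable M (\<lambda>\<omega>. c i * \<xi> i \<omega>)" "(LINT \<omega>|M. c i * \<xi> i \<omega>) = 0"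
      using m by simp_all
    have cross: "integrable M (\<lambda>\<omega>. (c i * \<xi> i \<omega>) * ?S \<omega>)" "(LINT \<omega>|M. (c i * \<xi> i \<omega>) * ?S \<omega>) = 0"
      using indep_var_integrable[OF iv ci(1) IH(2)] indep_var_lebesgue_integral[OF iv ci(1) IH(2)] m(3) IH(4)
      by auto
    have sq: "(c i * \<xi> i \<omega> + ?S \<omega>)\<^sup>2 = (c i)\<^sup>2 * (\<xi> i \<omega>)\<^sup>2 + 2 * ((c i * \<xi> i \<omega>) * ?S \<omega>) + (?S \<omega>)\<^sup>2" for \<omega>
      by (simp add: power2_sum power_mult_distrib mult_ac)
    have sq1: "integrable M (\<lambda>\<omega>. (c i)\<^sup>2 * (\<xi> i \<omega>)\<^sup>2)" "(LINT \<omega>|M. (c i)\<^sup>2 * (\<xi> i \<omega>)\<^sup>2) = (c i)\<^sup>2"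
      using m by auto
    have sq2: "integrable M (\<lambda>\<omega>. 2 * ((c i * \<xi> i \<omega>) * ?S \<omega>))" "(LINT \<omega>|M. 2 * ((c i * \<xi> i \<omega>) * ?S \<omega>)) = 0"
      using cross by (auto simp del: mult.assoc)
    show ?case
      unfolding sum.insert[OF insert.hyps] sq
      using IH ci m(3) sq1 sq2 m(1)
      by (auto simp del: integral_mult_right_zero integral_mult_left_zero Bochner_Integration.integral_mult_right)
  qed
  then show "S \<in> borel_measurable M" "integrable M (\<lambda>\<omega>. (S \<omega>)\<^sup>2)" "(LINT \<omega>|M. S \<omega>) = 0"
    "(LINT \<omega>|M. (S \<omega>)\<^sup>2) = (\<Sum>j\<in>F. (c j)\<^sup>2)"
    unfolding S_def by auto
qed

text \<open>The centred square of a standard Gaussian variable has variance \<open>E x\<^sup>4 - (E x\<^sup>2)\<^sup>2 = 3 - 1 = 2\<close>.\<close>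
lemma square_minus_one_distr:
  assumes \<xi>: "standard_gaussian_sequence M \<xi>"
  defines "\<mu> \<equiv> distr std_normal_distribution borel (\<lambda>x. x\<^sup>2 - 1)"
  shows "\<And>j. j \<ge> 1 \<Longrightarrow> distr M borel (\<lambda>\<omega>. (\<xi> j \<omega>)\<^sup>2 - 1) = \<mu>"
    and "integrable \<mu> (\<lambda>x. x)" "(LINT x|\<mu>. x) = 0" "integrable \<mu> (\<lambda>x. x\<^sup>2)" "(LINT x|\<mu>. x\<^sup>2) = 2"
proof -
  interpret N: real_distribution std_normal_distribution by (rule real_dist_normal_dist)
  show "distr M borel (\<lambda>\<omega>. (\<xi> j \<omega>)\<^sup>2 - 1) = \<mu>" if "j \<ge> 1" for j
    unfolding \<mu>_def gaussian_sequence_distr(2)[OF \<xi> that, symmetric]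
    using gaussian_sequence_distr(1)[OF \<xi> that] by (subst distr_distr) (auto simp: o_def)
  have i2: "integrable std_normal_distribution (\<lambda>x. x\<^sup>2)" and i4: "integrable std_normal_distribution (\<lambda>x. x ^ 4)"
    by (rule integrable_std_normal_distribution_moment)+
  have e2: "(LINT x|std_normal_distribution. x\<^sup>2) = 1" and e4: "(LINT x|std_normal_distribution. x ^ 4) = 3"
    using std_normal_distribution_even_moments(1)[of 1] std_normal_distribution_even_moments(1)[of 2]
    by (simp_all add: fact_numeral)
  have sq: "(x\<^sup>2 - 1)\<^sup>2 = x ^ 4 - 2 * x\<^sup>2 + 1" for x :: real
    by (simp add: power2_diff power_mult[symmetric])
  show "integrable \<mu> (\<lambda>x. x)" "integrable \<mu> (\<lambda>x. x\<^sup>2)"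
    unfolding \<mu>_def using i2 i4 by (simp_all add: integrable_distr_eq sq)
  show "(LINT x|\<mu>. x) = 0" "(LINT x|\<mu>. x\<^sup>2) = 2"
    unfolding \<mu>_def using i2 i4 e2 e4 N.prob_space by (simp_all add: integral_distr sq)
qed

text \<open>A quantitative form of Slutsky's lemma, uniform in the argument: replacing \<open>V G + B\<close> by a
  variable within \<open>\<eta>\<close> of it shifts the argument of \<open>\<Phi>\<close> by at most \<open>\<eta> / V\<close>, and \<open>\<Phi>\<close> is
  \<open>1\<close>-Lipschitz.\<close>
lemma (in prob_space) slutsky_cdf_bound:
  fixes Y G :: "'a \<Rightarrow> real"
  assumes rv: "random_variable borel Y" "random_variable borel G"
    and "V > 0" "\<eta> \<ge> 0"
    and \<delta>: "\<And>x. \<bar>prob {\<omega> \<in> space M. G \<omega> \<le> x} - \<Phi> x\<bar> \<le> \<delta>"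
    and p: "prob {\<omega> \<in> space M. \<bar>Y \<omega> - (V * G \<omega> + B)\<bar> > \<eta>} \<le> p"
  shows "\<bar>prob {\<omega> \<in> space M. Y \<omega> \<le> z} - \<Phi> ((z - B) / V)\<bar> \<le> \<delta> + p + \<eta> / V"
proof -
  note [measurable] = rv
  let ?D = "{\<omega> \<in> space M. \<bar>Y \<omega> - (V * G \<omega> + B)\<bar> > \<eta>}"
  have G_ev: "V * g + B \<le> y \<longleftrightarrow> g \<le> (y - B) / V" for g y
    using \<open>V > 0\<close> by (simp add: pos_le_divide_eq algebra_simps)
  have "prob {\<omega> \<in> space M. Y \<omega> \<le> z} \<le> prob ({\<omega> \<in> space M. G \<omega> \<le> (z + \<eta> - B) / V} \<union> ?D)"
    by (intro finite_measure_mono) (auto simp: G_ev[symmetric])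
  also have "\<dots> \<le> prob {\<omega> \<in> space M. G \<omega> \<le> (z + \<eta> - B) / V} + prob ?D"
    by (intro measure_Un_le) auto
  finally have up: "prob {\<omega> \<in> space M. Y \<omega> \<le> z} \<le> prob {\<omega> \<in> space M. G \<omega> \<le> (z + \<eta> - B) / V} + p"
    using p by linarith
  have "prob {\<omega> \<in> space M. G \<omega> \<le> (z - \<eta> - B) / V} \<le> prob ({\<omega> \<in> space M. Y \<omega> \<le> z} \<union> ?D)"
    by (intro finite_measure_mono) (auto simp: G_ev[symmetric])
  also have "\<dots> \<le> prob {\<omega> \<in> space M. Y \<omega> \<le> z} + prob ?D"
    by (intro measure_Un_le) auto
  finally have lo: "prob {\<omega> \<in> space M. G \<omega> \<le> (z - \<eta> - B) / V} \<le> prob {\<omega> \<in> space M. Y \<omega> \<le> z} + p"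
    using p by linarith
  have "\<bar>(z + \<eta> - B) / V - (z - B) / V\<bar> = \<eta> / V" "\<bar>(z - \<eta> - B) / V - (z - B) / V\<bar> = \<eta> / V"
    using \<open>V > 0\<close> \<open>\<eta> \<ge> 0\<close> by (simp_all add: diff_divide_distrib add_divide_distrib)
  then have "\<bar>\<Phi> ((z + \<eta> - B) / V) - \<Phi> ((z - B) / V)\<bar> \<le> \<eta> / V"
    "\<bar>\<Phi> ((z - \<eta> - B) / V) - \<Phi> ((z - B) / V)\<bar> \<le> \<eta> / V"
    using normal_cdf_lipschitz by metis+
  with up lo \<delta>[of "(z + \<eta> - B) / V"] \<delta>[of "(z - \<eta> - B) / V"] show ?thesis
    by linarith
qed

lemma test_statistic_measurable:
  assumes \<xi>: "standard_gaussian_sequence M \<xi>"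
  shows "test_statistic \<sigma> \<phi> \<xi> \<kappa> n f \<in> borel_measurable M"
proof -
  have [measurable]: "\<xi> (Suc j) \<in> borel_measurable M" for j
    using gaussian_sequence_distr(1)[OF \<xi>, of "Suc j"] by simp
  have "test_statistic \<sigma> \<phi> \<xi> \<kappa> n f = (\<lambda>\<omega>. enn2real (\<Sum>j. ennreal ((\<kappa> n (Suc j))\<^sup>2 *
      (f \<bullet> \<phi> (Suc j) + \<sigma> / sqrt (real n) * \<xi> (Suc j) \<omega>)\<^sup>2)) - \<sigma>\<^sup>2 / real n * coeff_sum \<kappa> n)"
    unfolding test_statistic_def atLeast_Suc_0_eq observation_def
    by (subst infsum_nonneg_eq_enn2real) auto
  also have "\<dots> \<in> borel_measurable M" by measurable
  finally show ?thesis .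
qed

lemma inner_basis_le:
  assumes "orthonormal_basis \<phi>" "j \<ge> 1"
  shows "(f \<bullet> \<phi> j)\<^sup>2 \<le> (norm f)\<^sup>2"
proof -
  have "norm (\<phi> j) = 1" using assms by (simp add: orthonormal_basis_def norm_eq_sqrt_inner)
  then have "\<bar>f \<bullet> \<phi> j\<bar> \<le> norm f" using Cauchy_Schwarz_ineq2[of f "\<phi> j"] by simp
  then show ?thesis by (simp add: abs_le_square_iff[symmetric])
qed

text \<open>Expanding the squared observations splits \<open>n\<^sup>2 T\<close> into the centred quadratic noise \<open>S\<close>, the
  energy \<open>B\<close> of the signal, and three errors: the mixed term of signal and noise (bounded in
  second moment), the contribution of the observations beyond \<open>N\<close> (bounded in mean), and the
  deterministic compensators of that contribution. Each is required to be at most \<open>\<eta> / 3\<close>, which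
  explains the constants \<open>36 = 4 * 9\<close> and \<open>3\<close>. The bound \<open>1 / n\<^sup>2\<close> on the discarded coefficients
  is what makes the last two errors of the order of \<open>(norm f)\<^sup>2 + \<sigma>\<^sup>2 / n\<close>.\<close>
lemma statistic_decomposition:
  fixes f :: L2 and \<sigma> \<eta> :: real
  assumes \<xi>: "standard_gaussian_sequence M \<xi>" and basis: "orthonormal_basis \<phi>"
    and n: "n \<ge> 1" and A1: "antimono_on {1..} (\<lambda>j. (\<kappa> n j)\<^sup>2)"
    and summable: "(\<lambda>j. (\<kappa> n j)\<^sup>2) summable_on {1..}"
    and tail_sum: "(\<Sum>\<^sub>\<infinity>j\<in>{N<..}. (\<kappa> n j)\<^sup>2) \<le> 1 / (real n)\<^sup>2" and "\<eta> > 0"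
  defines "S \<equiv> (\<lambda>\<omega>. \<Sum>j\<in>{1..N}. (\<kappa> n j)\<^sup>2 * ((\<xi> j \<omega>)\<^sup>2 - 1))"
    and "B \<equiv> (real n)\<^sup>2 * (\<Sum>\<^sub>\<infinity>j\<in>{1..}. (\<kappa> n j)\<^sup>2 * (f \<bullet> \<phi> j)\<^sup>2)"
  shows "measure M {\<omega> \<in> space M. \<bar>(real n)\<^sup>2 * test_statistic \<sigma> \<phi> \<xi> \<kappa> n f \<omega> - (real n * \<sigma>\<^sup>2 * S \<omega> + B)\<bar> > \<eta>}
    \<le> 36 * \<sigma>\<^sup>2 * (real n)^3 * ((\<kappa> n 1)\<^sup>2)\<^sup>2 * (norm f)\<^sup>2 / \<eta>\<^sup>2 + 3 * ((norm f)\<^sup>2 + \<sigma>\<^sup>2 / real n) / \<eta>"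
proof -
  interpret prob_space M using \<xi> by (simp add: standard_gaussian_sequence_def)
  define a where "a j = (\<kappa> n j)\<^sup>2" for j
  define \<theta> where "\<theta> j = f \<bullet> \<phi> j" for j
  define h where "h = \<sigma> / sqrt (real n)"
  define w where "w = (norm f)\<^sup>2 + \<sigma>\<^sup>2 / real n"
  define y where "y j \<omega> = observation \<sigma> \<phi> \<xi> n f j \<omega>" for j \<omega>
  have y: "y j \<omega> = \<theta> j + h * \<xi> j \<omega>" for j \<omega>
    by (simp add: y_def observation_def \<theta>_def h_def)
  have h2: "h\<^sup>2 = \<sigma>\<^sup>2 / real n" by (simp add: h_def power_divide)
  have a0: "a j \<ge> 0" for j by (simp add: a_def)
  have a1: "a j \<le> a 1" if "j \<ge> 1" for j
    using A1 that by (auto simp: monotone_on_def a_def)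
  have \<theta>2: "(\<theta> j)\<^sup>2 \<le> (norm f)\<^sup>2" if "j \<ge> 1" for j
    unfolding \<theta>_def by (rule inner_basis_le[OF basis that])
  have w0: "w \<ge> 0" by (simp add: w_def)
  have n0: "real n > 0" using n by simp
  note \<xi>_meas = gaussian_sequence_distr(1)[OF \<xi>]
  have [measurable]: "y (N + Suc j) \<in> borel_measurable M" for j
    unfolding y[abs_def]
    by (intro borel_measurable_add borel_measurable_times borel_measurable_const \<xi>_meas) simp
  have sN: "a summable_on {N<..}"
    using summable unfolding a_def[abs_def] by (rule summable_on_subset_banach) auto
  have \<delta>: "infsum a {N<..} \<le> 1 / (real n)\<^sup>2"
    using tail_sum by (simp add: a_def[abs_def])

  define Q where "Q \<omega> = (\<Sum>j. ennreal (a (N + Suc j) * (y (N + Suc j) \<omega>)\<^sup>2))" for \<omega>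
  have [measurable]: "Q \<in> borel_measurable M" unfolding Q_def[abs_def] by measurable
  have "(\<integral>\<^sup>+\<omega>. Q \<omega> \<partial>M) = (\<Sum>j. \<integral>\<^sup>+\<omega>. ennreal (a (N + Suc j) * (y (N + Suc j) \<omega>)\<^sup>2) \<partial>M)"
    unfolding Q_def by (intro nn_integral_suminf) measurable
  also have "\<dots> \<le> (\<Sum>j. ennreal (w * a (N + Suc j)))"
  proof (intro suminf_le allI)
    fix i
    define j where "j = N + Suc i"
    have j: "j \<ge> 1" by (simp add: j_def)
    note m = gaussian_sequence_mean_var[OF \<xi> j]
    have sq: "a j * (y j \<omega>)\<^sup>2 = a j * (\<theta> j)\<^sup>2 + (2 * a j * \<theta> j * h) * \<xi> j \<omega> + (a j * h\<^sup>2) * (\<xi> j \<omega>)\<^sup>2" for \<omega>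
      unfolding y by (simp add: power2_sum power_mult_distrib algebra_simps)
    have int: "integrable M (\<lambda>\<omega>. a j * (y j \<omega>)\<^sup>2)"
      unfolding sq using m by simp
    have "(LINT \<omega>|M. a j * (y j \<omega>)\<^sup>2) = a j * (\<theta> j)\<^sup>2 + a j * h\<^sup>2"
      unfolding sq using m by (simp add: prob_space)
    also have "\<dots> \<le> w * a j"
      using mult_left_mono[OF \<theta>2[OF j] a0[of j]] by (simp add: w_def h2 algebra_simps)
    finally have "ennreal (LINT \<omega>|M. a j * (y j \<omega>)\<^sup>2) \<le> ennreal (w * a j)"
      by (rule ennreal_leI)
    moreover have "(\<integral>\<^sup>+\<omega>. ennreal (a j * (y j \<omega>)\<^sup>2) \<partial>M) = ennreal (LINT \<omega>|M. a j * (y j \<omega>)\<^sup>2)"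
      using int a0 by (intro nn_integral_eq_integral) auto
    ultimately show "(\<integral>\<^sup>+\<omega>. ennreal (a (N + Suc i) * (y (N + Suc i) \<omega>)\<^sup>2) \<partial>M) \<le> ennreal (w * a (N + Suc i))"
      by (simp add: j_def)
  qed auto
  also have "\<dots> = ennreal (infsum (\<lambda>j. w * a j) {N<..})"
  proof -
    have nn: "\<And>j. 0 \<le> w * a j" using w0 a0 by simp
    have "(\<lambda>j. w * a j) summable_on {N<..}" by (rule summable_on_cmult_right[OF sN])
    then have "(\<Sum>j. ennreal (w * a (N + Suc j))) < \<infinity>"
      using infsum_nonneg_eq_enn2real(2)[of "\<lambda>j. w * a j" N] nn by (simp add: less_top)
    then show ?thesis
      unfolding infsum_nonneg_eq_enn2real(1)[of "\<lambda>j. w * a j" N, OF nn] by simp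
  qed
  also have "infsum (\<lambda>j. w * a j) {N<..} = w * infsum a {N<..}"
    by (rule infsum_cmult_right) (rule sN)
  also have "ennreal \<dots> \<le> ennreal (w * (1 / (real n)\<^sup>2))"
    using \<delta> w0 by (intro ennreal_leI mult_left_mono)
  finally have EQ: "(\<integral>\<^sup>+\<omega>. Q \<omega> \<partial>M) \<le> ennreal (w / (real n)\<^sup>2)" by simp

  \<comment> \<open>Outside \<open>E1\<close> the series beyond \<open>N\<close> converges and is small; outside \<open>E2\<close> the mixed term is small.\<close>
  define E1 where "E1 = {\<omega> \<in> space M. 1 \<le> ennreal (3 * (real n)\<^sup>2 / \<eta>) * Q \<omega>}"
  have [measurable]: "E1 \<in> sets M" unfolding E1_def by measurable
  have "emeasure M E1 \<le> ennreal (3 * (real n)\<^sup>2 / \<eta>) * (\<integral>\<^sup>+\<omega>. Q \<omega> * indicator (space M) \<omega> \<partial>M)"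
    unfolding E1_def by (rule nn_integral_Markov_inequality) auto
  also have "(\<integral>\<^sup>+\<omega>. Q \<omega> * indicator (space M) \<omega> \<partial>M) = (\<integral>\<^sup>+\<omega>. Q \<omega> \<partial>M)"
    by (intro nn_integral_cong) simp
  also have "ennreal (3 * (real n)\<^sup>2 / \<eta>) * \<dots> \<le> ennreal (3 * (real n)\<^sup>2 / \<eta>) * ennreal (w / (real n)\<^sup>2)"
    by (intro mult_left_mono EQ) simp
  also have "\<dots> = ennreal (3 * w / \<eta>)"
    using n0 \<open>\<eta> > 0\<close> w0 by (simp add: ennreal_mult[symmetric])
  finally have PE1: "prob E1 \<le> 3 * w / \<eta>"
    using \<open>\<eta> > 0\<close> w0 by (simp add: emeasure_eq_measure)

  define c where "c j = 2 * (real n)\<^sup>2 * h * (a j * \<theta> j)" for j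
  define X where "X \<omega> = (\<Sum>j\<in>{1..N}. c j * \<xi> j \<omega>)" for \<omega>
  have X: "X \<in> borel_measurable M" "integrable M (\<lambda>\<omega>. (X \<omega>)\<^sup>2)" "expectation X = 0"
      "expectation (\<lambda>\<omega>. (X \<omega>)\<^sup>2) = (\<Sum>j\<in>{1..N}. (c j)\<^sup>2)"
    using gaussian_linear_combination[OF \<xi>, of "{1..N}" c] unfolding X_def[abs_def] by auto
  note [measurable] = X(1)
  define E2 where "E2 = {\<omega> \<in> space M. \<bar>X \<omega>\<bar> \<ge> \<eta> / 3}"
  have [measurable]: "E2 \<in> sets M" unfolding E2_def by measurable
  have "prob E2 \<le> (\<Sum>j\<in>{1..N}. (c j)\<^sup>2) / (\<eta> / 3)\<^sup>2"
    using Chebyshev_inequality[OF X(1,2), of "\<eta> / 3"] \<open>\<eta> > 0\<close> X(3,4) by (simp add: E2_def)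
  also have "(\<Sum>j\<in>{1..N}. (c j)\<^sup>2) \<le> (\<Sum>j\<in>{1..N}. (4 * (real n)^4 * h\<^sup>2 * (a 1)\<^sup>2) * (\<theta> j)\<^sup>2)"
  proof (intro sum_mono)
    fix j assume "j \<in> {1..N}"
    then have "(a j)\<^sup>2 \<le> (a 1)\<^sup>2" using a1[of j] a0[of j] by (intro power_mono) auto
    then have "(4 * (real n)^4 * h\<^sup>2 * (\<theta> j)\<^sup>2) * (a j)\<^sup>2 \<le> (4 * (real n)^4 * h\<^sup>2 * (\<theta> j)\<^sup>2) * (a 1)\<^sup>2"
      by (intro mult_left_mono) auto
    then show "(c j)\<^sup>2 \<le> (4 * (real n)^4 * h\<^sup>2 * (a 1)\<^sup>2) * (\<theta> j)\<^sup>2"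
      by (simp add: c_def power_mult_distrib power_mult[symmetric] mult_ac)
  qed
  also have "\<dots> = (4 * (real n)^4 * h\<^sup>2 * (a 1)\<^sup>2) * (\<Sum>j\<in>{1..N}. (\<theta> j)\<^sup>2)"
    by (simp add: sum_distrib_left)
  also have "(\<Sum>j\<in>{1..N}. (\<theta> j)\<^sup>2) \<le> (norm f)\<^sup>2"
  proof -
    have "(\<Sum>j\<in>{1..N}. (\<theta> j)\<^sup>2) \<le> infsum (\<lambda>j. (\<theta> j)\<^sup>2) {1..}"
      using has_sum_imp_summable[OF parseval[OF basis, of f]]
      by (intro finite_sum_le_infsum) (auto simp: \<theta>_def)
    also have "\<dots> = (norm f)\<^sup>2" unfolding \<theta>_def by (rule infsumI[OF parseval[OF basis]])
    finally show ?thesis .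
  qed
  finally have PE2: "prob E2 \<le> (4 * (real n)^4 * h\<^sup>2 * (a 1)\<^sup>2) * (norm f)\<^sup>2 / (\<eta> / 3)\<^sup>2"
    by (simp add: divide_right_mono mult_left_mono)
  also have "\<dots> = 36 * \<sigma>\<^sup>2 * (real n)^3 * (a 1)\<^sup>2 * (norm f)\<^sup>2 / \<eta>\<^sup>2"
  proof -
    have "(real n)^4 * h\<^sup>2 = \<sigma>\<^sup>2 * (real n)^3" unfolding h2 using n0 by (simp add: eval_nat_numeral)
    then show ?thesis by (simp add: power_divide mult_ac)
  qed
  finally have PE2: "prob E2 \<le> 36 * \<sigma>\<^sup>2 * (real n)^3 * (a 1)\<^sup>2 * (norm f)\<^sup>2 / \<eta>\<^sup>2" .

  let ?D = "{\<omega> \<in> space M. \<bar>(real n)\<^sup>2 * test_statistic \<sigma> \<phi> \<xi> \<kappa> n f \<omega> - (real n * \<sigma>\<^sup>2 * S \<omega> + B)\<bar> > \<eta>}"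
  \<comment> \<open>If \<open>w\<close> exceeds \<open>\<eta> / 3\<close> the claimed bound is larger than 1; otherwise the compensators are harmless.\<close>
  have "prob ?D \<le> 36 * \<sigma>\<^sup>2 * (real n)^3 * (a 1)\<^sup>2 * (norm f)\<^sup>2 / \<eta>\<^sup>2 + 3 * w / \<eta>"
  proof (cases "w \<le> \<eta> / 3")
    case False
    then have "1 \<le> 3 * w / \<eta>" using \<open>\<eta> > 0\<close> by (simp add: pos_le_divide_eq)
    moreover have "0 \<le> 36 * \<sigma>\<^sup>2 * (real n)^3 * (a 1)\<^sup>2 * (norm f)\<^sup>2 / \<eta>\<^sup>2" by simp
    ultimately show ?thesis using prob_le_1[of ?D] by linarith
  next
    case True
    define \<tau> where "\<tau> = infsum (\<lambda>j. a j * (\<theta> j)\<^sup>2) {N<..}"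
    have s\<tau>: "(\<lambda>j. a j * (\<theta> j)\<^sup>2) summable_on {N<..}"
    proof (rule summable_on_comparison_test)
      show "(\<lambda>j. a j * (norm f)\<^sup>2) summable_on {N<..}" by (rule summable_on_cmult_left[OF sN])
      show "a j * (\<theta> j)\<^sup>2 \<le> a j * (norm f)\<^sup>2" if "j \<in> {N<..}" for j
        using that by (intro mult_left_mono \<theta>2 a0) auto
    qed (use a0 in auto)
    have "\<tau> \<le> infsum (\<lambda>j. a j * (norm f)\<^sup>2) {N<..}"
      unfolding \<tau>_def
      by (intro infsum_mono s\<tau> summable_on_cmult_left sN mult_left_mono \<theta>2 a0) auto
    also have "\<dots> = infsum a {N<..} * (norm f)\<^sup>2" by (rule infsum_cmult_left) (rule sN)
    finally have \<tau>1: "\<tau> \<le> infsum a {N<..} * (norm f)\<^sup>2" .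
    have \<tau>0: "\<tau> \<ge> 0" unfolding \<tau>_def by (intro infsum_nonneg) (use a0 in auto)
    have B: "B = (real n)\<^sup>2 * ((\<Sum>j\<in>{1..N}. a j * (\<theta> j)\<^sup>2) + \<tau>)"
      unfolding B_def \<tau>_def using infsum_split_at(2)[OF s\<tau>] by (simp add: a_def \<theta>_def)
    have det: "(real n)\<^sup>2 * \<tau> + real n * \<sigma>\<^sup>2 * infsum a {N<..} \<le> w"
    proof -
      have "(real n)\<^sup>2 * \<tau> + real n * \<sigma>\<^sup>2 * infsum a {N<..} \<le>
          (real n)\<^sup>2 * (infsum a {N<..} * (norm f)\<^sup>2) + real n * \<sigma>\<^sup>2 * infsum a {N<..}"
        using \<tau>1 by (intro add_right_mono mult_left_mono) auto
      also have "\<dots> = ((real n)\<^sup>2 * infsum a {N<..}) * w"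
        using n0 by (simp add: w_def algebra_simps power2_eq_square)
      also have "\<dots> \<le> 1 * w"
        using \<delta> n0 w0 by (intro mult_right_mono) (auto simp: pos_le_divide_eq mult.commute)
      finally show ?thesis by simp
    qed
    have det0: "0 \<le> (real n)\<^sup>2 * \<tau> + real n * \<sigma>\<^sup>2 * infsum a {N<..}"
      using \<tau>0 a0 by (intro add_nonneg_nonneg mult_nonneg_nonneg infsum_nonneg) auto
    have "?D \<subseteq> E1 \<union> E2"
    proof
      fix \<omega> assume \<omega>: "\<omega> \<in> ?D"
      show "\<omega> \<in> E1 \<union> E2"
      proof (rule ccontr)
        assume no: "\<omega> \<notin> E1 \<union> E2"
        then have X_small: "\<bar>X \<omega>\<bar> < \<eta> / 3" using \<omega> by (simp add: E2_def not_le)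
        have c: "ennreal (3 * (real n)\<^sup>2 / \<eta>) * Q \<omega> < 1" using no \<omega> by (simp add: E1_def not_le)
        then have "Q \<omega> \<noteq> \<infinity>"
          using n0 \<open>\<eta> > 0\<close> by (auto simp: ennreal_mult_top)
        then obtain q where q: "Q \<omega> = ennreal q" "q \<ge> 0" by (cases "Q \<omega>") auto
        have "3 * (real n)\<^sup>2 / \<eta> * q < 1"
          using c q \<open>\<eta> > 0\<close> by (simp add: ennreal_mult[symmetric])
        then have q_small: "(real n)\<^sup>2 * q < \<eta> / 3" using \<open>\<eta> > 0\<close> by (simp add: field_simps)
        have sq: "(\<lambda>j. a j * (y j \<omega>)\<^sup>2) summable_on {N<..}" "infsum (\<lambda>j. a j * (y j \<omega>)\<^sup>2) {N<..} = q"
        proof -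
          have nn: "\<And>j. 0 \<le> a j * (y j \<omega>)\<^sup>2" using a0 by simp
          have Qq: "(\<Sum>j. ennreal (a (N + Suc j) * (y (N + Suc j) \<omega>)\<^sup>2)) = ennreal q"
            using q(1) by (simp only: Q_def)
          show "(\<lambda>j. a j * (y j \<omega>)\<^sup>2) summable_on {N<..}"
            by (rule infsum_nonneg_eq_enn2real(2)[of "\<lambda>j. a j * (y j \<omega>)\<^sup>2" N, OF nn, THEN iffD2])
              (simp only: Qq, simp)
          show "infsum (\<lambda>j. a j * (y j \<omega>)\<^sup>2) {N<..} = q"
            unfolding infsum_nonneg_eq_enn2real(1)[of "\<lambda>j. a j * (y j \<omega>)\<^sup>2" N, OF nn] Qq
            using q(2) by (rule enn2real_ennreal)
        qed
        have "test_statistic \<sigma> \<phi> \<xi> \<kappa> n f \<omega> =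
            infsum (\<lambda>j. a j * (y j \<omega>)\<^sup>2) {1..} - h\<^sup>2 * infsum a {1..}"
          by (simp add: test_statistic_def coeff_sum_def a_def[abs_def] y_def h2)
        also have "\<dots> = (\<Sum>j\<in>{1..N}. a j * (y j \<omega>)\<^sup>2) + q - h\<^sup>2 * ((\<Sum>j\<in>{1..N}. a j) + infsum a {N<..})"
          using infsum_split_at(2)[OF sq(1)] infsum_split_at(2)[OF sN] sq(2) by simp
        finally have T: "test_statistic \<sigma> \<phi> \<xi> \<kappa> n f \<omega> = \<dots>" .
        have yy: "(\<Sum>j\<in>{1..N}. a j * (y j \<omega>)\<^sup>2) = (\<Sum>j\<in>{1..N}. a j * (\<theta> j)\<^sup>2)
            + 2 * h * (\<Sum>j\<in>{1..N}. a j * \<theta> j * \<xi> j \<omega>) + h\<^sup>2 * (S \<omega> + (\<Sum>j\<in>{1..N}. a j))"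
        proof -
          have "a j * (y j \<omega>)\<^sup>2 = a j * (\<theta> j)\<^sup>2 + 2 * h * (a j * \<theta> j * \<xi> j \<omega>)
              + h\<^sup>2 * (a j * ((\<xi> j \<omega>)\<^sup>2 - 1) + a j)" for j
            unfolding y by (simp add: power2_sum power_mult_distrib algebra_simps)
          then show ?thesis
            by (simp only: S_def a_def[symmetric] sum.distrib sum_distrib_left[symmetric])
        qed
        have XX: "X \<omega> = (real n)\<^sup>2 * (2 * h * (\<Sum>j\<in>{1..N}. a j * \<theta> j * \<xi> j \<omega>))"
          by (simp add: X_def c_def sum_distrib_left mult_ac)
        have nh: "(real n)\<^sup>2 * h\<^sup>2 = real n * \<sigma>\<^sup>2"
          unfolding h2 using n0 by (simp add: power2_eq_square)
        have "(real n)\<^sup>2 * test_statistic \<sigma> \<phi> \<xi> \<kappa> n f \<omega> - (real n * \<sigma>\<^sup>2 * S \<omega> + B) =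
           X \<omega> + (real n)\<^sup>2 * q - ((real n)\<^sup>2 * \<tau> + real n * \<sigma>\<^sup>2 * infsum a {N<..})"
          unfolding T yy B XX nh[symmetric] by (simp add: algebra_simps)
        moreover have "0 \<le> (real n)\<^sup>2 * q" using q(2) by simp
        ultimately have "\<bar>(real n)\<^sup>2 * test_statistic \<sigma> \<phi> \<xi> \<kappa> n f \<omega> - (real n * \<sigma>\<^sup>2 * S \<omega> + B)\<bar> \<le> \<eta>"
          using X_small q_small det det0 True by linarith
        with \<omega> show False by simp
      qed
    qed
    then have "prob ?D \<le> prob (E1 \<union> E2)" by (intro finite_measure_mono) auto
    also have "\<dots> \<le> prob E1 + prob E2" by (intro measure_Un_le) auto
    finally show ?thesis using PE1 PE2 by linarith
  qed
  then show ?thesis by (simp add: a_def w_def)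
qed

section \<open>Asymptotic error probabilities\<close>

text \<open>The mean of \<open>n\<^sup>2 T\<close> at the signal \<open>f\<close>. The quadratic noise in \<open>n\<^sup>2 T\<close> has bounded variance, so this
  quantity decides about detectability.\<close>
definition signal_energy :: "(nat \<Rightarrow> nat \<Rightarrow> real) \<Rightarrow> (nat \<Rightarrow> L2) \<Rightarrow> nat \<Rightarrow> L2 \<Rightarrow> real" where
  "signal_energy \<kappa> \<phi> n f = (real n)\<^sup>2 * (\<Sum>\<^sub>\<infinity>j\<in>{1..}. (\<kappa> n j)\<^sup>2 * (f \<bullet> \<phi> j)\<^sup>2)"

text \<open>At sample size \<open>m i\<close> and signal \<open>f i\<close> the statistic \<open>n\<^sup>2 T\<close> is asymptotically normal with
  mean \<open>B i\<close> and standard deviation \<open>V (m i)\<close>, uniformly over all thresholds.\<close>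
definition gaussian_limit ::
  "'w measure \<Rightarrow> (nat \<Rightarrow> L2 \<Rightarrow> 'w \<Rightarrow> real) \<Rightarrow> (nat \<Rightarrow> real) \<Rightarrow> (nat \<Rightarrow> nat) \<Rightarrow> (nat \<Rightarrow> L2) \<Rightarrow> (nat \<Rightarrow> real) \<Rightarrow> bool" where
  "gaussian_limit M T V m f B \<longleftrightarrow> (\<forall>\<epsilon>>0. \<forall>\<^sub>F i in sequentially. \<forall>x.
     \<bar>type_II_error M T (m i) x (f i) - \<Phi> (((real (m i))\<^sup>2 * x - B i) / V (m i))\<bar> \<le> \<epsilon>)"

lemma type_errors_sum_to_1:
  assumes "prob_space M" "T n 0 \<in> borel_measurable M"
  shows "type_I_error M T n x = 1 - type_II_error M T n x 0"
proof -
  interpret prob_space M by fact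
  have "prob {\<omega> \<in> space M. \<not> T n 0 \<omega> > x} = 1 - prob {\<omega> \<in> space M. T n 0 \<omega> > x}"
    using assms(2) by (intro prob_neg) measurable
  then show ?thesis by (simp add: type_I_error_def type_II_error_def)
qed

text \<open>The level of the test bounds its normalised threshold by the normal quantile \<open>q\<close> of order
  \<open>1 - \<alpha>\<close>, up to an error that may be taken as \<open>d\<close>. Energy at least \<open>b\<close> moves the normalised
  statistic by at least \<open>b / v = 2 d\<close>, so the type II error is asymptotically at most
  \<open>\<Phi> (q - d)\<close>, which lies strictly below \<open>1 - \<alpha>\<close>.\<close>
lemma consistent_of_signal_energy_bounded_below:
  assumes M: "prob_space M" "\<And>n. T n 0 \<in> borel_measurable M"
    and V: "\<And>i. 0 < V (m i)" "\<And>i. V (m i) \<le> v"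
    and null: "gaussian_limit M T V m (\<lambda>_. 0) (\<lambda>_. 0)"
    and alt: "gaussian_limit M T V m f B"
    and "b > 0" "\<forall>\<^sub>F i in sequentially. B i \<ge> b"
  shows "consistent M T m f"
  unfolding consistent_def
proof (intro ballI allI impI)
  fix \<alpha> :: real and x
  assume \<alpha>: "\<alpha> \<in> {0<..<1}" and "(\<lambda>i. type_I_error M T (m i) (x i)) \<sim>[sequentially] (\<lambda>_. \<alpha>)"
  then have level: "(\<lambda>i. type_I_error M T (m i) (x i)) \<longlonglongrightarrow> \<alpha>"
    by (intro asymp_equivD_const)
  obtain q where q: "\<Phi> q = 1 - \<alpha>"
    using continuous_cdf_attains[OF real_dist_normal_dist isCont_normal_cdf, of "1 - \<alpha>"] \<alpha> by auto
  have "v > 0" using V[of 0] by linarith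
  define d where "d = b / (2 * v)"
  have "d > 0" using \<open>b > 0\<close> \<open>v > 0\<close> by (simp add: d_def)
  define \<epsilon> where "\<epsilon> = (\<Phi> (q + d) - (1 - \<alpha>)) / 2"
  define \<epsilon>' where "\<epsilon>' = (1 - \<alpha> - \<Phi> (q - d)) / 2"
  have "\<epsilon> > 0" "\<epsilon>' > 0"
    using normal_cdf_strict_mono[of q "q + d"] normal_cdf_strict_mono[of "q - d" q] q \<open>d > 0\<close>
    by (auto simp: \<epsilon>_def \<epsilon>'_def)
  have "\<forall>\<^sub>F i in sequentially. type_I_error M T (m i) (x i) > \<alpha> - \<epsilon>"
    using level \<open>\<epsilon> > 0\<close> by (intro order_tendstoD) auto
  moreover have "\<forall>\<^sub>F i in sequentially. \<forall>x. \<bar>type_II_error M T (m i) x 0 - \<Phi> (((real (m i))\<^sup>2 * x - 0) / V (m i))\<bar> \<le> \<epsilon>"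
    using null \<open>\<epsilon> > 0\<close> unfolding gaussian_limit_def by blast
  moreover have "\<forall>\<^sub>F i in sequentially. \<forall>x. \<bar>type_II_error M T (m i) x (f i) - \<Phi> (((real (m i))\<^sup>2 * x - B i) / V (m i))\<bar> \<le> \<epsilon>'"
    using alt \<open>\<epsilon>' > 0\<close> unfolding gaussian_limit_def by blast
  ultimately have "\<forall>\<^sub>F i in sequentially. ereal (type_II_error M T (m i) (x i) (f i)) \<le> ereal (\<Phi> (q - d) + \<epsilon>')"
    using assms(8)
  proof eventually_elim
    case (elim i)
    define z where "z = (real (m i))\<^sup>2 * x i"
    have null_i: "\<bar>type_II_error M T (m i) (x i) 0 - \<Phi> (z / V (m i))\<bar> \<le> \<epsilon>"
      using elim(2)[rule_format, of "x i"] by (simp add: z_def)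
    have "\<Phi> (z / V (m i)) < \<Phi> (q + d)"
    proof -
      have "2 * \<epsilon> = \<Phi> (q + d) - (1 - \<alpha>)" by (simp add: \<epsilon>_def)
      moreover have "type_I_error M T (m i) (x i) = 1 - type_II_error M T (m i) (x i) 0"
        by (rule type_errors_sum_to_1[of M T, OF M])
      ultimately show ?thesis using elim(1) null_i by linarith
    qed
    then have "z / V (m i) < q + d"
      using normal_cdf_strict_mono[of "q + d" "z / V (m i)"] by (cases "z / V (m i)" "q + d" rule: linorder_cases) auto
    moreover have "2 * d \<le> B i / V (m i)"
    proof -
      have "2 * d = b / v" by (simp add: d_def)
      also have "\<dots> \<le> B i / V (m i)" using V[of i] \<open>b > 0\<close> elim(4) by (intro frac_le) auto
      finally show ?thesis .
    qed
    ultimately have "(z - B i) / V (m i) \<le> q - d" by (simp add: diff_divide_distrib)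
    then have "\<Phi> ((z - B i) / V (m i)) \<le> \<Phi> (q - d)"
      by (intro finite_borel_measure.cdf_nondecreasing real_distribution.finite_borel_measure_M real_dist_normal_dist)
    with elim(3)[rule_format, of "x i"] show ?case by (simp add: z_def)
  qed
  then have "limsup (\<lambda>i. ereal (type_II_error M T (m i) (x i) (f i))) \<le> ereal (\<Phi> (q - d) + \<epsilon>')"
    by (rule Limsup_bounded)
  also have "\<dots> < ereal (1 - \<alpha>)"
    using \<open>\<epsilon>' > 0\<close> by (simp add: \<epsilon>'_def field_simps)
  finally show "limsup (\<lambda>i. ereal (type_II_error M T (m i) (x i) (f i))) < ereal (1 - \<alpha>)" .
qed

text \<open>In the limit the two error probabilities add up to \<open>1\<close> minus an increment of \<open>\<Phi>\<close> over an interval of length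
  \<open>B i / V (m i)\<close>, which tends to \<open>0\<close> whatever the thresholds are.\<close>
lemma inconsistent_of_signal_energy_vanishing:
  assumes M: "prob_space M" "\<And>n. T n 0 \<in> borel_measurable M"
    and V: "0 < v" "\<And>i. v \<le> V (m i)"
    and null: "gaussian_limit M T V m (\<lambda>_. 0) (\<lambda>_. 0)"
    and alt: "gaussian_limit M T V m f B"
    and "B \<longlonglongrightarrow> 0"
  shows "inconsistent M T m f"
  unfolding inconsistent_def
proof (intro allI)
  fix x
  show "1 \<le> liminf (\<lambda>i. ereal (type_I_error M T (m i) (x i) + type_II_error M T (m i) (x i) (f i)))"
    unfolding le_Liminf_iff
  proof (intro allI impI)
    fix y :: ereal assume "y < 1"
    then obtain y' where y': "y \<le> ereal y'" "y' < 1"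
      by (cases y) (auto intro: that[of 0])
    define \<epsilon> where "\<epsilon> = (1 - y') / 4"
    have "\<epsilon> > 0" using y' by (simp add: \<epsilon>_def)
    have "(\<lambda>i. \<bar>B i\<bar>) \<longlonglongrightarrow> 0" using assms(7) by (rule tendsto_rabs_zero)
    then have "\<forall>\<^sub>F i in sequentially. \<bar>B i\<bar> < \<epsilon> * v"
      by (rule order_tendstoD) (use \<open>\<epsilon> > 0\<close> V(1) in simp)
    moreover have "\<forall>\<^sub>F i in sequentially. \<forall>x. \<bar>type_II_error M T (m i) x 0 - \<Phi> (((real (m i))\<^sup>2 * x - 0) / V (m i))\<bar> \<le> \<epsilon>"
      using null \<open>\<epsilon> > 0\<close> unfolding gaussian_limit_def by blast
    moreover have "\<forall>\<^sub>F i in sequentially. \<forall>x. \<bar>type_II_error M T (m i) x (f i) - \<Phi> (((real (m i))\<^sup>2 * x - B i) / V (m i))\<bar> \<le> \<epsilon>"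
      using alt \<open>\<epsilon> > 0\<close> unfolding gaussian_limit_def by blast
    ultimately show "\<forall>\<^sub>F i in sequentially. y < ereal (type_I_error M T (m i) (x i) + type_II_error M T (m i) (x i) (f i))"
    proof eventually_elim
      case (elim i)
      define z where "z = (real (m i))\<^sup>2 * x i"
      have Vi: "V (m i) > 0" using V(1) V(2)[of i] by linarith
      have "\<bar>(z - 0) / V (m i) - (z - B i) / V (m i)\<bar> = \<bar>B i\<bar> / V (m i)"
        using Vi by (simp add: diff_divide_distrib)
      also have "\<dots> \<le> (\<epsilon> * v) / v" using V(1) V(2)[of i] elim(1) by (intro frac_le) auto
      also have "\<dots> = \<epsilon>" using V(1) by simp
      finally have "\<bar>\<Phi> ((z - 0) / V (m i)) - \<Phi> ((z - B i) / V (m i))\<bar> \<le> \<epsilon>"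
        using normal_cdf_lipschitz order_trans by blast
      moreover have "\<bar>type_II_error M T (m i) (x i) 0 - \<Phi> ((z - 0) / V (m i))\<bar> \<le> \<epsilon>"
        "\<bar>type_II_error M T (m i) (x i) (f i) - \<Phi> ((z - B i) / V (m i))\<bar> \<le> \<epsilon>"
        using elim(2)[rule_format, of "x i"] elim(3)[rule_format, of "x i"] by (simp_all add: z_def)
      ultimately have "1 - 3 * \<epsilon> \<le> type_I_error M T (m i) (x i) + type_II_error M T (m i) (x i) (f i)"
        unfolding type_errors_sum_to_1[of M T, OF M] by linarith
      moreover have "y' < 1 - 3 * \<epsilon>" using \<open>\<epsilon> > 0\<close> by (simp add: \<epsilon>_def field_simps)
      ultimately have "y' < type_I_error M T (m i) (x i) + type_II_error M T (m i) (x i) (f i)"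
        by linarith
      with y'(1) show ?case by (meson ereal_less_eq(3) le_less_trans less_ereal.simps(1))
    qed
  qed
qed

lemma has_sum_imp_partial_sums_tendsto:
  fixes g :: "nat \<Rightarrow> real"
  assumes "(g has_sum S) {1..}"
  shows "(\<lambda>N. \<Sum>j\<in>{1..N}. g j) \<longlonglongrightarrow> S"
  using assms unfolding has_sum_def
proof (rule filterlim_compose)
  show "filterlim (\<lambda>N. {1..N::nat}) (finite_subsets_at_top {1..}) sequentially"
    unfolding filterlim_finite_subsets_at_top
  proof (intro allI impI)
    fix X :: "nat set" assume X: "finite X \<and> X \<subseteq> {1..}"
    show "\<forall>\<^sub>F N in sequentially. finite {1..N} \<and> X \<subseteq> {1..N} \<and> {1..N} \<subseteq> {1..}"
      using eventually_ge_at_top[of "Max (insert 0 X)"]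
    proof eventually_elim
      case (elim N)
      have "x \<le> N" if "x \<in> X" for x
        using Max_ge[of "insert 0 X" x] X that elim by (meson finite_insert insertI2 order_trans)
      with X show ?case by auto
    qed
  qed
qed

lemma truncation_index:
  fixes a :: "nat \<Rightarrow> real"
  assumes a: "a summable_on {1..}" "\<And>j. a j \<ge> 0" and "\<epsilon> > 0"
    and Q: "infsum (\<lambda>j. (a j)\<^sup>2) {1..} > 0"
  obtains N where "infsum a {N<..} \<le> \<epsilon>" "infsum (\<lambda>j. (a j)\<^sup>2) {1..} / 2 \<le> (\<Sum>j\<in>{1..N}. (a j)\<^sup>2)"
proof -
  let ?Q = "infsum (\<lambda>j. (a j)\<^sup>2) {1..}"
  have "(\<lambda>j. (a j)\<^sup>2) summable_on {1..}" using Q by (intro infsum_nonzero_imp_summable) simp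
  then have "\<forall>\<^sub>F N in sequentially. ?Q / 2 < (\<Sum>j\<in>{1..N}. (a j)\<^sup>2)"
    using Q by (intro order_tendstoD(1)[OF has_sum_imp_partial_sums_tendsto[OF has_sum_infsum]]) auto
  moreover have "\<forall>\<^sub>F N in sequentially. infsum a {1..} - \<epsilon> < (\<Sum>j\<in>{1..N}. a j)"
    using assms by (intro order_tendstoD(1)[OF has_sum_imp_partial_sums_tendsto[OF has_sum_infsum]]) auto
  ultimately have "\<forall>\<^sub>F N in sequentially. infsum a {N<..} \<le> \<epsilon> \<and> ?Q / 2 \<le> (\<Sum>j\<in>{1..N}. (a j)\<^sup>2)"
  proof eventually_elim
    case (elim N)
    have "a summable_on {N<..}" using a(1) by (rule summable_on_subset_banach) auto
    from infsum_split_at(2)[OF this] elim show ?case by simp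
  qed
  then show ?thesis using that eventually_happens'[OF sequentially_bot] by blast
qed

text \<open>The row is truncated at an index \<open>N n\<close> beyond which the \<open>\<kappa>\<^sup>2\<close> sum to at most \<open>1 / n\<^sup>2\<close>
  and the \<open>\<kappa>\<^sup>4\<close> to at most half of their total. By A2 the standard deviation \<open>V n\<close> of the
  truncated quadratic noise then stays between positive constants. Its normalised weights are at
  most of order \<open>n\<close> times the first coefficient, that is \<open>n powr (2r - 1)\<close>, and tend to \<open>0\<close>
  because \<open>r < 1/2\<close>; this is the hypothesis of the central limit theorem. For signals of order
  \<open>n powr (-r)\<close> the mixed term has second moment of the same order \<open>n powr (2r - 1)\<close>.\<close>
lemma normal_approximation:
  fixes r \<sigma> :: real
  assumes r: "0 < r" "r < 1 / 2" and \<sigma>: "0 < \<sigma>"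
    and basis: "orthonormal_basis \<phi>"
    and \<xi>: "standard_gaussian_sequence M \<xi>"
    and A: "assumption_A1 \<kappa>" "assumption_A2 \<sigma> \<kappa>" "assumption_A3 r \<kappa>" "assumption_A5 \<kappa>"
  obtains V v\<^sub>1 v\<^sub>2 where "0 < v\<^sub>1" "\<And>n. n \<ge> 1 \<Longrightarrow> v\<^sub>1 \<le> V n" "\<And>n. n \<ge> 1 \<Longrightarrow> V n \<le> v\<^sub>2"
    "\<And>m f c. filterlim m at_top sequentially \<Longrightarrow> (\<And>i. m i \<ge> 1) \<Longrightarrow>
       (\<And>i. norm (f i) \<le> c * real (m i) powr (- r)) \<Longrightarrow>
       gaussian_limit M (test_statistic \<sigma> \<phi> \<xi> \<kappa>) V m f (\<lambda>i. signal_energy \<kappa> \<phi> (m i) (f i))"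
proof -
  interpret prob_space M using \<xi> by (simp add: standard_gaussian_sequence_def)
  define a where "a n j = (\<kappa> n j)\<^sup>2" for n j
  have a0: "a n j \<ge> 0" for n j by (simp add: a_def)
  have a1: "a n j \<le> a n 1" if "n \<ge> 1" "j \<ge> 1" for n j
    using A(1) that unfolding assumption_A1_def a_def by (auto simp: monotone_on_def)
  obtain C where C: "C > 0" "\<forall>\<^sub>F n in sequentially. a n 1 \<le> C * real n powr (2 * r - 2)"
  proof (rule coefficient_scales[OF \<sigma> A])
    fix c C assume "C > 0" and ev: "\<forall>\<^sub>F n in sequentially. c * real n powr (2 * r - 2) \<le> (\<kappa> n (cutoff \<kappa> n))\<^sup>2 \<and>
       (\<kappa> n 1)\<^sup>2 \<le> C * real n powr (2 * r - 2) \<and>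
       c * real n powr (2 - 4 * r) \<le> real (cutoff \<kappa> n) \<and>
       real (cutoff \<kappa> n) \<le> C * real n powr (2 - 4 * r)"
    from ev have "\<forall>\<^sub>F n in sequentially. a n 1 \<le> C * real n powr (2 * r - 2)"
      by (rule eventually_mono) (simp add: a_def)
    with \<open>C > 0\<close> show thesis by (rule that)
  qed
  obtain C\<^sub>1 C\<^sub>2 where C12: "C\<^sub>1 > 0" "C\<^sub>2 > 0" and Q: "\<And>n. n \<ge> 1 \<Longrightarrow>
      C\<^sub>1 < (real n)\<^sup>2 / \<sigma> ^ 4 * infsum (\<lambda>j. (a n j)\<^sup>2) {1..} \<and>
      (real n)\<^sup>2 / \<sigma> ^ 4 * infsum (\<lambda>j. (a n j)\<^sup>2) {1..} < C\<^sub>2"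
  proof -
    have sq: "(\<kappa> n j) ^ 4 = (a n j)\<^sup>2" for n j by (simp add: a_def)
    show ?thesis
      using A(2) that unfolding assumption_A2_def Let_def sq by blast
  qed
  have Qpos: "infsum (\<lambda>j. (a n j)\<^sup>2) {1..} > 0" if "n \<ge> 1" for n
  proof (rule ccontr)
    assume "\<not> ?thesis"
    then have "(real n)\<^sup>2 / \<sigma> ^ 4 * infsum (\<lambda>j. (a n j)\<^sup>2) {1..} \<le> 0"
      using \<sigma> by (intro mult_nonneg_nonpos) auto
    with Q[OF that] C12 show False by linarith
  qed
  obtain c\<^sub>1 where c1: "c\<^sub>1 > 0" "\<And>n. n \<ge> 1 \<Longrightarrow> c\<^sub>1 * real n powr (- 2 * r) \<le> infsum (a n) {1..}"
    using A(3) unfolding assumption_A3_def coeff_sum_def a_def by blast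
  have sa: "a n summable_on {1..}" if "n \<ge> 1" for n
  proof (rule infsum_nonzero_imp_summable)
    have "0 < c\<^sub>1 * real n powr (- 2 * r)" using c1(1) that by simp
    with c1(2)[OF that] show "infsum (a n) {1..} \<noteq> 0" by linarith
  qed
  have "\<exists>N. infsum (a n) {N<..} \<le> 1 / (real n)\<^sup>2 \<and>
      infsum (\<lambda>j. (a n j)\<^sup>2) {1..} / 2 \<le> (\<Sum>j\<in>{1..N}. (a n j)\<^sup>2)" if "n \<ge> 1" for n
    using truncation_index[OF sa[OF that] a0 _ Qpos[OF that], of "1 / (real n)\<^sup>2"] that by auto
  then obtain N where N: "\<And>n. n \<ge> 1 \<Longrightarrow> infsum (a n) {N n<..} \<le> 1 / (real n)\<^sup>2"
      "\<And>n. n \<ge> 1 \<Longrightarrow> infsum (\<lambda>j. (a n j)\<^sup>2) {1..} / 2 \<le> (\<Sum>j\<in>{1..N n}. (a n j)\<^sup>2)"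
    by metis
  define V where "V n = sqrt (2 * (real n * \<sigma>\<^sup>2)\<^sup>2 * (\<Sum>j\<in>{1..N n}. (a n j)\<^sup>2))" for n
  define v\<^sub>1 where "v\<^sub>1 = sqrt (C\<^sub>1 * \<sigma> ^ 8)"
  define v\<^sub>2 where "v\<^sub>2 = sqrt (2 * C\<^sub>2 * \<sigma> ^ 8)"
  have v1: "v\<^sub>1 > 0" using C12 \<sigma> by (simp add: v\<^sub>1_def)
  have \<sigma>8: "(real n * \<sigma>\<^sup>2)\<^sup>2 * q = ((real n)\<^sup>2 / \<sigma> ^ 4 * q) * \<sigma> ^ 8" for n q
    using \<sigma> by (simp add: power_mult_distrib power_mult[symmetric] divide_simps power_add[symmetric])
  have V1: "v\<^sub>1 \<le> V n" if "n \<ge> 1" for n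
    unfolding v\<^sub>1_def V_def
  proof (rule real_sqrt_le_mono)
    have "C\<^sub>1 * \<sigma> ^ 8 \<le> ((real n)\<^sup>2 / \<sigma> ^ 4 * infsum (\<lambda>j. (a n j)\<^sup>2) {1..}) * \<sigma> ^ 8"
      using Q[OF that] \<sigma> by (intro mult_right_mono) auto
    also have "\<dots> = (real n * \<sigma>\<^sup>2)\<^sup>2 * infsum (\<lambda>j. (a n j)\<^sup>2) {1..}" by (rule \<sigma>8[symmetric])
    also have "\<dots> \<le> (real n * \<sigma>\<^sup>2)\<^sup>2 * (2 * (\<Sum>j\<in>{1..N n}. (a n j)\<^sup>2))"
      using N(2)[OF that] by (intro mult_left_mono) auto
    finally show "C\<^sub>1 * \<sigma> ^ 8 \<le> 2 * (real n * \<sigma>\<^sup>2)\<^sup>2 * (\<Sum>j\<in>{1..N n}. (a n j)\<^sup>2)" by simp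
  qed
  have V2: "V n \<le> v\<^sub>2" if "n \<ge> 1" for n
    unfolding v\<^sub>2_def V_def
  proof (rule real_sqrt_le_mono)
    have "(\<Sum>j\<in>{1..N n}. (a n j)\<^sup>2) \<le> infsum (\<lambda>j. (a n j)\<^sup>2) {1..}"
      using Qpos[OF that] by (intro finite_sum_le_infsum infsum_nonzero_imp_summable) auto
    then have "(real n * \<sigma>\<^sup>2)\<^sup>2 * (\<Sum>j\<in>{1..N n}. (a n j)\<^sup>2) \<le> (real n * \<sigma>\<^sup>2)\<^sup>2 * infsum (\<lambda>j. (a n j)\<^sup>2) {1..}"
      by (intro mult_left_mono) auto
    also have "\<dots> \<le> C\<^sub>2 * \<sigma> ^ 8"
      unfolding \<sigma>8 using Q[OF that] \<sigma> by (intro mult_right_mono) auto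
    finally show "2 * (real n * \<sigma>\<^sup>2)\<^sup>2 * (\<Sum>j\<in>{1..N n}. (a n j)\<^sup>2) \<le> 2 * C\<^sub>2 * \<sigma> ^ 8" by simp
  qed
  define S where "S n \<omega> = (\<Sum>j\<in>{1..N n}. a n j * ((\<xi> j \<omega>)\<^sup>2 - 1))" for n \<omega>
  define G where "G n \<omega> = (\<Sum>j\<in>{1..N n}. (real n * \<sigma>\<^sup>2 * a n j / V n) * ((\<xi> j \<omega>)\<^sup>2 - 1))" for n \<omega>
  have VG: "V n * G n \<omega> = real n * \<sigma>\<^sup>2 * S n \<omega>" if "n \<ge> 1" for n \<omega>
    using V1[OF that] v1 by (simp add: G_def S_def sum_distrib_left mult_ac)
  have G_meas: "G n \<in> borel_measurable M" for n
    unfolding G_def[abs_def] using gaussian_sequence_distr(1)[OF \<xi>]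
    by (intro borel_measurable_sum borel_measurable_times borel_measurable_diff borel_measurable_power) auto

  define e where "e n = real n * \<sigma>\<^sup>2 * a n 1 / v\<^sub>1" for n
  have e: "e \<longlonglongrightarrow> 0"
  proof (rule tendsto_sandwich[of "\<lambda>_. 0" _ _ "\<lambda>n. \<sigma>\<^sup>2 * C / v\<^sub>1 * real n powr (2 * r - 1)"])
    show "\<forall>\<^sub>F n in sequentially. 0 \<le> e n"
      using v1 a0 by (intro always_eventually allI) (simp add: e_def)
    show "\<forall>\<^sub>F n in sequentially. e n \<le> \<sigma>\<^sup>2 * C / v\<^sub>1 * real n powr (2 * r - 1)"
      using C(2) eventually_gt_at_top[of 0]
    proof eventually_elim
      case (elim n)
      have "real n powr (2 * r - 1) = real n powr (1 + (2 * r - 2))" by simp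
      also have "\<dots> = real n * real n powr (2 * r - 2)"
        using elim(2) by (subst powr_add) simp
      finally have p: "real n powr (2 * r - 1) = real n * real n powr (2 * r - 2)" .
      have "real n * \<sigma>\<^sup>2 / v\<^sub>1 * a n 1 \<le> real n * \<sigma>\<^sup>2 / v\<^sub>1 * (C * real n powr (2 * r - 2))"
        using elim(1) v1 by (intro mult_left_mono) auto
      then show ?case unfolding p e_def by (simp add: mult_ac)
    qed
    have "(\<lambda>n. \<sigma>\<^sup>2 * C / v\<^sub>1 * real n powr (2 * r - 1)) \<longlonglongrightarrow> \<sigma>\<^sup>2 * C / v\<^sub>1 * 0"
      using r by (intro tendsto_intros tendsto_neg_powr filterlim_real_sequentially) auto
    then show "(\<lambda>n. \<sigma>\<^sup>2 * C / v\<^sub>1 * real n powr (2 * r - 1)) \<longlonglongrightarrow> 0" by simp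
  qed simp

  have clt: "weak_conv_m (\<lambda>i. distr M borel (G (Suc i))) std_normal_distribution"
    unfolding G_def[abs_def]
  proof (rule weighted_central_limit_theorem[where J = "{1..}" and v = 2 and e = "\<lambda>i. e (Suc i)"
        and X = "\<lambda>j \<omega>. (\<xi> j \<omega>)\<^sup>2 - 1" and \<mu> = "distr std_normal_distribution borel (\<lambda>x. x\<^sup>2 - 1)"
        and I = "\<lambda>i. {1..N (Suc i)}" and b = "\<lambda>i j. real (Suc i) * \<sigma>\<^sup>2 * a (Suc i) j / V (Suc i)"])
    show "indep_vars (\<lambda>_. borel) (\<lambda>j \<omega>. (\<xi> j \<omega>)\<^sup>2 - 1) {1..}"
      using \<xi> unfolding standard_gaussian_sequence_def
      by (intro prob_space.indep_vars_compose2[where X = \<xi> and M' = "\<lambda>_. borel" and Y = "\<lambda>_ x. x\<^sup>2 - 1"]) auto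
    show "distr M borel (\<lambda>\<omega>. (\<xi> j \<omega>)\<^sup>2 - 1) = distr std_normal_distribution borel (\<lambda>x. x\<^sup>2 - 1)" if "j \<in> {1..}" for j
      using square_minus_one_distr(1)[OF \<xi>] that by simp
    show "2 * (\<Sum>j\<in>{1..N (Suc i)}. (real (Suc i) * \<sigma>\<^sup>2 * a (Suc i) j / V (Suc i))\<^sup>2) = 1" for i
    proof -
      let ?n = "Suc i"
      have V_sq: "(V ?n)\<^sup>2 = 2 * (real ?n * \<sigma>\<^sup>2)\<^sup>2 * (\<Sum>j\<in>{1..N ?n}. (a ?n j)\<^sup>2)"
        unfolding V_def by (intro real_sqrt_pow2 mult_nonneg_nonneg sum_nonneg) auto
      have "V ?n > 0" using V1[of ?n] v1 by linarith
      have "2 * (\<Sum>j\<in>{1..N ?n}. (real ?n * \<sigma>\<^sup>2 * a ?n j / V ?n)\<^sup>2)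
          = 2 * (real ?n * \<sigma>\<^sup>2)\<^sup>2 * (\<Sum>j\<in>{1..N ?n}. (a ?n j)\<^sup>2) / (V ?n)\<^sup>2"
        by (simp only: power_divide power_mult_distrib sum_divide_distrib sum_distrib_left times_divide_eq_right mult.assoc)
      also have "\<dots> = 1" unfolding V_sq[symmetric] using \<open>V ?n > 0\<close> by simp
      finally show ?thesis .
    qed
    show "\<bar>real (Suc i) * \<sigma>\<^sup>2 * a (Suc i) j / V (Suc i)\<bar> \<le> e (Suc i)" if "j \<in> {1..N (Suc i)}" for i j
    proof -
      have "V (Suc i) > 0" using V1[of "Suc i"] v1 by linarith
      then have "\<bar>real (Suc i) * \<sigma>\<^sup>2 * a (Suc i) j / V (Suc i)\<bar> = real (Suc i) * \<sigma>\<^sup>2 * a (Suc i) j / V (Suc i)"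
        using a0 by (intro abs_of_nonneg divide_nonneg_pos mult_nonneg_nonneg) auto
      also have "\<dots> \<le> e (Suc i)"
        unfolding e_def using a0 a1[of "Suc i" j] that V1[of "Suc i"] v1
        by (intro frac_le mult_left_mono mult_nonneg_nonneg) auto
      finally show ?thesis .
    qed
    show "(\<lambda>i. e (Suc i)) \<longlonglongrightarrow> 0" using e by (rule LIMSEQ_Suc)
    show "e (Suc i) \<ge> 0" for i unfolding e_def using a0 v1 by (intro divide_nonneg_pos mult_nonneg_nonneg) auto
  qed (use square_minus_one_distr[OF \<xi>] in auto)
  have G_unif: "\<forall>\<^sub>F n in sequentially. \<forall>x. \<bar>prob {\<omega> \<in> space M. G n \<omega> \<le> x} - \<Phi> x\<bar> \<le> \<epsilon>" if "\<epsilon> > 0" for \<epsilon>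
  proof -
    have "\<forall>\<^sub>F i in sequentially. \<forall>x. \<bar>cdf (distr M borel (G (Suc i))) x - \<Phi> x\<bar> \<le> \<epsilon>"
      using G_meas by (intro weak_conv_m_imp_uniform clt isCont_normal_cdf that real_dist_normal_dist) auto
    moreover have "cdf (distr M borel (G n)) x = prob {\<omega> \<in> space M. G n \<omega> \<le> x}" for n x
      unfolding cdf_def using G_meas[of n]
      by (subst measure_distr) (auto intro!: arg_cong[where f = prob])
    ultimately show ?thesis
      by (subst eventually_sequentially_Suc[symmetric]) simp
  qed

  have "gaussian_limit M (test_statistic \<sigma> \<phi> \<xi> \<kappa>) V m f (\<lambda>i. signal_energy \<kappa> \<phi> (m i) (f i))"
    if m: "filterlim m at_top sequentially" "\<And>i. m i \<ge> 1" and f: "\<And>i. norm (f i) \<le> c * real (m i) powr (- r)"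
    for m f c
    unfolding gaussian_limit_def
  proof (intro allI impI)
    fix \<epsilon> :: real assume "\<epsilon> > 0"
    define \<eta> where "\<eta> = \<epsilon> * v\<^sub>1 / 4"
    have "\<eta> > 0" using \<open>\<epsilon> > 0\<close> v1 by (simp add: \<eta>_def)
    define u where "u n = 36 * \<sigma>\<^sup>2 * C\<^sup>2 * c\<^sup>2 / \<eta>\<^sup>2 * real n powr (2 * r - 1)
        + 3 / \<eta> * (c\<^sup>2 * real n powr (- 2 * r) + \<sigma>\<^sup>2 * real n powr (- 1))" for n :: nat
    have "u \<longlonglongrightarrow> 36 * \<sigma>\<^sup>2 * C\<^sup>2 * c\<^sup>2 / \<eta>\<^sup>2 * 0 + 3 / \<eta> * (c\<^sup>2 * 0 + \<sigma>\<^sup>2 * 0)"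
      unfolding u_def using r by (intro tendsto_intros tendsto_neg_powr filterlim_real_sequentially) auto
    then have "u \<longlonglongrightarrow> 0" by simp
    then have "\<forall>\<^sub>F n in sequentially. u n < \<epsilon> / 4"
      using \<open>\<epsilon> > 0\<close> by (intro order_tendstoD) auto
    then have ev: "\<forall>\<^sub>F n in sequentially. u n < \<epsilon> / 4 \<and> a n 1 \<le> C * real n powr (2 * r - 2) \<and>
        (\<forall>x. \<bar>prob {\<omega> \<in> space M. G n \<omega> \<le> x} - \<Phi> x\<bar> \<le> \<epsilon> / 4)"
      using C(2) G_unif[of "\<epsilon> / 4"] \<open>\<epsilon> > 0\<close> by (intro eventually_conj) auto
    show "\<forall>\<^sub>F i in sequentially. \<forall>x.
       \<bar>type_II_error M (test_statistic \<sigma> \<phi> \<xi> \<kappa>) (m i) x (f i) -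
        \<Phi> (((real (m i))\<^sup>2 * x - signal_energy \<kappa> \<phi> (m i) (f i)) / V (m i))\<bar> \<le> \<epsilon>"
      using eventually_compose_filterlim[OF ev m(1)]
    proof eventually_elim
      case (elim i)
      define n where "n = m i"
      define B where "B = signal_energy \<kappa> \<phi> n (f i)"
      define Y where "Y \<omega> = (real n)\<^sup>2 * test_statistic \<sigma> \<phi> \<xi> \<kappa> n (f i) \<omega>" for \<omega>
      have n: "n \<ge> 1" and n0: "real n > 0" using m(2)[of i] by (simp_all add: n_def)
      have fi: "(norm (f i))\<^sup>2 \<le> c\<^sup>2 * real n powr (- 2 * r)"
      proof -
        have "(norm (f i))\<^sup>2 \<le> (c * real n powr (- r))\<^sup>2"
          using f[of i] by (intro power_mono) (auto simp: n_def)
        also have "\<dots> = c\<^sup>2 * real n powr (- 2 * r)"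
          by (simp add: power_mult_distrib power2_eq_square powr_add[symmetric])
        finally show ?thesis .
      qed
      have an: "(a n 1)\<^sup>2 \<le> C\<^sup>2 * real n powr (4 * r - 4)"
      proof -
        have "(a n 1)\<^sup>2 \<le> (C * real n powr (2 * r - 2))\<^sup>2"
          using elim a0 by (intro power_mono) (auto simp: n_def)
        also have "\<dots> = C\<^sup>2 * real n powr (4 * r - 4)"
          by (simp add: power_mult_distrib power2_eq_square powr_add[symmetric])
        finally show ?thesis .
      qed
      have "prob {\<omega> \<in> space M. \<bar>Y \<omega> - (V n * G n \<omega> + B)\<bar> > \<eta>}
        \<le> 36 * \<sigma>\<^sup>2 * (real n)^3 * (a n 1)\<^sup>2 * (norm (f i))\<^sup>2 / \<eta>\<^sup>2 + 3 * ((norm (f i))\<^sup>2 + \<sigma>\<^sup>2 / real n) / \<eta>"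
        using statistic_decomposition[OF \<xi> basis n, of \<kappa> "N n" \<eta> \<sigma> "f i"] A(1) sa[OF n] N(1)[OF n] \<open>\<eta> > 0\<close> n
        unfolding Y_def VG[OF n] S_def B_def signal_energy_def a_def assumption_A1_def by blast
      also have "\<dots> \<le> u n"
        unfolding u_def
      proof (rule add_mono)
        have "(real n)^3 * real n powr (4 * r - 4) * real n powr (- 2 * r) = real n powr (2 * r - 1)"
        proof -
          have "(real n)^3 = real n powr 3" using n0 by simp
          moreover have "3 + (4 * r - 4) + (- 2 * r) = 2 * r - 1" by simp
          ultimately show ?thesis by (simp only: powr_add[symmetric])
        qed
        then have e3: "(real n)^3 * (C\<^sup>2 * real n powr (4 * r - 4)) * (c\<^sup>2 * real n powr (- 2 * r)) = C\<^sup>2 * c\<^sup>2 * real n powr (2 * r - 1)"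
          by (simp only: mult_ac)
        have "(real n)^3 * (a n 1)\<^sup>2 * (norm (f i))\<^sup>2 \<le> (real n)^3 * (C\<^sup>2 * real n powr (4 * r - 4)) * (c\<^sup>2 * real n powr (- 2 * r))"
          using an fi by (intro mult_mono) auto
        then have "(36 * \<sigma>\<^sup>2 / \<eta>\<^sup>2) * ((real n)^3 * (a n 1)\<^sup>2 * (norm (f i))\<^sup>2) \<le>
            (36 * \<sigma>\<^sup>2 / \<eta>\<^sup>2) * (C\<^sup>2 * c\<^sup>2 * real n powr (2 * r - 1))"
          unfolding e3 by (intro mult_left_mono) auto
        then show "36 * \<sigma>\<^sup>2 * (real n)^3 * (a n 1)\<^sup>2 * (norm (f i))\<^sup>2 / \<eta>\<^sup>2 \<le>
            36 * \<sigma>\<^sup>2 * C\<^sup>2 * c\<^sup>2 / \<eta>\<^sup>2 * real n powr (2 * r - 1)"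
          by (simp add: mult_ac)
        have "3 / \<eta> * ((norm (f i))\<^sup>2 + \<sigma>\<^sup>2 / real n) \<le> 3 / \<eta> * (c\<^sup>2 * real n powr (- 2 * r) + \<sigma>\<^sup>2 * real n powr (- 1))"
          using fi \<open>\<eta> > 0\<close> n0 by (intro mult_left_mono add_mono) (auto simp: powr_minus_divide)
        then show "3 * ((norm (f i))\<^sup>2 + \<sigma>\<^sup>2 / real n) / \<eta> \<le> 3 / \<eta> * (c\<^sup>2 * real n powr (- 2 * r) + \<sigma>\<^sup>2 * real n powr (- 1))"
          by simp
      qed
      also have "\<dots> \<le> \<epsilon> / 4" using elim by (simp add: n_def)
      finally have p: "prob {\<omega> \<in> space M. \<bar>Y \<omega> - (V n * G n \<omega> + B)\<bar> > \<eta>} \<le> \<epsilon> / 4" .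
      have Vn: "V n > 0" using V1[OF n] v1 by linarith
      have Y_meas: "Y \<in> borel_measurable M"
        unfolding Y_def[abs_def] using test_statistic_measurable[OF \<xi>] by (intro borel_measurable_times) auto
      have \<eta>V: "\<eta> / V n \<le> \<epsilon> / 4"
      proof -
        have "\<eta> / V n \<le> \<eta> / v\<^sub>1" using V1[OF n] v1 \<open>\<eta> > 0\<close> by (intro divide_left_mono) auto
        also have "\<dots> = \<epsilon> / 4" using v1 by (simp add: \<eta>_def)
        finally show ?thesis .
      qed
      show ?case
      proof
        fix x
        have "{\<omega> \<in> space M. \<not> test_statistic \<sigma> \<phi> \<xi> \<kappa> n (f i) \<omega> > x} = {\<omega> \<in> space M. Y \<omega> \<le> (real n)\<^sup>2 * x}"
          using n0 by (auto simp: Y_def not_less)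
        then have "type_II_error M (test_statistic \<sigma> \<phi> \<xi> \<kappa>) n x (f i) = prob {\<omega> \<in> space M. Y \<omega> \<le> (real n)\<^sup>2 * x}"
          by (simp add: type_II_error_def)
        moreover have "\<bar>prob {\<omega> \<in> space M. Y \<omega> \<le> (real n)\<^sup>2 * x} - \<Phi> (((real n)\<^sup>2 * x - B) / V n)\<bar> \<le> \<epsilon> / 4 + \<epsilon> / 4 + \<eta> / V n"
          using elim \<open>\<eta> > 0\<close> by (intro slutsky_cdf_bound[OF Y_meas G_meas Vn _ _ p]) (auto simp: n_def)
        ultimately show "\<bar>type_II_error M (test_statistic \<sigma> \<phi> \<xi> \<kappa>) (m i) x (f i) -
            \<Phi> (((real (m i))\<^sup>2 * x - signal_energy \<kappa> \<phi> (m i) (f i)) / V (m i))\<bar> \<le> \<epsilon>"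
          unfolding n_def[symmetric] B_def[symmetric] using \<eta>V by linarith
      qed
    qed
  qed
  with v1 V1 V2 that show ?thesis by blast
qed

section \<open>Signal energy inside and outside the Besov space\<close>

lemma signal_energy_summable:
  assumes "orthonormal_basis \<phi>" "antimono_on {1..} (\<lambda>j. (\<kappa> n j)\<^sup>2)"
  shows "(\<lambda>j. (\<kappa> n j)\<^sup>2 * (f \<bullet> \<phi> j)\<^sup>2) summable_on {1..}"
proof (rule summable_on_comparison_test)
  show "(\<lambda>j. (\<kappa> n 1)\<^sup>2 * (f \<bullet> \<phi> j)\<^sup>2) summable_on {1..}"
    by (rule summable_on_cmult_right[OF has_sum_imp_summable[OF parseval[OF assms(1)]]])
  show "(\<kappa> n j)\<^sup>2 * (f \<bullet> \<phi> j)\<^sup>2 \<le> (\<kappa> n 1)\<^sup>2 * (f \<bullet> \<phi> j)\<^sup>2" if "j \<in> {1..}" for j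
    using assms(2) that by (intro mult_right_mono) (auto simp: monotone_on_def)
qed auto

lemma norm_sq_split:
  assumes "orthonormal_basis \<phi>"
  shows "(norm f)\<^sup>2 = (\<Sum>j\<in>{1..k}. (f \<bullet> \<phi> j)\<^sup>2) + (norm (tail \<phi> k f))\<^sup>2"
  using infsum_split_at(2)[OF has_sum_imp_summable[OF has_sum_tail[OF assms]], of f k]
    infsumI[OF parseval[OF assms, of f]] infsumI[OF has_sum_tail[OF assms, of f k]]
  by metis

lemma signal_energy_ge_head:
  assumes basis: "orthonormal_basis \<phi>" and A1: "antimono_on {1..} (\<lambda>j. (\<kappa> n j)\<^sup>2)"
  shows "(real n)\<^sup>2 * ((\<kappa> n k)\<^sup>2 * ((norm f)\<^sup>2 - (norm (tail \<phi> k f))\<^sup>2)) \<le> signal_energy \<kappa> \<phi> n f"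
  unfolding signal_energy_def
proof (rule mult_left_mono)
  have "(\<kappa> n k)\<^sup>2 * ((norm f)\<^sup>2 - (norm (tail \<phi> k f))\<^sup>2) = (\<Sum>j\<in>{1..k}. (\<kappa> n k)\<^sup>2 * (f \<bullet> \<phi> j)\<^sup>2)"
    unfolding norm_sq_split[OF basis, of f k] by (simp add: sum_distrib_left)
  also have "\<dots> \<le> (\<Sum>j\<in>{1..k}. (\<kappa> n j)\<^sup>2 * (f \<bullet> \<phi> j)\<^sup>2)"
    using A1 by (intro sum_mono mult_right_mono) (auto simp: monotone_on_def)
  also have "\<dots> \<le> (\<Sum>\<^sub>\<infinity>j\<in>{1..}. (\<kappa> n j)\<^sup>2 * (f \<bullet> \<phi> j)\<^sup>2)"
    by (intro finite_sum_le_infsum signal_energy_summable basis A1) auto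
  finally show "(\<kappa> n k)\<^sup>2 * ((norm f)\<^sup>2 - (norm (tail \<phi> k f))\<^sup>2) \<le> (\<Sum>\<^sub>\<infinity>j\<in>{1..}. (\<kappa> n j)\<^sup>2 * (f \<bullet> \<phi> j)\<^sup>2)" .
qed simp

text \<open>The tail of \<open>f\<close> beyond \<open>k\<close> meets only coefficients not exceeding the one at \<open>k\<close>.\<close>
lemma signal_energy_tail_le:
  assumes basis: "orthonormal_basis \<phi>" and A1: "antimono_on {1..} (\<lambda>j. (\<kappa> n j)\<^sup>2)" and "k \<ge> 1"
  shows "signal_energy \<kappa> \<phi> n (tail \<phi> k f) \<le> (real n)\<^sup>2 * ((\<kappa> n k)\<^sup>2 * (norm (tail \<phi> k f))\<^sup>2)"
  unfolding signal_energy_def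
proof (rule mult_left_mono)
  let ?g = "tail \<phi> k f"
  have "(\<Sum>\<^sub>\<infinity>j\<in>{1..}. (\<kappa> n j)\<^sup>2 * (?g \<bullet> \<phi> j)\<^sup>2) \<le> (\<Sum>\<^sub>\<infinity>j\<in>{1..}. (\<kappa> n k)\<^sup>2 * (?g \<bullet> \<phi> j)\<^sup>2)"
  proof (rule infsum_mono)
    show "(\<lambda>j. (\<kappa> n j)\<^sup>2 * (?g \<bullet> \<phi> j)\<^sup>2) summable_on {1..}"
      by (rule signal_energy_summable[where \<kappa> = \<kappa>, OF basis A1])
    show "(\<lambda>j. (\<kappa> n k)\<^sup>2 * (?g \<bullet> \<phi> j)\<^sup>2) summable_on {1..}"
      by (rule summable_on_cmult_right[OF has_sum_imp_summable[OF parseval[OF basis]]])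
    fix j :: nat assume "j \<in> {1..}"
    show "(\<kappa> n j)\<^sup>2 * (?g \<bullet> \<phi> j)\<^sup>2 \<le> (\<kappa> n k)\<^sup>2 * (?g \<bullet> \<phi> j)\<^sup>2"
    proof (cases "j \<le> k")
      case True
      then show ?thesis using tail_inner[OF basis, of j k f] \<open>j \<in> {1..}\<close> by simp
    next
      case False
      then show ?thesis using A1 \<open>k \<ge> 1\<close> by (intro mult_right_mono) (auto simp: monotone_on_def)
    qed
  qed
  also have "\<dots> = (\<kappa> n k)\<^sup>2 * (norm ?g)\<^sup>2"
    using infsum_cmult_right[of "(\<kappa> n k)\<^sup>2" "\<lambda>j. (?g \<bullet> \<phi> j)\<^sup>2" "{1..}"]
      has_sum_imp_summable[OF parseval[OF basis, of ?g]] infsumI[OF parseval[OF basis, of ?g]]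
    by metis
  finally show "(\<Sum>\<^sub>\<infinity>j\<in>{1..}. (\<kappa> n j)\<^sup>2 * (?g \<bullet> \<phi> j)\<^sup>2) \<le> (\<kappa> n k)\<^sup>2 * (norm ?g)\<^sup>2" .
qed simp

text \<open>Cut the signal at \<open>D\<close> times the cutoff, a frequency of order \<open>n powr (2 - 4r)\<close>. The Besov
  bound on the squared norm beyond it is of order \<open>n powr (-(2 - 4r) 2s) = n powr (-2r)\<close> with a
  constant that is small for large \<open>D\<close>, so at least half of the squared norm sits below it. By A5 the coefficients
  there are bounded below by a multiple of \<open>n powr (2r - 2)\<close>. The product with \<open>n\<^sup>2\<close> is of
  order \<open>1\<close>.\<close>
lemma besov_alternatives_signal_energy:
  assumes basis: "orthonormal_basis \<phi>" and A1: "assumption_A1 \<kappa>" and A5: "assumption_A5 \<kappa>"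
    and "s > 0" "P \<ge> 0" and rs: "(2 - 4 * r) * s = r"
    and scales: "c\<^sub>0 > 0" "\<forall>\<^sub>F n in sequentially. c\<^sub>0 * real n powr (2 * r - 2) \<le> (\<kappa> n (cutoff \<kappa> n))\<^sup>2 \<and>
       c\<^sub>0 * real n powr (2 - 4 * r) \<le> real (cutoff \<kappa> n)"
    and m: "filterlim m at_top sequentially"
    and f: "\<And>i. f i \<in> (\<lambda>g. \<gamma> *\<^sub>R g) ` besov_ball \<phi> s P" "\<And>i. c * real (m i) powr (- r) < norm (f i)" and "c > 0"
  shows "\<exists>b>0. \<forall>\<^sub>F i in sequentially. b \<le> signal_energy \<kappa> \<phi> (m i) (f i)"
proof -
  define K where "K = \<gamma>\<^sup>2 * P * c\<^sub>0 powr (- 2 * s)"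
  have "((\<lambda>D. K * D powr (- 2 * s)) \<longlongrightarrow> K * 0) at_top"
    using \<open>s > 0\<close> by (intro tendsto_intros tendsto_neg_powr filterlim_ident) auto
  then have "\<forall>\<^sub>F D in at_top. K * D powr (- 2 * s) < c\<^sup>2 / 2"
    by (rule order_tendstoD) (use \<open>c > 0\<close> in simp)
  then have "\<forall>\<^sub>F D in at_top. K * D powr (- 2 * s) < c\<^sup>2 / 2 \<and> D > 1"
    by (intro eventually_conj eventually_gt_at_top)
  then obtain D where D: "K * D powr (- 2 * s) < c\<^sup>2 / 2" "D > 1"
    using eventually_happens' trivial_limit_at_top_linorder by blast
  obtain C where C: "C > 0" "\<And>n. n \<ge> 1 \<Longrightarrow> C * (\<kappa> n (cutoff \<kappa> n))\<^sup>2 \<le> (\<kappa> n (nat \<lfloor>D * real (cutoff \<kappa> n)\<rfloor>))\<^sup>2"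
    using A5 D(2) unfolding assumption_A5_def by blast
  define b where "b = C * c\<^sub>0 * (c\<^sup>2 / 2)"
  have ev: "\<forall>\<^sub>F n in sequentially. n \<ge> 1 \<and> c\<^sub>0 * real n powr (2 * r - 2) \<le> (\<kappa> n (cutoff \<kappa> n))\<^sup>2 \<and>
       c\<^sub>0 * real n powr (2 - 4 * r) \<le> real (cutoff \<kappa> n)"
    using scales(2) eventually_ge_at_top[of 1] by eventually_elim auto
  have "\<forall>\<^sub>F i in sequentially. b \<le> signal_energy \<kappa> \<phi> (m i) (f i)"
    using eventually_compose_filterlim[OF ev m]
  proof eventually_elim
    case (elim i)
    define n where "n = m i"
    define k where "k = nat \<lfloor>D * real (cutoff \<kappa> n)\<rfloor>"
    define w where "w = real n powr (- r)"
    have n: "n \<ge> 1" and n0: "real n > 0" using elim by (simp_all add: n_def)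
    have lower: "c\<^sub>0 * real n powr (2 * r - 2) \<le> (\<kappa> n (cutoff \<kappa> n))\<^sup>2"
        "c\<^sub>0 * real n powr (2 - 4 * r) \<le> real (cutoff \<kappa> n)"
      using elim by (simp_all add: n_def)
    have w0: "w > 0" using n0 by (simp add: w_def)
    have w2: "w\<^sup>2 = real n powr (- 2 * r)" by (simp add: w_def power2_eq_square powr_add[symmetric])
    have l0: "c\<^sub>0 * real n powr (2 - 4 * r) > 0" using scales(1) n0 by simp
    then have l: "D * real (cutoff \<kappa> n) > 0" using lower(2) D(2) by (intro mult_pos_pos) auto
    obtain g where g: "f i = \<gamma> *\<^sub>R g" "g \<in> besov_ball \<phi> s P" using f(1)[of i] by blast
    have "(D * real (cutoff \<kappa> n)) powr (2 * s) * (norm (tail \<phi> k g))\<^sup>2 \<le> P"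
      using g(2) l unfolding besov_ball_iff[OF basis] k_def by blast
    moreover have "(D * real (cutoff \<kappa> n)) powr (- 2 * s) = 1 / (D * real (cutoff \<kappa> n)) powr (2 * s)"
      using powr_minus_divide[of _ "2 * s"] by simp
    moreover have "(D * real (cutoff \<kappa> n)) powr (2 * s) > 0" using l by (rule powr_gt_zero[THEN iffD2, OF less_imp_neq[symmetric]])
    ultimately have "(norm (tail \<phi> k g))\<^sup>2 \<le> P * (D * real (cutoff \<kappa> n)) powr (- 2 * s)"
      by (simp only: times_divide_eq_right mult_1_right pos_le_divide_eq mult.commute)
    also have "\<dots> \<le> P * (D * (c\<^sub>0 * real n powr (2 - 4 * r))) powr (- 2 * s)"
      using l0 lower(2) D(2) \<open>P \<ge> 0\<close> \<open>s > 0\<close>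
      by (intro mult_left_mono powr_mono2') auto
    also have "(D * (c\<^sub>0 * real n powr (2 - 4 * r))) powr (- 2 * s) =
        D powr (- 2 * s) * c\<^sub>0 powr (- 2 * s) * w\<^sup>2"
    proof -
      have "(2 - 4 * r) * (- 2 * s) = - 2 * r" using rs by (simp add: mult.commute mult.left_commute)
      then have "(real n powr (2 - 4 * r)) powr (- 2 * s) = w\<^sup>2" unfolding w2 powr_powr by (rule arg_cong)
      then show ?thesis using scales(1) D(2) n0 by (simp add: powr_mult)
    qed
    finally have "(norm (tail \<phi> k g))\<^sup>2 \<le> P * (D powr (- 2 * s) * c\<^sub>0 powr (- 2 * s) * w\<^sup>2)" .
    then have "\<gamma>\<^sup>2 * (norm (tail \<phi> k g))\<^sup>2 \<le> \<gamma>\<^sup>2 * (P * (D powr (- 2 * s) * c\<^sub>0 powr (- 2 * s) * w\<^sup>2))"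
      by (intro mult_left_mono) auto
    then have "(norm (tail \<phi> k (f i)))\<^sup>2 \<le> (K * D powr (- 2 * s)) * w\<^sup>2"
      by (simp add: g(1) linear_cmul[OF linear_tail] power_mult_distrib K_def mult_ac)
    also have "\<dots> \<le> (c\<^sup>2 / 2) * w\<^sup>2"
      using D(1) by (intro mult_right_mono) auto
    finally have tail_small: "(norm (tail \<phi> k (f i)))\<^sup>2 \<le> (c\<^sup>2 / 2) * w\<^sup>2" .
    have "(c * w)\<^sup>2 \<le> (norm (f i))\<^sup>2"
      using f(2)[of i] \<open>c > 0\<close> w0 by (intro power_mono) (auto simp: w_def n_def)
    then have head: "(c\<^sup>2 / 2) * w\<^sup>2 \<le> (norm (f i))\<^sup>2 - (norm (tail \<phi> k (f i)))\<^sup>2"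
      using tail_small by (simp add: power_mult_distrib)
    have coef: "C * (c\<^sub>0 * real n powr (2 * r - 2)) \<le> (\<kappa> n k)\<^sup>2"
      using C(2)[OF n] mult_left_mono[OF lower(1), of C] C(1) unfolding k_def by linarith
    have "(real n)\<^sup>2 * (real n powr (2 * r - 2) * w\<^sup>2) = 1"
    proof -
      have "(real n)\<^sup>2 = real n powr 2" using n0 by simp
      moreover have "2 + ((2 * r - 2) + (- 2 * r)) = 0" by simp
      ultimately show ?thesis unfolding w2 using n0 by (simp only: powr_add[symmetric]) simp
    qed
    then have "b = (real n)\<^sup>2 * ((C * (c\<^sub>0 * real n powr (2 * r - 2))) * ((c\<^sup>2 / 2) * w\<^sup>2))"
      by (simp add: b_def mult_ac)
    also have "\<dots> \<le> (real n)\<^sup>2 * ((\<kappa> n k)\<^sup>2 * ((norm (f i))\<^sup>2 - (norm (tail \<phi> k (f i)))\<^sup>2))"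
      using coef head by (intro mult_left_mono mult_mono) auto
    also have "\<dots> \<le> signal_energy \<kappa> \<phi> n (f i)"
      using A1 n unfolding assumption_A1_def by (intro signal_energy_ge_head basis) auto
    finally show ?case by (simp add: n_def)
  qed
  moreover have "b > 0" using C(1) scales(1) \<open>c > 0\<close> by (simp add: b_def)
  ultimately show ?thesis by blast
qed

text \<open>Flipping the signs of the first \<open>k\<close> coefficients stays inside the set, and the tail is the
  midpoint of the signal and its flipped version.\<close>
lemma tail_mem_convex_ortho_symmetric:
  assumes basis: "orthonormal_basis \<phi>" and V: "convex V" "ortho_symmetric \<phi> V" "f \<in> V"
  shows "tail \<phi> k f \<in> V"
proof -
  define \<theta> where "\<theta> j = f \<bullet> \<phi> j" for j
  define \<theta>' where "\<theta>' j = (if j \<le> k then - \<theta> j else \<theta> j)" for j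
  define p where "p = (\<Sum>j\<in>{1..k}. \<theta> j *\<^sub>R \<phi> j)"
  have f: "((\<lambda>j. \<theta> j *\<^sub>R \<phi> j) has_sum f) {1..}"
    unfolding \<theta>_def by (rule basis_expansion[OF basis])
  have "((\<lambda>j. (if j \<le> k then - 2 * \<theta> j else 0) *\<^sub>R \<phi> j) has_sum (- 2) *\<^sub>R p) {1..}"
    unfolding p_def
    by (rule has_sum_finite_neutralI[of "{1..k}"]) (auto simp: scaleR_sum_right simp del: scaleR_left.minus scaleR_minus_left intro!: sum.cong)
  from has_sum_add[OF f this]
  have "((\<lambda>j. \<theta>' j *\<^sub>R \<phi> j) has_sum (f + (- 2) *\<^sub>R p)) {1..}"
    by (rule has_sum_cong[THEN iffD1, rotated]) (auto simp: \<theta>'_def scaleR_left_distrib[symmetric] simp del: scaleR_left.minus)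
  moreover have "\<forall>j\<ge>1. \<theta>' j \<in> {\<theta> j, - \<theta> j}" by (auto simp: \<theta>'_def)
  ultimately have "f + (- 2) *\<^sub>R p \<in> V"
    using V(2,3) f unfolding ortho_symmetric_def by blast
  then have "(1/2) *\<^sub>R f + (1/2) *\<^sub>R (f + (- 2) *\<^sub>R p) \<in> V"
    using V(1,3) by (intro convexD) auto
  moreover have "(1/2) *\<^sub>R f + (1/2) *\<^sub>R (f + (- 2) *\<^sub>R p) = tail \<phi> k f"
  proof -
    have "(1/2) *\<^sub>R f + (1/2) *\<^sub>R f = f" by (simp add: scaleR_left_distrib[symmetric])
    moreover have "(1/2) *\<^sub>R ((- 2) *\<^sub>R p) = - p" by simp
    ultimately show ?thesis
      by (simp only: scaleR_right_distrib add.assoc[symmetric]) (simp add: tail_def p_def \<theta>_def)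
  qed
  ultimately show ?thesis by simp
qed

lemma norm_tail_tendsto_0:
  assumes "orthonormal_basis \<phi>"
  shows "(\<lambda>k. norm (tail \<phi> k f)) \<longlonglongrightarrow> 0"
proof -
  have "(\<lambda>k. (norm f)\<^sup>2 - (\<Sum>j\<in>{1..k}. (f \<bullet> \<phi> j)\<^sup>2)) \<longlonglongrightarrow> (norm f)\<^sup>2 - (norm f)\<^sup>2"
    by (intro tendsto_intros has_sum_imp_partial_sums_tendsto parseval assms)
  moreover have "(norm f)\<^sup>2 - (\<Sum>j\<in>{1..k}. (f \<bullet> \<phi> j)\<^sup>2) = (norm (tail \<phi> k f))\<^sup>2" for k
    using norm_sq_split[OF assms, of f k] by simp
  ultimately have "(\<lambda>k. (norm (tail \<phi> k f))\<^sup>2) \<longlonglongrightarrow> 0"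
    by (simp only: diff_self)
  then have "(\<lambda>k. sqrt ((norm (tail \<phi> k f))\<^sup>2)) \<longlonglongrightarrow> sqrt 0" by (rule tendsto_real_sqrt)
  then show ?thesis by simp
qed

text \<open>Outside the generated space the weighted tails are unbounded. On a bounded range of levels they are
  bounded by the norm of the signal, so large values occur only at high levels, where the tails
  are as short as desired. The factor \<open>2\<close> pays for rounding the level down to an index
  \<open>k \<ge> 1\<close>.\<close>
lemma large_tail_index:
  assumes basis: "orthonormal_basis \<phi>" and "s > 0" "P > 0"
    and f: "f \<notin> generated_space (besov_ball \<phi> s P)" and "\<delta> > 0"
  obtains k where "k \<ge> 1" "K < (2 * real k) powr (2 * s) * (norm (tail \<phi> k f))\<^sup>2" "norm (tail \<phi> k f) < \<delta>"
proof -
  obtain k\<^sub>0 where k0: "\<And>k. k \<ge> k\<^sub>0 \<Longrightarrow> norm (tail \<phi> k f) < \<delta>"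
    using order_tendstoD(2)[OF norm_tail_tendsto_0[OF basis] \<open>\<delta> > 0\<close>] unfolding eventually_sequentially by blast
  define F where "F = (norm f)\<^sup>2"
  \<comment> \<open>\<open>K'\<close> is at least the weighted tail at every level up to \<open>k\<^sub>0 + 1\<close>, so exceeding it forces a high level.\<close>
  define K' where "K' = max K (real (Suc k\<^sub>0) powr (2 * s) * F)"
  obtain l where l: "l > 0" "K' < l powr (2 * s) * (norm (tail \<phi> (nat \<lfloor>l\<rfloor>) f))\<^sup>2"
    using not_in_generated_space_besov[OF basis \<open>P > 0\<close> f, of K'] by blast
  define k where "k = nat \<lfloor>l\<rfloor>"
  have tail_le: "(norm (tail \<phi> k f))\<^sup>2 \<le> F"
    unfolding F_def norm_sq_split[OF basis, of f k] by (simp add: sum_nonneg)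
  have "real (Suc k\<^sub>0) < l"
  proof (rule ccontr)
    assume "\<not> ?thesis"
    then have "l powr (2 * s) * (norm (tail \<phi> k f))\<^sup>2 \<le> real (Suc k\<^sub>0) powr (2 * s) * F"
      using l(1) \<open>s > 0\<close> tail_le by (intro mult_mono powr_mono2) auto
    with l(2) show False by (simp add: K'_def k_def)
  qed
  then have k: "k\<^sub>0 \<le> k" "k \<ge> 1" "l \<le> 2 * real k"
  proof -
    have "real k = of_int \<lfloor>l\<rfloor>" using l(1) by (simp add: k_def)
    moreover have "1 \<le> \<lfloor>l\<rfloor>" using \<open>real (Suc k\<^sub>0) < l\<close> by simp
    ultimately show "k\<^sub>0 \<le> k" "k \<ge> 1" "l \<le> 2 * real k"
      using \<open>real (Suc k\<^sub>0) < l\<close> by linarith+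
  qed
  have "K < l powr (2 * s) * (norm (tail \<phi> k f))\<^sup>2"
    using l(2) by (simp add: K'_def k_def)
  also have "\<dots> \<le> (2 * real k) powr (2 * s) * (norm (tail \<phi> k f))\<^sup>2"
    using k l(1) \<open>s > 0\<close> by (intro mult_right_mono powr_mono2) auto
  finally show ?thesis using that[of k] k k0 by blast
qed

text \<open>Here \<open>t k\<close> stands for the norm of the tail at \<open>k\<close>, which serves as alternative at the sample
  size \<open>n = \<lceil>t k powr (-1/r)\<rceil>\<close>, the one whose rate \<open>n powr (-r)\<close> matches this norm up to rounding.
  Tails of arbitrarily small norm are available, hence arbitrarily large sample sizes, and a
  strictly increasing sequence can be selected.\<close>
lemma exists_matching_sample_sizes:
  fixes t :: "nat \<Rightarrow> real" and r :: real
  assumes "r > 0"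
    and large: "\<And>K \<delta>. \<delta> > 0 \<Longrightarrow> \<exists>k\<ge>1. K < (2 * real k) powr (2 * s) * (t k)\<^sup>2 \<and> t k < \<delta>"
    and t: "\<And>k. t k \<ge> 0"
  obtains k m :: "nat \<Rightarrow> nat" where "strict_mono m" "\<And>i. m i \<ge> 1" "\<And>i. k i \<ge> 1"
    "\<And>i. real i < (2 * real (k i)) powr (2 * s) * (t (k i))\<^sup>2"
    "\<And>i. real (m i) powr (- r) \<le> t (k i)" "\<And>i. t (k i) \<le> 2 powr r * real (m i) powr (- r)"
proof -
  define n where "n k = nat \<lceil>t k powr (- 1 / r)\<rceil>" for k
  let ?P = "\<lambda>i k. k \<ge> 1 \<and> real i < (2 * real k) powr (2 * s) * (t k)\<^sup>2 \<and> t k \<le> 1"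
  have pos: "t k > 0" if "?P i k" for i k
    using that t[of k] by (cases "t k = 0") auto
  have ex: "\<exists>k. ?P i k \<and> N < n k" for i N
  proof -
    define \<delta> where "\<delta> = real (Suc N) powr (- r)"
    have "\<delta> \<le> 1" using \<open>r > 0\<close> by (simp add: \<delta>_def powr_minus_divide ge_one_powr_ge_zero)
    obtain k where k: "k \<ge> 1" "real i < (2 * real k) powr (2 * s) * (t k)\<^sup>2" "t k < \<delta>"
      using large[of \<delta> "real i"] by (auto simp: \<delta>_def)
    have "t k > 0" using pos[of k i] k \<open>\<delta> \<le> 1\<close> by simp
    have "real (Suc N) = \<delta> powr (- 1 / r)"
      using \<open>r > 0\<close> by (simp add: \<delta>_def powr_powr)
    also have "\<dots> < t k powr (- 1 / r)"
      using k(3) \<open>t k > 0\<close> \<open>r > 0\<close> by (intro powr_less_mono2_neg) auto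
    finally have "N < n k" unfolding n_def by linarith
    with k \<open>\<delta> \<le> 1\<close> show ?thesis by force
  qed
  have "\<exists>h. \<forall>i. ?P i (h i) \<and> n (h i) < n (h (Suc i))"
    by (rule dependent_nat_choice) (use ex in blast)+
  then obtain h where h: "\<And>i. ?P i (h i)" "\<And>i. n (h i) < n (h (Suc i))" by blast
  show ?thesis
  proof (rule that[of "\<lambda>i. n (h i)" h])
    show "strict_mono (\<lambda>i. n (h i))" using h(2) by (simp add: strict_mono_Suc_iff)
    fix i
    have t0: "t (h i) > 0" and t1: "t (h i) \<le> 1" using pos[OF h(1)] h(1) by blast+
    define y where "y = t (h i) powr (- 1 / r)"
    have "1 \<le> y"
    proof -
      have "y = 1 / t (h i) powr (1 / r)" by (simp add: y_def powr_minus_divide)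
      moreover have "t (h i) powr (1 / r) \<le> 1" using t0 t1 \<open>r > 0\<close> by (intro powr_le1) auto
      ultimately show ?thesis using t0 by simp
    qed
    then have ny: "y \<le> real (n (h i))" "real (n (h i)) \<le> 2 * y" unfolding n_def y_def[symmetric] by linarith+
    show "n (h i) \<ge> 1" using ny(1) \<open>1 \<le> y\<close> by linarith
    have y: "y powr (- r) = t (h i)" using \<open>r > 0\<close> t0 by (simp add: y_def powr_powr)
    have "real (n (h i)) powr (- r) \<le> y powr (- r)"
      using ny \<open>1 \<le> y\<close> \<open>r > 0\<close> by (intro powr_mono2') auto
    then show "real (n (h i)) powr (- r) \<le> t (h i)" by (simp add: y)
    have "(2 * y) powr (- r) \<le> real (n (h i)) powr (- r)"
      using ny \<open>1 \<le> y\<close> \<open>r > 0\<close> by (intro powr_mono2') auto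
    then have "2 powr (- r) * t (h i) \<le> real (n (h i)) powr (- r)"
      using \<open>1 \<le> y\<close> by (simp add: powr_mult y)
    then have "2 powr r * (2 powr (- r) * t (h i)) \<le> 2 powr r * real (n (h i)) powr (- r)"
      by (intro mult_left_mono) auto
    then show "t (h i) \<le> 2 powr r * real (n (h i)) powr (- r)"
      by (simp add: mult.assoc[symmetric] powr_add[symmetric])
  qed (use h(1) in blast)+
qed

text \<open>Let \<open>x\<close> be the ratio of the tail index \<open>k\<close> to the cutoff. The tail is long in the weighted
  sense: \<open>(2k) powr (2s)\<close> times its squared norm, which is at most of order \<open>n powr (-2r)\<close>,
  exceeds \<open>i\<close>. As \<open>n powr (2r) = (n powr (2 - 4r)) powr (2s)\<close> and the cutoff has order
  \<open>n powr (2 - 4r)\<close>, this says that \<open>x powr (2s)\<close> is at least a multiple of \<open>i\<close>; so \<open>x\<close> tends to infinity. By A4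
  the coefficients beyond \<open>k\<close> are then smaller than those at the cutoff by a factor of order
  \<open>x powr (-p)\<close>, while at the cutoff they would give energy of order \<open>1\<close>.\<close>
lemma tail_alternatives_signal_energy:
  assumes basis: "orthonormal_basis \<phi>" and A1: "assumption_A1 \<kappa>" and A4: "assumption_A4 \<kappa>"
    and "s > 0" and rs: "(2 - 4 * r) * s = r"
    and scales: "c\<^sub>0 > 0" "C\<^sub>0 > 0" "\<forall>\<^sub>F n in sequentially. c\<^sub>0 * real n powr (2 - 4 * r) \<le> real (cutoff \<kappa> n) \<and>
       (\<kappa> n 1)\<^sup>2 \<le> C\<^sub>0 * real n powr (2 * r - 2) \<and> real (cutoff \<kappa> n) \<le> C\<^sub>0 * real n powr (2 - 4 * r)"
    and m: "filterlim m at_top sequentially" and k: "\<And>i. k i \<ge> 1"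
    and large: "\<And>i. real i < (2 * real (k i)) powr (2 * s) * (norm (tail \<phi> (k i) f))\<^sup>2"
    and rate: "\<And>i. norm (tail \<phi> (k i) f) \<le> C * real (m i) powr (- r)"
  shows "(\<lambda>i. signal_energy \<kappa> \<phi> (m i) (tail \<phi> (k i) f)) \<longlonglongrightarrow> 0"
proof -
  define x where "x i = real (k i) / real (cutoff \<kappa> (m i))" for i
  obtain C\<^sub>4 p where p: "p > 1" and A4': "\<And>\<delta> n. \<delta> > 0 \<Longrightarrow> n \<ge> 1 \<Longrightarrow>
      (\<kappa> n (nat \<lfloor>(1 + \<delta>) * real (cutoff \<kappa> n)\<rfloor>))\<^sup>2 < C\<^sub>4 * (1 + \<delta>) powr (- p) * (\<kappa> n (cutoff \<kappa> n))\<^sup>2"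
    using A4 unfolding assumption_A4_def by blast
  have ev: "\<forall>\<^sub>F i in sequentially. m i \<ge> 1 \<and> c\<^sub>0 * real (m i) powr (2 - 4 * r) \<le> real (cutoff \<kappa> (m i)) \<and>
       (\<kappa> (m i) 1)\<^sup>2 \<le> C\<^sub>0 * real (m i) powr (2 * r - 2) \<and> real (cutoff \<kappa> (m i)) \<le> C\<^sub>0 * real (m i) powr (2 - 4 * r)"
    using eventually_compose_filterlim[OF eventually_conj[OF eventually_ge_at_top[of 1] scales(3)] m] .

  define q where "q = C\<^sup>2 * (2 * C\<^sub>0) powr (2 * s) + 1"
  have "q > 0" by (simp add: q_def add_nonneg_pos)
  have x_large: "\<forall>\<^sub>F i in sequentially. (real i / q) powr (1 / (2 * s)) \<le> x i"
    using ev
  proof eventually_elim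
    case (elim i)
    define n where "n = m i"
    have n0: "real n > 0" using elim by (simp add: n_def)
    have "0 < c\<^sub>0 * real n powr (2 - 4 * r)" using scales(1) n0 by simp
    then have cut: "real (cutoff \<kappa> n) > 0" "real (cutoff \<kappa> n) \<le> C\<^sub>0 * real n powr (2 - 4 * r)"
      using elim unfolding n_def by linarith+
    have xk: "real (k i) = x i * real (cutoff \<kappa> n)" using cut(1) by (simp add: x_def n_def)
    have x0: "x i \<ge> 0" by (simp add: x_def)
    have "real i \<le> (2 * real (k i)) powr (2 * s) * (C * real n powr (- r))\<^sup>2"
    proof -
      have "(norm (tail \<phi> (k i) f))\<^sup>2 \<le> (C * real n powr (- r))\<^sup>2"
        using rate[of i] by (intro power_mono) (auto simp: n_def)
      then have "(2 * real (k i)) powr (2 * s) * (norm (tail \<phi> (k i) f))\<^sup>2 \<le> (2 * real (k i)) powr (2 * s) * (C * real n powr (- r))\<^sup>2"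
        by (intro mult_left_mono) auto
      with large[of i] show ?thesis by linarith
    qed
    also have "\<dots> \<le> (2 * (x i * (C\<^sub>0 * real n powr (2 - 4 * r)))) powr (2 * s) * (C * real n powr (- r))\<^sup>2"
      unfolding xk using cut x0 \<open>s > 0\<close> by (intro mult_right_mono powr_mono2 mult_left_mono) auto
    also have "\<dots> = C\<^sup>2 * (2 * C\<^sub>0) powr (2 * s) * x i powr (2 * s)"
    proof -
      have e: "(2 - 4 * r) * (2 * s) = 2 * r" using rs by (simp add: mult.commute mult.left_commute)
      have "(2 * (x i * (C\<^sub>0 * real n powr (2 - 4 * r)))) powr (2 * s) = ((2 * C\<^sub>0) * x i * real n powr (2 - 4 * r)) powr (2 * s)"
        by (simp add: mult_ac)
      also have "\<dots> = (2 * C\<^sub>0) powr (2 * s) * x i powr (2 * s) * real n powr (2 * r)"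
        using x0 scales(2) by (simp add: powr_mult powr_powr e)
      finally have split: "(2 * (x i * (C\<^sub>0 * real n powr (2 - 4 * r)))) powr (2 * s) =
          (2 * C\<^sub>0) powr (2 * s) * x i powr (2 * s) * real n powr (2 * r)" .
      have "real n powr (2 * r) * (real n powr (- r))\<^sup>2 = 1"
        using n0 by (simp add: power2_eq_square powr_add[symmetric])
      then show ?thesis unfolding split by (simp add: power_mult_distrib mult_ac)
    qed
    also have "\<dots> \<le> q * x i powr (2 * s)" by (intro mult_right_mono) (auto simp: q_def)
    finally have "real i / q \<le> x i powr (2 * s)" using \<open>q > 0\<close> by (simp add: pos_divide_le_eq mult.commute)
    then have "(real i / q) powr (1 / (2 * s)) \<le> (x i powr (2 * s)) powr (1 / (2 * s))"
      using \<open>q > 0\<close> \<open>s > 0\<close> by (intro powr_mono2) auto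
    also have "\<dots> = x i" using x0 \<open>s > 0\<close> by (simp add: powr_powr)
    finally show ?case .
  qed
  have "filterlim (\<lambda>i. (real i / q) powr (1 / (2 * s))) at_top sequentially"
    using \<open>q > 0\<close> \<open>s > 0\<close> by real_asymp
  then have x_lim: "filterlim x at_top sequentially"
    by (rule filterlim_at_top_mono[OF _ x_large])
  have "(\<lambda>i. C\<^sub>4 * C\<^sub>0 * C\<^sup>2 * x i powr (- p)) \<longlonglongrightarrow> C\<^sub>4 * C\<^sub>0 * C\<^sup>2 * 0"
    using p by (intro tendsto_intros tendsto_neg_powr x_lim) auto
  then have upper: "(\<lambda>i. C\<^sub>4 * C\<^sub>0 * C\<^sup>2 * x i powr (- p)) \<longlonglongrightarrow> 0" by simp
  show ?thesis
  proof (rule tendsto_sandwich[OF _ _ tendsto_const upper])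
    show "\<forall>\<^sub>F i in sequentially. 0 \<le> signal_energy \<kappa> \<phi> (m i) (tail \<phi> (k i) f)"
      by (intro always_eventually allI) (simp add: signal_energy_def infsum_nonneg)
    have "\<forall>\<^sub>F i in sequentially. x i > 1" using x_lim by (simp add: filterlim_at_top_dense)
    then show "\<forall>\<^sub>F i in sequentially. signal_energy \<kappa> \<phi> (m i) (tail \<phi> (k i) f) \<le> C\<^sub>4 * C\<^sub>0 * C\<^sup>2 * x i powr (- p)"
      using ev
    proof eventually_elim
      case (elim i)
      define n where "n = m i"
      have n: "n \<ge> 1" and n0: "real n > 0" using elim by (simp_all add: n_def)
      have A1n: "antimono_on {1..} (\<lambda>j. (\<kappa> n j)\<^sup>2)" using A1 n unfolding assumption_A1_def by blast
      have cut: "real (cutoff \<kappa> n) > 0"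
      proof -
        have "0 < c\<^sub>0 * real n powr (2 - 4 * r)" using scales(1) n0 by simp
        then show ?thesis using elim unfolding n_def by linarith
      qed
      have "(1 + (x i - 1)) * real (cutoff \<kappa> n) = real (k i)" using cut by (simp add: x_def n_def)
      then have "(\<kappa> n (k i))\<^sup>2 < C\<^sub>4 * x i powr (- p) * (\<kappa> n (cutoff \<kappa> n))\<^sup>2"
        using A4'[of "x i - 1" n] elim(1) n by simp
      then have C4: "C\<^sub>4 * x i powr (- p) > 0"
        by (smt (verit) mult_nonpos_nonneg zero_le_power2)
      have "(\<kappa> n (cutoff \<kappa> n))\<^sup>2 \<le> (\<kappa> n 1)\<^sup>2" using A1n cut by (auto simp: monotone_on_def)
      also have "\<dots> \<le> C\<^sub>0 * real n powr (2 * r - 2)" using elim by (simp add: n_def)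
      finally have "(\<kappa> n (k i))\<^sup>2 \<le> C\<^sub>4 * x i powr (- p) * (C\<^sub>0 * real n powr (2 * r - 2))"
        using C4 \<open>(\<kappa> n (k i))\<^sup>2 < _\<close> mult_left_mono[of "(\<kappa> n (cutoff \<kappa> n))\<^sup>2" "C\<^sub>0 * real n powr (2 * r - 2)" "C\<^sub>4 * x i powr (- p)"]
        by linarith
      moreover have "(norm (tail \<phi> (k i) f))\<^sup>2 \<le> (C * real n powr (- r))\<^sup>2"
        using rate[of i] by (intro power_mono) (auto simp: n_def)
      ultimately have "(real n)\<^sup>2 * ((\<kappa> n (k i))\<^sup>2 * (norm (tail \<phi> (k i) f))\<^sup>2) \<le>
          (real n)\<^sup>2 * ((C\<^sub>4 * x i powr (- p) * (C\<^sub>0 * real n powr (2 * r - 2))) * (C * real n powr (- r))\<^sup>2)"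
        using C4 scales(2) by (intro mult_left_mono mult_mono) auto
      also have "\<dots> = C\<^sub>4 * C\<^sub>0 * C\<^sup>2 * x i powr (- p)"
      proof -
        have "(real n)\<^sup>2 = real n powr 2" using n0 by simp
        moreover have "(real n powr (- r))\<^sup>2 = real n powr (- 2 * r)" by (simp add: power2_eq_square powr_add[symmetric])
        moreover have "2 + ((2 * r - 2) + (- 2 * r)) = 0" by simp
        ultimately have "(real n)\<^sup>2 * (real n powr (2 * r - 2) * (real n powr (- r))\<^sup>2) = 1"
          using n0 by (simp only: powr_add[symmetric]) simp
        then show ?thesis by (simp add: power_mult_distrib mult_ac)
      qed
      finally show ?case
        using signal_energy_tail_le[where \<kappa> = \<kappa>, OF basis A1n k[of i], of f] by (simp add: n_def)
    qed
  qed
qed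

section \<open>Besov balls as maxisets\<close>

theorem theorem4p4:
  fixes r \<sigma> s :: real
    and \<phi> :: "nat \<Rightarrow> L2"
    and M :: "'w measure"
    and \<xi> :: "nat \<Rightarrow> 'w \<Rightarrow> real"
    and \<kappa> :: "nat \<Rightarrow> nat \<Rightarrow> real"
  assumes "0 < r" and "r < 1 / 2" and "0 < \<sigma>"
    and "orthonormal_basis \<phi>"
    and "standard_gaussian_sequence M \<xi>"
    and "assumption_A1 \<kappa>"
    and "assumption_A2 \<sigma> \<kappa>"
    and "assumption_A3 r \<kappa>"
    and "assumption_A4 \<kappa>"
    and "assumption_A5 \<kappa>"
    and "s = r / (2 - 4 * r)"
  shows "r = 2 * s / (1 + 4 * s) \<and>
    (\<forall>P\<^sub>0>0. maxiset M \<phi> r (test_statistic \<sigma> \<phi> \<xi> \<kappa>) (besov_ball \<phi> s P\<^sub>0))"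
proof (intro conjI allI impI)
  note basis = assms(4)
  have s: "s > 0" and rs: "(2 - 4 * r) * s = r"
    using assms(1,2) by (simp_all add: assms(11))
  have "r * (1 + 4 * s) = 2 * s" using rs by (simp add: algebra_simps)
  then show "r = 2 * s / (1 + 4 * s)" using s by (simp add: eq_divide_eq)
  let ?T = "test_statistic \<sigma> \<phi> \<xi> \<kappa>"
  have M: "prob_space M" "\<And>n. ?T n 0 \<in> borel_measurable M"
    using test_statistic_measurable[OF assms(5)] assms(5) by (auto simp only: standard_gaussian_sequence_def)
  obtain c\<^sub>0 C\<^sub>0 where c0: "c\<^sub>0 > 0" "C\<^sub>0 > 0" and scales:
    "\<forall>\<^sub>F n in sequentially. c\<^sub>0 * real n powr (2 * r - 2) \<le> (\<kappa> n (cutoff \<kappa> n))\<^sup>2 \<and>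
       (\<kappa> n 1)\<^sup>2 \<le> C\<^sub>0 * real n powr (2 * r - 2) \<and>
       c\<^sub>0 * real n powr (2 - 4 * r) \<le> real (cutoff \<kappa> n) \<and>
       real (cutoff \<kappa> n) \<le> C\<^sub>0 * real n powr (2 - 4 * r)"
    by (rule coefficient_scales[OF assms(3,6,7,8,10)])
  obtain V v\<^sub>1 v\<^sub>2 where V: "0 < v\<^sub>1" "\<And>n. n \<ge> 1 \<Longrightarrow> v\<^sub>1 \<le> V n" "\<And>n. n \<ge> 1 \<Longrightarrow> V n \<le> v\<^sub>2"
    and limit: "\<And>m f c. filterlim m at_top sequentially \<Longrightarrow> (\<And>i. m i \<ge> 1) \<Longrightarrow>
       (\<And>i. norm (f i) \<le> c * real (m i) powr (- r)) \<Longrightarrow>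
       gaussian_limit M ?T V m f (\<lambda>i. signal_energy \<kappa> \<phi> (m i) (f i))"
  proof (rule normal_approximation[OF assms(1-8,10)], goal_cases)
    case (1 V v\<^sub>1 v\<^sub>2)
    show thesis by (rule 1(1)[OF 1(2)]) (fact 1)+
  qed
  have null: "gaussian_limit M ?T V m (\<lambda>_. 0) (\<lambda>_. 0)"
    if "filterlim m at_top sequentially" "\<And>i. m i \<ge> 1" for m
    using limit[OF that, of "\<lambda>_. 0" 0] by (simp add: signal_energy_def)
  fix P\<^sub>0 :: real assume "P\<^sub>0 > 0"
  let ?U = "besov_ball \<phi> s P\<^sub>0"
  show "maxiset M \<phi> r ?T ?U"
    unfolding maxiset_def
  proof (intro conjI allI impI)
    show "bounded ?U" "closed ?U" "convex ?U" "ortho_symmetric \<phi> ?U"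
      by (rule bounded_besov_ball closed_besov_ball convex_besov_ball ortho_symmetric_besov_ball, rule basis)+
  next
    fix \<gamma> c C :: real and m f
    assume "\<gamma> > 0" "c > 0" "c < C" and rate: "alternatives_of_rate r c C m f"
      and f: "\<forall>i. f i \<in> (\<lambda>g. \<gamma> *\<^sub>R g) ` ?U"
    have m: "filterlim m at_top sequentially" "\<And>i. m i \<ge> 1"
      and norms: "\<And>i. c * real (m i) powr (- r) < norm (f i)" "\<And>i. norm (f i) < C * real (m i) powr (- r)"
      using rate by (auto simp: alternatives_of_rate_def filterlim_subseq)
    obtain b where b: "b > 0" "\<forall>\<^sub>F i in sequentially. b \<le> signal_energy \<kappa> \<phi> (m i) (f i)"
      using besov_alternatives_signal_energy[OF basis assms(6,10) s _ rs c0(1) _ m(1) _ norms(1) \<open>c > 0\<close>, of P\<^sub>0 \<gamma>]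
        eventually_mono[OF scales] \<open>P\<^sub>0 > 0\<close> f by auto
    show "consistent M ?T m f"
    proof (rule consistent_of_signal_energy_bounded_below[OF M _ _ null[OF m] limit[OF m] b])
      show "0 < V (m i)" "V (m i) \<le> v\<^sub>2" for i using V(1) V(2,3)[OF m(2)[of i]] by linarith+
      show "norm (f i) \<le> C * real (m i) powr (- r)" for i using norms(2)[of i] by simp
    qed
  next
    fix f V' assume f: "f \<notin> generated_space ?U" and V': "convex V'" "ortho_symmetric \<phi> V'" "f \<in> V'"
    have "\<exists>k\<ge>1. K < (2 * real k) powr (2 * s) * (norm (tail \<phi> k f))\<^sup>2 \<and> norm (tail \<phi> k f) < \<delta>"
      if "\<delta> > 0" for K \<delta>
      using large_tail_index[OF basis s \<open>P\<^sub>0 > 0\<close> f that] by metis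
    then obtain k m where mono: "strict_mono m" and m: "\<And>i. m i \<ge> 1" and k: "\<And>i. k i \<ge> 1"
      and large: "\<And>i. real i < (2 * real (k i)) powr (2 * s) * (norm (tail \<phi> (k i) f))\<^sup>2"
      and norms: "\<And>i. real (m i) powr (- r) \<le> norm (tail \<phi> (k i) f)"
        "\<And>i. norm (tail \<phi> (k i) f) \<le> 2 powr r * real (m i) powr (- r)"
      by (rule exists_matching_sample_sizes[OF assms(1), of s "\<lambda>k. norm (tail \<phi> k f)"]) auto
    have m_lim: "filterlim m at_top sequentially" using mono by (rule filterlim_subseq)
    let ?g = "\<lambda>i. tail \<phi> (k i) f"
    have "(\<lambda>i. signal_energy \<kappa> \<phi> (m i) (?g i)) \<longlonglongrightarrow> 0"
      by (rule tail_alternatives_signal_energy[OF basis assms(6,9) s rs c0 _ m_lim k large norms(2)])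
        (rule eventually_mono[OF scales], blast)
    then have "inconsistent M ?T m ?g"
      using V(1) V(2)[OF m]
      by (intro inconsistent_of_signal_energy_vanishing[OF M _ _ null[OF m_lim m] limit[OF m_lim m norms(2)]]) auto
    moreover have "alternatives_of_rate r (1/2) (2 * 2 powr r) m ?g"
      unfolding alternatives_of_rate_def
    proof (intro conjI allI mono m)
      fix i
      have w: "real (m i) powr (- r) > 0" using m[of i] by simp
      then show "1 / 2 * real (m i) powr (- r) < norm (?g i)" using norms(1)[of i] by linarith
      have "2 powr r * real (m i) powr (- r) > 0" using w by simp
      then show "norm (?g i) < 2 * 2 powr r * real (m i) powr (- r)"
        using norms(2)[of i] by (simp only: mult.assoc)
    qed
    moreover have "\<forall>i. ?g i \<in> V'" using tail_mem_convex_ortho_symmetric[OF basis V'] by blast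
    moreover have "(1/2 :: real) < 2 * 2 powr r"
      using ge_one_powr_ge_zero[of 2 r] assms(1) by simp
    ultimately show "\<exists>c>0. \<exists>C>c. \<exists>m g. alternatives_of_rate r c C m g \<and> (\<forall>i. g i \<in> V') \<and> inconsistent M ?T m g"
      by (intro exI[of _ "1/2 :: real"] conjI exI[of _ "2 * 2 powr r"] exI[of _ m] exI[of _ ?g]) simp_all
  qed
qed

end
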